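(* Let $\mathfrak M=\{M^\lambda:\lambda\in\Lambda\}$ be a weight matrix and $p,q,r\ge1$. (1) If $\mathfrak M$ satisfies $(\mathfrak M_{(FdB)})$, then the composition map $\mathrm{comp}^{(\mathfrak M)}:\mathcal E^{(\mathfrak M)}(\mathbb R^p,\mathbb R^q)\times\mathcal E^{(\mathfrak M)}(\mathbb R^q,\mathbb R^r)\to\mathcal E^{(\mathfrak M)}(\mathbb R^p,\mathbb R^r)$, $(g,f)\mapsto f\circ g$, is continuous. (2) If $\mathfrak M$ satisfies $(\mathfrak M_{\{FdB\}})$, then for each $f\in\mathcal E^{\{\mathfrak M\}}(\mathbb R^q,\mathbb R^r)$ the map $\mathcal E^{\{\mathfrak M\}}(\mathbb R^p,\mathbb R^q)\to\mathcal E^{\{\mathfrak M\}}(\mathbb R^p,\mathbb R^r)$, $g\mapsto f\circ g$, is continuous, and the composition map $\mathrm{comp}^{\{\mathfrak M\}}:\mathcal E^{\{\mathfrak M\}}(\mathbb R^p,\mathbb R^q)\times\mathcal E^{\{\mathfrak M\}}(\mathbb R^q,\mathbb R^r)\to\mathcal E^{\{\mathfrak M\}}(\mathbb R^p,\mathbb R^r)$, $(g,f)\mapsto f\circ g$, is sequentially continuous.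
   Context: A weight matrix is a family $\mathfrak M=\{M^\lambda\in\mathbb R_{>0}^{\mathbb N}:\lambda\in\Lambda\}$, $\Lambda$ an ordered subset of $\mathbb R$, with each $(k!M^\lambda_k)_k$ log-convex, $M^\lambda_0=1$, $(k!M^\lambda_k)^{1/k}\to\infty$, and $M^\lambda\le M^\mu$ for $\lambda\le\mu$. For $M\in\mathbb R_{>0}^{\mathbb N}$, compact $K\subseteq\mathbb R^n$, $\rho>0$: $\|f\|^M_{K,\rho}:=\sup\{\|f^{(k)}(x)\|/(k!\rho^kM_k):x\in K,k\in\mathbb N\}$, $\mathcal E^M_\rho(K,\mathbb R^m)$ the Banach space of smooth maps on $K$ with finite norm, $\mathcal E^{\{M\}}(K,\mathbb R^m)=\varinjlim_m\mathcal E^M_m(K,\mathbb R^m)$; $\mathcal E^{(M)}(U,\mathbb R^m)$ is the Fréchet space of smooth $f$ on open $U$ with all $\|f\|^M_{K,\rho}<\infty$ ($K\subseteq U$ compact, $\rho>0$). Topologized spaces: $\mathcal E^{(\mathfrak M)}(U,\mathbb R^m):=\varprojlim_\lambda\mathcal E^{(M^\lambda)}(U,\mathbb R^m)$ and $\mathcal E^{\{\mathfrak M\}}(U,\mathbb R^m):=\varprojlim_{K\subseteq U}\varinjlim_\lambda\mathcal E^{\{M^\lambda\}}(K,\mathbb R^m)$ (functions whose restrictions to every compact $K$ lie in some $\mathcal E^{\{M^\lambda\}}(K,\mathbb R^m)$); products carry the product topology. $M^\circ_k:=\max\{M_jM_{\alpha_1}\cdots M_{\alpha_j}:\alpha_i\ge1,\sum\alpha_i=k\}$,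 $M^\circ_0=1$; $M\preceq N$ iff $\exists C,\rho>0\ \forall k:M_k\le C\rho^kN_k$. $(\mathfrak M_{(FdB)})$: $\forall\lambda\exists\mu:(M^\mu)^\circ\preceq M^\lambda$; $(\mathfrak M_{\{FdB\}})$: $\forall\lambda\exists\mu:(M^\lambda)^\circ\preceq M^\mu$. *)

theory Defs
  imports "HOL-Analysis.Analysis"
begin

definition weight_matrix :: "real set \<Rightarrow> (real \<Rightarrow> nat \<Rightarrow> real) \<Rightarrow> bool" where
  "weight_matrix \<Lambda> M \<longleftrightarrow>
     \<Lambda> \<noteq> {} \<and>
     (\<forall>l\<in>\<Lambda>. (\<forall>k. 0 < M l k) \<and> M l 0 = 1 \<and>
        (\<forall>k\<ge>1. (fact k * M l k)^2 \<le> (fact (k - 1) * M l (k - 1)) * (fact (k + 1) * M l (k + 1))) \<and>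
        filterlim (\<lambda>k. root k (fact k * M l k)) at_top sequentially) \<and>
     (\<forall>l\<in>\<Lambda>. \<forall>m\<in>\<Lambda>. l \<le> m \<longrightarrow> (\<forall>k. M l k \<le> M m k))"

definition circ_seq :: "(nat \<Rightarrow> real) \<Rightarrow> nat \<Rightarrow> real" where
  "circ_seq M k = (if k = 0 then 1 else
     Max {M (length as) * prod_list (map M as) | as. (\<forall>a\<in>set as. 1 \<le> a) \<and> sum_list as = k})"

definition seq_preceq :: "(nat \<Rightarrow> real) \<Rightarrow> (nat \<Rightarrow> real) \<Rightarrow> bool" where
  "seq_preceq M N \<longleftrightarrow> (\<exists>C>0. \<exists>\<rho>>0. \<forall>k. M k \<le> C * \<rho>^k * N k)"

definition FdB_Beurling :: "real set \<Rightarrow> (real \<Rightarrow> nat \<Rightarrow> real) \<Rightarrow> bool" where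
  "FdB_Beurling \<Lambda> M \<longleftrightarrow> (\<forall>l\<in>\<Lambda>. \<exists>m\<in>\<Lambda>. seq_preceq (circ_seq (M m)) (M l))"

definition FdB_Roumieu :: "real set \<Rightarrow> (real \<Rightarrow> nat \<Rightarrow> real) \<Rightarrow> bool" where
  "FdB_Roumieu \<Lambda> M \<longleftrightarrow> (\<forall>l\<in>\<Lambda>. \<exists>m\<in>\<Lambda>. seq_preceq (circ_seq (M l)) (M m))"

text \<open>\<open>nderiv k f vs x\<close> is $f^{(k)}(x)(v_1,\dots,v_k)$ for \<open>vs = [v_1,\dots,v_k]\<close>.\<close>
fun nderiv :: "nat \<Rightarrow> ('a::real_normed_vector \<Rightarrow> 'b::real_normed_vector) \<Rightarrow> 'a list \<Rightarrow> 'a \<Rightarrow> 'b" where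
  "nderiv 0 f vs x = f x"
| "nderiv (Suc k) f vs x = frechet_derivative (\<lambda>y. nderiv k f (tl vs) y) (at x) (hd vs)"

definition smooth :: "('a::real_normed_vector \<Rightarrow> 'b::real_normed_vector) \<Rightarrow> bool" where
  "smooth f \<longleftrightarrow> (\<forall>k vs x. length vs = k \<longrightarrow> (\<lambda>y. nderiv k f vs y) differentiable (at x))"

definition dnorm :: "nat \<Rightarrow> ('a::real_normed_vector \<Rightarrow> 'b::real_normed_vector) \<Rightarrow> 'a \<Rightarrow> real" where
  "dnorm k f x = Sup {norm (nderiv k f vs x) | vs. length vs = k \<and> (\<forall>v\<in>set vs. norm v \<le> 1)}"

definition wquot_set :: "(nat \<Rightarrow> real) \<Rightarrow> 'a set \<Rightarrow> real \<Rightarrow> ('a::real_normed_vector \<Rightarrow> 'b::real_normed_vector) \<Rightarrow> real set" where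
  "wquot_set M K \<rho> f = {dnorm k f x / (fact k * \<rho>^k * M k) | k x. x \<in> K}"

text \<open>$\|f\|^M_{K,\rho}$ (finite iff \<open>wfin\<close>).\<close>
definition wnorm :: "(nat \<Rightarrow> real) \<Rightarrow> 'a set \<Rightarrow> real \<Rightarrow> ('a::real_normed_vector \<Rightarrow> 'b::real_normed_vector) \<Rightarrow> real" where
  "wnorm M K \<rho> f = Sup (insert 0 (wquot_set M K \<rho> f))"

definition wfin :: "(nat \<Rightarrow> real) \<Rightarrow> 'a set \<Rightarrow> real \<Rightarrow> ('a::real_normed_vector \<Rightarrow> 'b::real_normed_vector) \<Rightarrow> bool" where
  "wfin M K \<rho> f \<longleftrightarrow> bdd_above (wquot_set M K \<rho> f)"

definition EB :: "real set \<Rightarrow> (real \<Rightarrow> nat \<Rightarrow> real) \<Rightarrow> ('a::euclidean_space \<Rightarrow> 'b::euclidean_space) set" where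
  "EB \<Lambda> M = {f. smooth f \<and> (\<forall>l\<in>\<Lambda>. \<forall>K. compact K \<longrightarrow> (\<forall>\<rho>>0. wfin (M l) K \<rho> f))}"

text \<open>Projective limit topology = locally convex topology of all seminorms
  $\|\cdot\|^{M^\lambda}_{K,\rho}$, generated by the corresponding open balls.\<close>
definition EB_top :: "real set \<Rightarrow> (real \<Rightarrow> nat \<Rightarrow> real) \<Rightarrow> ('a::euclidean_space \<Rightarrow> 'b::euclidean_space) topology" where
  "EB_top \<Lambda> M = topology_generated_by (insert (EB \<Lambda> M)
     {{g \<in> EB \<Lambda> M. wnorm (M l) K \<rho> (\<lambda>x. g x - f x) < \<epsilon>} | f l K \<rho> \<epsilon>.
        f \<in> EB \<Lambda> M \<and> l \<in> \<Lambda> \<and> compact K \<and> \<rho> > 0 \<and> \<epsilon> > 0})"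

text \<open>Underlying space of $\varinjlim_\lambda \mathcal E^{\{M^\lambda\}}(K)$ (maps considered modulo
  their jets on $K$, which is automatic for the admissible seminorms below).\<close>
definition EK :: "real set \<Rightarrow> (real \<Rightarrow> nat \<Rightarrow> real) \<Rightarrow> 'a set \<Rightarrow> ('a::euclidean_space \<Rightarrow> 'b::euclidean_space) set" where
  "EK \<Lambda> M K = {f. smooth f \<and> (\<exists>l\<in>\<Lambda>. \<exists>m::nat. m > 0 \<and> wfin (M l) K (real m) f)}"

definition seminorm_on :: "('a \<Rightarrow> 'b::real_normed_vector) set \<Rightarrow> (('a \<Rightarrow> 'b) \<Rightarrow> real) \<Rightarrow> bool" where
  "seminorm_on V p \<longleftrightarrow> (\<forall>f\<in>V. 0 \<le> p f) \<and> (\<forall>f\<in>V. \<forall>c. p (\<lambda>x. c *\<^sub>R f x) = \<bar>c\<bar> * p f) \<and>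
     (\<forall>f\<in>V. \<forall>g\<in>V. p (\<lambda>x. f x + g x) \<le> p f + p g)"

text \<open>Continuous seminorms of the locally convex inductive limit
  $\varinjlim_{\lambda}\varinjlim_m \mathcal E^{M^\lambda}_m(K)$: exactly the seminorms whose
  restriction to every step (Banach space) is continuous.\<close>
definition adm_seminorm :: "real set \<Rightarrow> (real \<Rightarrow> nat \<Rightarrow> real) \<Rightarrow> 'a set \<Rightarrow> (('a::euclidean_space \<Rightarrow> 'b::euclidean_space) \<Rightarrow> real) \<Rightarrow> bool" where
  "adm_seminorm \<Lambda> M K p \<longleftrightarrow> seminorm_on (EK \<Lambda> M K) p \<and>
     (\<forall>l\<in>\<Lambda>. \<forall>m::nat. m > 0 \<longrightarrow> (\<exists>C. \<forall>f. smooth f \<and> wfin (M l) K (real m) f \<longrightarrow> p f \<le> C * wnorm (M l) K (real m) f))"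

definition ER :: "real set \<Rightarrow> (real \<Rightarrow> nat \<Rightarrow> real) \<Rightarrow> ('a::euclidean_space \<Rightarrow> 'b::euclidean_space) set" where
  "ER \<Lambda> M = {f. smooth f \<and> (\<forall>K. compact K \<longrightarrow> (\<exists>l\<in>\<Lambda>. \<exists>m::nat. m > 0 \<and> wfin (M l) K (real m) f))}"

text \<open>Projective limit over compact \<open>K\<close> (initial topology w.r.t. the maps into the
  inductive limits), generated by the balls of all admissible seminorms.\<close>
definition ER_top :: "real set \<Rightarrow> (real \<Rightarrow> nat \<Rightarrow> real) \<Rightarrow> ('a::euclidean_space \<Rightarrow> 'b::euclidean_space) topology" where
  "ER_top \<Lambda> M = topology_generated_by (insert (ER \<Lambda> M)
     {{g \<in> ER \<Lambda> M. p (\<lambda>x. g x - f x) < \<epsilon>} | f K p \<epsilon>.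
        f \<in> ER \<Lambda> M \<and> compact K \<and> adm_seminorm \<Lambda> M K p \<and> \<epsilon> > 0})"

definition seq_continuous_map :: "'a topology \<Rightarrow> 'b topology \<Rightarrow> ('a \<Rightarrow> 'b) \<Rightarrow> bool" where
  "seq_continuous_map X Y h \<longleftrightarrow> h ` topspace X \<subseteq> topspace Y \<and>
     (\<forall>s l. (\<forall>n. s n \<in> topspace X) \<and> limitin X s l sequentially \<longrightarrow> limitin Y (h \<circ> s) (h l) sequentially)"

end

theory Submission
  imports Defs
begin

text \<open>Differentiating a composition puts the new direction into a block of its own or into an
  existing block, so the derivatives of \<open>f \<circ> g\<close> are sums over set partitions, and weighted sums over
  partitions grow only geometrically beyond \<open>k!\<close>. This bounds \<open>f \<circ> g\<close> in the weight \<open>M\<^sup>\<circ>\<close>.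
  If the target norm uses twice the geometric rate of that bound, high orders of \<open>f \<circ> g - f \<circ> h\<close> are
  uniformly small and low orders are handled by the mean value theorem: \<open>g \<mapsto> f \<circ> g\<close> is
  uniformly continuous on bounded sets from one Banach step to another, and
  \<open>f \<circ> g - f\<^sub>0 \<circ> g\<^sub>0 = (f - f\<^sub>0) \<circ> g + (f\<^sub>0 \<circ> g - f\<^sub>0 \<circ> g\<^sub>0)\<close> settles the Beurling case.
  In the Roumieu case a basic neighbourhood of zero consists of the finite sums \<open>\<Sum>i<n. u i\<close> with \<open>u i\<close> in the
  \<open>\<delta> i\<close>-ball of step \<open>i\<close>; adding the \<open>u i\<close> one at a time and summing the errors gives continuity without
  any compactness of the inclusions. A sequence that is null for all continuous seminorms is null in a
  single step, since otherwise a diagonal weight would give a continuous seminorm that is unbounded on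
  it; hence sequential continuity.\<close>

section \<open>Directional derivatives of higher order\<close>

text \<open>The rate of the composition estimate is \<open>s * r * (2 + A * t)\<close>:
  \<open>s\<close> and \<open>t\<close> are the radii for \<open>g\<close> and \<open>f\<close>,
  \<open>A\<close> bounds the norm of \<open>g\<close>, and \<open>r\<close> is the loss in passing
  from the composed weight to the target weight. Much turns on the order in which these constants
  can be chosen. In the Beurling case the target rate is prescribed, so \<open>s\<close> is fixed
  first, \<open>A\<close> is read off from \<open>s\<close>, and \<open>t = 1 / A\<close> is
  available because \<open>f\<close> is controlled at every radius. In the Roumieu case
  \<open>t\<close> is dictated by \<open>f\<close>, and the target rate is allowed to grow instead.
  There the target step depends on the steps of both \<open>g\<close> and \<open>f\<close>. For
  fixed \<open>f\<close> the tolerances can be chosen step by step along \<open>g\<close>, because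
  \<open>A\<close> and the ball containing all values stay the same while the steps grow. For
  varying \<open>f\<close> the tolerances would be indexed by pairs of steps; for sequences both
  differences stay in one step. Derivatives are functions of a list of directions. Expanding a slot
  in a basis reduces norm bounds and differentiation with moving directions to the differentiability
  with fixed directions that \<open>smooth\<close> provides.\<close>

definition dd :: "('a::real_normed_vector \<Rightarrow> 'b::real_normed_vector) \<Rightarrow> 'a list \<Rightarrow> 'a \<Rightarrow> 'b" where
  "dd f vs x = nderiv (length vs) f vs x"

lemma dd_Nil [simp]: "dd f [] = f"
  by (simp add: dd_def fun_eq_iff)

lemma dd_Cons: "dd f (v # vs) x = frechet_derivative (dd f vs) (at x) v"
  by (simp add: dd_def[abs_def])

lemma smooth_iff_dd: "smooth f \<longleftrightarrow> (\<forall>vs x. dd f vs differentiable (at x))"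
  by (auto simp: smooth_def dd_def[abs_def])

lemma dd_has_derivative:
  "smooth f \<Longrightarrow> (dd f vs has_derivative (\<lambda>v. dd f (v # vs) x)) (at x)"
  unfolding dd_Cons using frechet_derivative_works[of "dd f vs" "at x"]
  by (simp add: smooth_iff_dd)

lemma dd_Cons_eqI:
  assumes "(dd f vs has_derivative D) (at x)"
  shows "dd f (v # vs) x = D v"
  using frechet_derivative_at[OF assms] by (simp add: dd_Cons)

text \<open>\<open>smooth\<close> only speaks of each fixed list of directions. The outermost slot
  is linear as a Frechet derivative; for a deeper slot the identity holds at every base point, so it
  may be differentiated along the directions in \<open>cs\<close> one after the other.\<close>

lemma dd_linear_slot:
  assumes "smooth f"
  shows "linear (\<lambda>w. dd f (cs @ w # ds) x)"
proof (induction cs arbitrary: x)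
  case Nil
  then show ?case using has_derivative_linear[OF dd_has_derivative[OF assms]] by simp
next
  case (Cons c cs)
  show ?case
  proof (rule linearI)
    fix v w
    have "dd f (cs @ (v + w) # ds) = (\<lambda>y. dd f (cs @ v # ds) y + dd f (cs @ w # ds) y)"
      by (rule ext) (rule linear_add[OF Cons])
    then have "(dd f (cs @ (v + w) # ds) has_derivative
        (\<lambda>u. dd f (u # cs @ v # ds) x + dd f (u # cs @ w # ds) x)) (at x)"
      by (auto intro!: has_derivative_add dd_has_derivative assms)
    from dd_Cons_eqI[OF this]
    show "dd f ((c # cs) @ (v + w) # ds) x = dd f ((c # cs) @ v # ds) x + dd f ((c # cs) @ w # ds) x"
      by simp
  next
    fix r w
    have "dd f (cs @ (r *\<^sub>R w) # ds) = (\<lambda>y. r *\<^sub>R dd f (cs @ w # ds) y)"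
      by (rule ext) (rule linear_scale[OF Cons])
    then have "(dd f (cs @ (r *\<^sub>R w) # ds) has_derivative (\<lambda>u. r *\<^sub>R dd f (u # cs @ w # ds) x)) (at x)"
      by (auto intro!: has_derivative_scaleR_right dd_has_derivative assms)
    from dd_Cons_eqI[OF this]
    show "dd f ((c # cs) @ (r *\<^sub>R w) # ds) x = r *\<^sub>R dd f ((c # cs) @ w # ds) x"
      by simp
  qed
qed

text \<open>Trades a variable direction for finitely many fixed ones, for which smoothness gives
  information.\<close>

lemma dd_slot_expand:
  fixes f :: "'a::euclidean_space \<Rightarrow> 'b::real_normed_vector"
  assumes "smooth f"
  shows "dd f (cs @ w # ds) x = (\<Sum>b\<in>Basis. (w \<bullet> b) *\<^sub>R dd f (cs @ b # ds) x)"
proof -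
  have "dd f (cs @ w # ds) x = dd f (cs @ (\<Sum>b\<in>Basis. (w \<bullet> b) *\<^sub>R b) # ds) x"
    by (simp add: euclidean_representation)
  also have "\<dots> = (\<Sum>b\<in>Basis. (w \<bullet> b) *\<^sub>R dd f (cs @ b # ds) x)"
    by (simp add: linear_sum[OF dd_linear_slot[OF assms]] linear_scale[OF dd_linear_slot[OF assms]])
  finally show ?thesis .
qed

lemma dd_scale_slots:
  assumes "smooth f"
  shows "dd f (cs @ map (\<lambda>v. c v *\<^sub>R u v) vs) x = prod_list (map c vs) *\<^sub>R dd f (cs @ map u vs) x"
proof (induction vs arbitrary: cs)
  case (Cons v vs)
  show ?case
    using Cons[of "cs @ [c v *\<^sub>R u v]"] linear_scale[OF dd_linear_slot[OF assms], of cs "c v" "u v"]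
    by simp
qed simp

lemma dd_add:
  assumes "smooth f" "smooth g"
  shows "dd (\<lambda>x. f x + g x) vs = (\<lambda>x. dd f vs x + dd g vs x)"
proof (induction vs)
  case (Cons v vs)
  show ?case
    by (rule ext, rule dd_Cons_eqI, unfold Cons)
      (intro has_derivative_add dd_has_derivative assms)
qed simp

lemma dd_scaleR:
  assumes "smooth f"
  shows "dd (\<lambda>x. c *\<^sub>R f x) vs = (\<lambda>x. c *\<^sub>R dd f vs x)"
proof (induction vs)
  case (Cons v vs)
  show ?case
    by (rule ext, rule dd_Cons_eqI, unfold Cons)
      (intro has_derivative_scaleR_right dd_has_derivative assms)
qed simp

lemma smooth_add: "smooth f \<Longrightarrow> smooth g \<Longrightarrow> smooth (\<lambda>x. f x + g x)"
  by (subst smooth_iff_dd, simp add: dd_add) (simp add: smooth_iff_dd)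

lemma smooth_scaleR: "smooth f \<Longrightarrow> smooth (\<lambda>x. c *\<^sub>R f x)"
  by (subst smooth_iff_dd, simp add: dd_scaleR) (simp add: smooth_iff_dd)

lemma smooth_diff: "smooth f \<Longrightarrow> smooth g \<Longrightarrow> smooth (\<lambda>x. f x - g x)"
  using smooth_add[of f "\<lambda>x. (-1) *\<^sub>R g x"] smooth_scaleR[of g "-1"] by simp

lemma dd_diff:
  assumes "smooth f" "smooth g"
  shows "dd (\<lambda>x. f x - g x) vs = (\<lambda>x. dd f vs x - dd g vs x)"
  using dd_add[OF assms(1) smooth_scaleR[OF assms(2)], of "-1" vs] dd_scaleR[OF assms(2), of "-1" vs]
  by simp

lemma dd_zero [simp]: "dd (\<lambda>x. 0) vs = (\<lambda>x. 0)"
proof (induction vs)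
  case (Cons v vs)
  show ?case by (rule ext, rule dd_Cons_eqI, unfold Cons) (rule has_derivative_const)
qed simp

lemma smooth_zero: "smooth (\<lambda>x. 0)"
  by (simp add: smooth_iff_dd)

text \<open>Finite dimension enters here: the last variable slot is expanded in the basis and each
  basis vector is pushed into the tail \<open>ds\<close>, so \<open>ds\<close> has to be arbitrary
  in the induction. The constant may depend on the base point \<open>x\<close>.\<close>

lemma dd_bounded:
  fixes f :: "'a::euclidean_space \<Rightarrow> 'b::real_normed_vector"
  assumes "smooth f"
  shows "\<exists>C\<ge>0. \<forall>vs. length vs = n \<longrightarrow> norm (dd f (vs @ ds) x) \<le> C * prod_list (map norm vs)"
proof (induction n arbitrary: ds)
  case 0
  then show ?case by (intro exI[of _ "norm (dd f ds x)"]) simp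
next
  case (Suc n)
  then have "\<forall>b. \<exists>C\<ge>0. \<forall>vs. length vs = n \<longrightarrow> norm (dd f (vs @ b # ds) x) \<le> C * prod_list (map norm vs)"
    by blast
  then obtain C where C: "\<And>b. C b \<ge> 0"
    "\<And>b vs. length vs = n \<Longrightarrow> norm (dd f (vs @ b # ds) x) \<le> C b * prod_list (map norm vs)"
    by metis
  show ?case
  proof (intro exI[of _ "\<Sum>b\<in>Basis. C b"] conjI allI impI)
    fix vs :: "'a list" assume "length vs = Suc n"
    then obtain us w where vs: "vs = us @ [w]" "length us = n"
      by (metis length_Suc_conv_rev)
    have nn: "0 \<le> prod_list (map norm us)" by (rule prod_list_nonneg) auto
    have "norm (dd f (vs @ ds) x) = norm (\<Sum>b\<in>Basis. (w \<bullet> b) *\<^sub>R dd f (us @ b # ds) x)"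
      using dd_slot_expand[OF assms, of us w ds x] by (simp add: vs)
    also have "\<dots> \<le> (\<Sum>b\<in>Basis. norm w * (C b * prod_list (map norm us)))"
      by (intro sum_norm_le) (auto intro!: mult_mono C vs nn simp: Basis_le_norm)
    also have "\<dots> = (\<Sum>b\<in>Basis. C b) * prod_list (map norm vs)"
      by (simp add: vs sum_distrib_right sum_distrib_left mult_ac)
    finally show "norm (dd f (vs @ ds) x) \<le> (\<Sum>b\<in>Basis. C b) * prod_list (map norm vs)" .
  qed (simp add: C sum_nonneg)
qed

section \<open>Operator norms of the iterated derivatives\<close>

lemma dnorm_dd: "dnorm k f x = Sup {norm (dd f vs x) | vs. length vs = k \<and> (\<forall>v\<in>set vs. norm v \<le> 1)}"
  unfolding dnorm_def dd_def by (rule arg_cong[of _ _ Sup]) auto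

lemma prod_list_norm_le_power:
  fixes ws :: "'a::real_normed_vector list"
  assumes "\<And>w. w \<in> set ws \<Longrightarrow> norm w \<le> R"
  shows "prod_list (map norm ws) \<le> R ^ length ws"
  using assms
proof (induction ws)
  case (Cons w ws)
  have "0 \<le> R" using Cons.prems[of w] norm_ge_zero[of w] by (simp del: norm_ge_zero)
  then show ?case using Cons by (auto intro!: mult_mono prod_list_nonneg)
qed simp

lemma bdd_above_dnorm:
  fixes f :: "'a::euclidean_space \<Rightarrow> 'b::real_normed_vector"
  assumes "smooth f"
  shows "bdd_above {norm (dd f vs x) | vs. length vs = k \<and> (\<forall>v\<in>set vs. norm v \<le> 1)}"
proof -
  obtain C where C: "C \<ge> 0" "\<And>vs. length vs = k \<Longrightarrow> norm (dd f vs x) \<le> C * prod_list (map norm vs)"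
    using dd_bounded[OF assms, of k "[]" x] by auto
  have "norm (dd f vs x) \<le> C" if "length vs = k" "\<forall>v\<in>set vs. norm v \<le> 1" for vs
  proof -
    have "prod_list (map norm vs) \<le> 1"
      using prod_list_norm_le_power[of vs 1] that by simp
    then show ?thesis using C(2)[OF that(1)] C(1) mult_left_le[of "prod_list (map norm vs)" C] by linarith
  qed
  then show ?thesis by (intro bdd_aboveI[of _ C]) auto
qed

lemma dnorm_leI:
  assumes "\<And>vs. length vs = k \<Longrightarrow> (\<And>v. v \<in> set vs \<Longrightarrow> norm v \<le> 1) \<Longrightarrow> norm (dd f vs x) \<le> c"
  shows "dnorm k f x \<le> c"
  unfolding dnorm_dd
proof (rule cSup_least)
  have "norm (dd f (replicate k 0) x) \<in> {norm (dd f vs x) | vs. length vs = k \<and> (\<forall>v\<in>set vs. norm v \<le> 1)}"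
    by (intro CollectI exI[of _ "replicate k 0"]) (auto simp: set_replicate_conv_if)
  then show "{norm (dd f vs x) | vs. length vs = k \<and> (\<forall>v\<in>set vs. norm v \<le> 1)} \<noteq> {}" by blast
qed (use assms in auto)

lemma norm_dd_le_dnorm:
  fixes f :: "'a::euclidean_space \<Rightarrow> 'b::real_normed_vector"
  assumes "smooth f"
  shows "norm (dd f vs x) \<le> dnorm (length vs) f x * prod_list (map norm vs)"
proof -
  have "norm (dd f (map sgn vs) x) \<le> dnorm (length vs) f x"
    unfolding dnorm_dd
    by (rule cSup_upper[OF _ bdd_above_dnorm[OF assms]])
      (intro CollectI exI[of _ "map sgn vs"], auto simp: norm_sgn)
  moreover have "dd f vs x = prod_list (map norm vs) *\<^sub>R dd f (map sgn vs) x"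
  proof -
    \<comment> \<open>Since \<open>sgn 0 = 0\<close>, the factorisation into norm and direction also
      holds for a vanishing slot.\<close>
    have "map (\<lambda>v. norm v *\<^sub>R sgn v) vs = vs"
      by (rule map_idI) (metis norm_sgn scaleR_zero_left sgn_div_norm sgn_zero norm_eq_zero divideR_right)
    with dd_scale_slots[OF assms, of "[]" norm sgn vs x] show ?thesis by simp
  qed
  moreover have "0 \<le> prod_list (map norm vs)" by (rule prod_list_nonneg) auto
  ultimately show ?thesis by (simp add: mult_right_mono mult.commute[of "dnorm _ _ _"] mult_left_mono)
qed

lemma dnorm_nonneg:
  fixes f :: "'a::euclidean_space \<Rightarrow> 'b::real_normed_vector"
  assumes "smooth f"
  shows "0 \<le> dnorm k f x"
proof -
  obtain e :: 'a where "norm e = 1" using norm_Basis nonempty_Basis by blast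
  then show ?thesis
    using norm_dd_le_dnorm[OF assms, of "replicate k e" x] norm_ge_zero[of "dd f (replicate k e) x"]
    by (simp add: prod_list_replicate del: norm_ge_zero)
qed

lemma norm_dd_le_dnorm_unit:
  fixes f :: "'a::euclidean_space \<Rightarrow> 'b::real_normed_vector"
  assumes "smooth f" "\<And>v. v \<in> set vs \<Longrightarrow> norm v \<le> 1"
  shows "norm (dd f vs x) \<le> dnorm (length vs) f x"
proof -
  have "prod_list (map norm vs) \<le> 1"
    using prod_list_norm_le_power[of vs 1] assms(2) by simp
  then have "dnorm (length vs) f x * prod_list (map norm vs) \<le> dnorm (length vs) f x"
    using dnorm_nonneg[OF assms(1)] by (rule mult_left_le)
  then show ?thesis using norm_dd_le_dnorm[OF assms(1), of vs x] by linarith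
qed

lemma dnorm_0 [simp]: "dnorm 0 f x = norm (f x)"
  by (simp add: dnorm_dd)

lemma dnorm_add_le:
  fixes f g :: "'a::euclidean_space \<Rightarrow> 'b::real_normed_vector"
  assumes "smooth f" "smooth g"
  shows "dnorm k (\<lambda>x. f x + g x) x \<le> dnorm k f x + dnorm k g x"
  by (rule dnorm_leI)
    (use assms in \<open>auto simp: dd_add intro!: norm_triangle_le add_mono norm_dd_le_dnorm_unit\<close>)

lemma dnorm_diff_le:
  fixes f g :: "'a::euclidean_space \<Rightarrow> 'b::real_normed_vector"
  assumes "smooth f" "smooth g"
  shows "dnorm k (\<lambda>x. f x - g x) x \<le> dnorm k f x + dnorm k g x"
  by (rule dnorm_leI)
    (use assms in \<open>auto simp: dd_diff intro!: norm_triangle_le_diff add_mono norm_dd_le_dnorm_unit\<close>)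

lemma dnorm_scaleR_le:
  fixes f :: "'a::euclidean_space \<Rightarrow> 'b::real_normed_vector"
  assumes "smooth f"
  shows "dnorm k (\<lambda>x. c *\<^sub>R f x) x \<le> \<bar>c\<bar> * dnorm k f x"
  by (rule dnorm_leI)
    (use assms in \<open>auto simp: dd_scaleR intro!: mult_left_mono norm_dd_le_dnorm_unit\<close>)

lemma dnorm_zero [simp]: "dnorm k (\<lambda>x::'a::euclidean_space. 0::'b::real_normed_vector) x = 0"
  by (intro antisym dnorm_leI dnorm_nonneg smooth_zero) simp

text \<open>Expanding the first moving slot in the basis leaves one moving slot fewer.\<close>

lemma dd_has_derivative_param:
  fixes f :: "'a::euclidean_space \<Rightarrow> 'b::real_normed_vector" and c :: "'t::real_normed_vector \<Rightarrow> 'a"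
  assumes f: "smooth f" and c: "(c has_derivative c') (at t)"
    and \<phi>: "\<And>i. i \<in> set is \<Longrightarrow> (\<phi> i has_derivative \<phi>' i) (at t)"
  shows "((\<lambda>s. dd f (cs @ map (\<lambda>i. \<phi> i s) is) (c s)) has_derivative
     (\<lambda>v. dd f (c' v # cs @ map (\<lambda>i. \<phi> i t) is) (c t) +
        (\<Sum>j<length is. dd f (cs @ (map (\<lambda>i. \<phi> i t) is)[j := \<phi>' (is ! j) v]) (c t)))) (at t)"
  using \<phi>
proof (induction "is" arbitrary: cs)
  case Nil
  then show ?case using has_derivative_compose[OF c dd_has_derivative[OF f]] by simp
next
  case (Cons i "is")
  let ?r = "\<lambda>s. map (\<lambda>i. \<phi> i s) is"
  let ?D = "\<lambda>cs v. dd f (c' v # cs @ ?r t) (c t) + (\<Sum>j<length is. dd f (cs @ (?r t)[j := \<phi>' (is ! j) v]) (c t))"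
  have i: "(\<phi> i has_derivative \<phi>' i) (at t)" using Cons by simp
  \<comment> \<open>The coefficient of \<open>b\<close> carries the motion of slot \<open>i\<close>;
    the basis vector itself is constant and joins the prefix, which is why \<open>cs\<close> is
    arbitrary in the induction.\<close>
  have IH: "((\<lambda>s. dd f (cs @ b # ?r s) (c s)) has_derivative ?D (cs @ [b])) (at t)" for b
  proof -
    have "((\<lambda>s. dd f ((cs @ [b]) @ ?r s) (c s)) has_derivative ?D (cs @ [b])) (at t)"
      by (rule Cons.IH) (use Cons.prems in auto)
    then show ?thesis by simp
  qed
  have "((\<lambda>s. \<Sum>b\<in>Basis. (\<phi> i s \<bullet> b) *\<^sub>R dd f (cs @ b # ?r s) (c s)) has_derivative
      (\<lambda>v. \<Sum>b\<in>Basis. (\<phi> i t \<bullet> b) *\<^sub>R ?D (cs @ [b]) v + (\<phi>' i v \<bullet> b) *\<^sub>R dd f (cs @ b # ?r t) (c t))) (at t)"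
    by (intro has_derivative_sum has_derivative_scaleR IH has_derivative_inner_left i)
  moreover have "(\<lambda>s. \<Sum>b\<in>Basis. (\<phi> i s \<bullet> b) *\<^sub>R dd f (cs @ b # ?r s) (c s)) =
      (\<lambda>s. dd f (cs @ \<phi> i s # ?r s) (c s))"
    by (rule ext) (rule dd_slot_expand[OF f, symmetric])
  \<comment> \<open>Summing over the basis undoes the expansion in every term; the term with
    \<open>\<phi>' i v\<close> becomes the summand with index \<open>0\<close> of the enlarged
    sum.\<close>
  moreover have "(\<Sum>b\<in>Basis. (\<phi> i t \<bullet> b) *\<^sub>R ?D (cs @ [b]) v + (\<phi>' i v \<bullet> b) *\<^sub>R dd f (cs @ b # ?r t) (c t)) =
      dd f (c' v # cs @ \<phi> i t # ?r t) (c t) +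
      ((\<Sum>j<length is. dd f (cs @ \<phi> i t # (?r t)[j := \<phi>' (is ! j) v]) (c t)) + dd f (cs @ \<phi>' i v # ?r t) (c t))" for v
  proof -
    have "(\<Sum>b\<in>Basis. (\<phi> i t \<bullet> b) *\<^sub>R (\<Sum>j<length is. dd f (cs @ b # (?r t)[j := \<phi>' (is ! j) v]) (c t)))
      = (\<Sum>j<length is. \<Sum>b\<in>Basis. (\<phi> i t \<bullet> b) *\<^sub>R dd f (cs @ b # (?r t)[j := \<phi>' (is ! j) v]) (c t))"
      unfolding scaleR_sum_right by (rule sum.swap)
    also have "\<dots> = (\<Sum>j<length is. dd f (cs @ \<phi> i t # (?r t)[j := \<phi>' (is ! j) v]) (c t))"
      by (simp add: dd_slot_expand[OF f, symmetric])
    finally show ?thesis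
      using dd_slot_expand[OF f, of "c' v # cs" "\<phi> i t" "?r t" "c t"]
        dd_slot_expand[OF f, of cs "\<phi>' i v" "?r t" "c t"]
      by (simp add: sum.distrib scaleR_add_right)
  qed
  ultimately show ?case
    by (simp add: sum.lessThan_Suc_shift add_ac del: sum.lessThan_Suc)
qed

section \<open>The formula of Faa di Bruno\<close>

text \<open>Set partitions of the entries of a list; the recursion mirrors one differentiation of a
  composition.\<close>
fun partns :: "'a list \<Rightarrow> 'a list list list" where
  "partns [] = [[]]"
| "partns (v # vs) = concat (map (\<lambda>\<pi>. ([v] # \<pi>) # map (\<lambda>j. \<pi>[j := v # \<pi> ! j]) [0..<length \<pi>]) (partns vs))"

text \<open>Groups the partitions of \<open>v # vs\<close> by the partition of \<open>vs\<close>
  they extend, in the shape in which the product rule delivers its terms.\<close>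

lemma sum_list_partns_Cons:
  "(\<Sum>\<pi>\<leftarrow>partns (v # vs). F \<pi>) = (\<Sum>\<pi>\<leftarrow>partns vs. F ([v] # \<pi>) + (\<Sum>j<length \<pi>. F (\<pi>[j := v # \<pi> ! j])))"
  for F :: "'a list list \<Rightarrow> 'c::comm_monoid_add"
proof -
  have "(\<Sum>\<pi>\<leftarrow>concat (map (\<lambda>\<pi>. h \<pi> # map (k \<pi>) [0..<length \<pi>]) xs). F \<pi>) =
    (\<Sum>\<pi>\<leftarrow>xs. F (h \<pi>) + (\<Sum>j<length \<pi>. F (k \<pi> j)))" for h and k :: "'a list list \<Rightarrow> nat \<Rightarrow> 'a list list" and xs
    by (induction xs) (simp_all add: o_def interv_sum_list_conv_sum_set_nat atLeast0LessThan add.assoc)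
  then show ?thesis by simp
qed

lemma has_derivative_sum_list:
  assumes "\<And>i. i \<in> set xs \<Longrightarrow> (f i has_derivative f' i) F"
  shows "((\<lambda>x. \<Sum>i\<leftarrow>xs. f i x) has_derivative (\<lambda>v. \<Sum>i\<leftarrow>xs. f' i v)) F"
  using assms by (induction xs) (auto intro!: has_derivative_add)

text \<open>In \<open>dd_has_derivative_param\<close> the base point is \<open>g\<close> and the
  moving slots are the block derivatives \<open>dd g B\<close>. Motion of the base point creates the
  block \<open>[v]\<close>; motion of a slot turns \<open>B\<close> into
  \<open>v # B\<close>.\<close>

lemma has_derivative_faa_di_bruno_term:
  fixes g :: "'a::real_normed_vector \<Rightarrow> 'b::euclidean_space" and f :: "'b \<Rightarrow> 'c::real_normed_vector"
  assumes "smooth f" "smooth g"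
  shows "((\<lambda>x. dd f (map (\<lambda>B. dd g B x) \<pi>) (g x)) has_derivative
    (\<lambda>v. dd f (map (\<lambda>B. dd g B x) ([v] # \<pi>)) (g x) +
      (\<Sum>j<length \<pi>. dd f (map (\<lambda>B. dd g B x) (\<pi>[j := v # \<pi> ! j])) (g x)))) (at x)"
  using dd_has_derivative_param[OF assms(1) dd_has_derivative[OF assms(2), of "[]"],
      of \<pi> "dd g" "\<lambda>B v. dd g (v # B) x" x "[]", OF dd_has_derivative[OF assms(2)]]
  by (simp add: map_update)

text \<open>Both recursions put the newest direction in front: \<open>dd\<close> in its list,
  \<open>partns\<close> in a new first block \<open>[v]\<close> or at the head of an old block. The
  terms therefore agree literally after each differentiation.\<close>

theorem faa_di_bruno:
  fixes g :: "'a::real_normed_vector \<Rightarrow> 'b::euclidean_space" and f :: "'b \<Rightarrow> 'c::real_normed_vector"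
  assumes "smooth f" "smooth g"
  shows "dd (f \<circ> g) vs = (\<lambda>x. \<Sum>\<pi>\<leftarrow>partns vs. dd f (map (\<lambda>B. dd g B x) \<pi>) (g x))"
proof (induction vs)
  case (Cons v vs)
  show ?case
  proof
    fix x
    have "(dd (f \<circ> g) vs has_derivative (\<lambda>v. \<Sum>\<pi>\<leftarrow>partns vs. dd f (map (\<lambda>B. dd g B x) ([v] # \<pi>)) (g x) +
      (\<Sum>j<length \<pi>. dd f (map (\<lambda>B. dd g B x) (\<pi>[j := v # \<pi> ! j])) (g x)))) (at x)"
      unfolding Cons by (intro has_derivative_sum_list has_derivative_faa_di_bruno_term assms)
    from dd_Cons_eqI[OF this]
    show "dd (f \<circ> g) (v # vs) x = (\<Sum>\<pi>\<leftarrow>partns (v # vs). dd f (map (\<lambda>B. dd g B x) \<pi>) (g x))"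
      unfolding sum_list_partns_Cons .
  qed
qed (simp add: fun_eq_iff)

lemma smooth_comp:
  fixes g :: "'a::real_normed_vector \<Rightarrow> 'b::euclidean_space" and f :: "'b \<Rightarrow> 'c::real_normed_vector"
  assumes "smooth f" "smooth g"
  shows "smooth (f \<circ> g)"
  unfolding smooth_iff_dd faa_di_bruno[OF assms]
proof (intro allI)
  fix vs :: "'a list" and x
  show "(\<lambda>x. \<Sum>\<pi>\<leftarrow>partns vs. dd f (map (\<lambda>B. dd g B x) \<pi>) (g x)) differentiable at x"
    by (rule differentiableI, rule has_derivative_sum_list, rule has_derivative_faa_di_bruno_term[OF assms])
qed

section \<open>Counting and weighing set partitions\<close>

lemma partns_blocks:
  assumes "\<pi> \<in> set (partns vs)" "B \<in> set \<pi>"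
  shows "B \<noteq> [] \<and> set B \<subseteq> set vs"
  using assms
proof (induction vs arbitrary: \<pi> B)
  case (Cons v vs)
  from Cons.prems(1) obtain \<pi>' where \<pi>': "\<pi>' \<in> set (partns vs)"
    and \<pi>: "\<pi> \<in> set (([v] # \<pi>') # map (\<lambda>j. \<pi>'[j := v # \<pi>' ! j]) [0..<length \<pi>'])"
    unfolding partns.simps set_concat set_map by blast
  from \<pi> consider "\<pi> = [v] # \<pi>'" | j where "j < length \<pi>'" "\<pi> = \<pi>'[j := v # \<pi>' ! j]"
    by auto
  then show ?case
  proof cases
    case 1
    then show ?thesis using Cons.IH[OF \<pi>', of B] Cons.prems by auto
  next
    case 2
    then have "B \<in> set \<pi>' \<or> B = v # \<pi>' ! j"
      using Cons.prems set_update_subset_insert[of \<pi>' j] by auto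
    then show ?thesis using Cons.IH[OF \<pi>', of B] Cons.IH[OF \<pi>' nth_mem[OF 2(1)]] by auto
  qed
qed simp

lemma partns_sum_length: "\<pi> \<in> set (partns vs) \<Longrightarrow> sum_list (map length \<pi>) = length vs"
proof (induction vs arbitrary: \<pi>)
  case (Cons v vs)
  have "sum_list (map length (\<pi>[j := v # \<pi> ! j])) = Suc (sum_list (map length \<pi>))"
    if "j < length \<pi>" for \<pi> :: "'a list list" and j
    using that by (induction \<pi> arbitrary: j) (auto split: nat.splits)
  then show ?case using Cons by auto
qed simp

lemma partns_length_le:
  assumes "\<pi> \<in> set (partns vs)"
  shows "length \<pi> \<le> length vs"
proof -
  have "length \<pi> = sum_list (map (\<lambda>_. 1) \<pi>)" by (simp add: sum_list_triv)
  also have "\<dots> \<le> sum_list (map length \<pi>)"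
    by (rule sum_list_mono) (use partns_blocks[OF assms] in \<open>auto simp: Suc_le_eq\<close>)
  finally show ?thesis using partns_sum_length[OF assms] by simp
qed

lemma partns_block_length_le:
  assumes "\<pi> \<in> set (partns vs)" "B \<in> set \<pi>"
  shows "length B \<le> length vs"
  using partns_sum_length[OF assms(1)] member_le_sum_list[of "length B" "map length \<pi>"] assms(2) by auto

text \<open>In a term of the formula, with bounds \<open>B * (fact j * t ^ j * N j)\<close> for
  \<open>f\<close> and \<open>A * (fact k * s ^ k * N k)\<close> for \<open>g\<close>, this collects
  the factorials and one factor \<open>A * t\<close> per block; \<open>X\<close> will be
  \<open>A * t\<close>.\<close>

definition pweight :: "real \<Rightarrow> 'a list list \<Rightarrow> real" where
  "pweight X \<pi> = fact (length \<pi>) * prod_list (map (\<lambda>B. fact (length B)) \<pi>) * X ^ length \<pi>"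

lemma pweight_nonneg: "0 \<le> X \<Longrightarrow> 0 \<le> pweight X \<pi>"
  by (auto simp: pweight_def intro!: mult_nonneg_nonneg prod_list_nonneg)

lemma pweight_Cons: "pweight X ([v] # \<pi>) = pweight X \<pi> * (real (length \<pi>) + 1) * X"
  by (simp add: pweight_def algebra_simps)

lemma pweight_update:
  assumes "j < length \<pi>"
  shows "pweight X (\<pi>[j := v # \<pi> ! j]) = pweight X \<pi> * (real (length (\<pi> ! j)) + 1)"
proof -
  have "prod_list (map (\<lambda>B. fact (length B)) (\<pi>[j := v # \<pi> ! j])) =
    prod_list (map (\<lambda>B. fact (length B)) \<pi>) * (real (length (\<pi> ! j)) + 1)"
    using assms by (induction \<pi> arbitrary: j) (auto split: nat.splits simp: algebra_simps)
  then show ?thesis by (simp add: pweight_def)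
qed

text \<open>Passing from \<open>k\<close> to \<open>k + 1\<close> multiplies the weight of a partition with \<open>j\<close> blocks by
  \<open>(j + 1) X + (k + j)\<close>, and \<open>j \<le> k\<close>.\<close>

lemma sum_pweight_le:
  assumes "0 \<le> X"
  shows "(\<Sum>\<pi>\<leftarrow>partns vs. pweight X \<pi>) \<le> fact (length vs) * (X + 2) ^ length vs"
proof (induction vs)
  case (Cons v vs)
  let ?k = "length vs"
  have step: "pweight X ([v] # \<pi>) + (\<Sum>j<length \<pi>. pweight X (\<pi>[j := v # \<pi> ! j])) \<le>
      pweight X \<pi> * ((real ?k + 1) * (X + 2))" if \<pi>: "\<pi> \<in> set (partns vs)" for \<pi>
  proof -
    have "(\<Sum>j<length \<pi>. length (\<pi> ! j)) = ?k"
      using partns_sum_length[OF \<pi>] by (simp add: sum_list_sum_nth atLeast0LessThan)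
    then have "(\<Sum>j<length \<pi>. real (length (\<pi> ! j)) + 1) = real ?k + real (length \<pi>)"
      by (simp add: sum.distrib flip: of_nat_sum)
    then have "pweight X ([v] # \<pi>) + (\<Sum>j<length \<pi>. pweight X (\<pi>[j := v # \<pi> ! j])) =
      pweight X \<pi> * ((real (length \<pi>) + 1) * X + (real ?k + real (length \<pi>)))"
      by (simp add: pweight_Cons pweight_update flip: sum_distrib_left) (simp add: algebra_simps)
    also have "(real (length \<pi>) + 1) * X + (real ?k + real (length \<pi>)) \<le> (real ?k + 1) * X + (real ?k + real ?k)"
      using partns_length_le[OF \<pi>] assms by (intro add_mono mult_right_mono) auto
    then have "pweight X \<pi> * ((real (length \<pi>) + 1) * X + (real ?k + real (length \<pi>))) \<le>
      pweight X \<pi> * ((real ?k + 1) * (X + 2))"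
      by (intro mult_left_mono pweight_nonneg assms) (simp add: algebra_simps)
    finally show ?thesis .
  qed
  have "(\<Sum>\<pi>\<leftarrow>partns (v # vs). pweight X \<pi>) \<le> (\<Sum>\<pi>\<leftarrow>partns vs. pweight X \<pi> * ((real ?k + 1) * (X + 2)))"
    unfolding sum_list_partns_Cons by (rule sum_list_mono) (rule step)
  also have "\<dots> = (\<Sum>\<pi>\<leftarrow>partns vs. pweight X \<pi>) * ((real ?k + 1) * (X + 2))"
    by (rule sum_list_mult_const)
  also have "\<dots> \<le> (fact ?k * (X + 2) ^ ?k) * ((real ?k + 1) * (X + 2))"
    using Cons assms by (intro mult_right_mono) auto
  also have "\<dots> = fact (length (v # vs)) * (X + 2) ^ length (v # vs)"
    by (simp add: algebra_simps)
  finally show ?case .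
qed (simp add: pweight_def)

text \<open>A crude bound for the Bell numbers: for \<open>X = 1\<close> every partition has weight
  at least \<open>1\<close>, and \<open>3\<close> is \<open>X + 2\<close>.\<close>

lemma length_partns_le: "real (length (partns vs)) \<le> fact (length vs) * 3 ^ length vs"
proof -
  have "1 \<le> pweight 1 \<pi>" for \<pi> :: "'a list list"
  proof -
    have "1 \<le> prod_list (map (\<lambda>B. fact (length B) :: real) \<pi>)"
    proof (induction \<pi>)
      case (Cons B \<pi>)
      then show ?case using mult_mono[of 1 "fact (length B) :: real" 1] by simp
    qed simp
    then show ?thesis using mult_mono[of 1 "fact (length \<pi>) :: real" 1] by (simp add: pweight_def)
  qed
  then have "(\<Sum>\<pi>\<leftarrow>partns vs. 1) \<le> (\<Sum>\<pi>\<leftarrow>partns vs. pweight 1 \<pi>)"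
    by (intro sum_list_mono)
  also have "\<dots> \<le> fact (length vs) * 3 ^ length vs"
    using sum_pweight_le[of 1 vs] by simp
  finally show ?thesis by (simp add: sum_list_triv)
qed

text \<open>The list is one competitor in the defining maximum, once that maximum is known to range
  over a finite set: parts of size at least \<open>1\<close> bound both the length and the entries
  by the sum. The empty list is the case of sum \<open>0\<close>, where \<open>N 0 = 1\<close>
  enters.\<close>

lemma circ_seq_ge:
  assumes "N 0 = 1" "\<And>a. a \<in> set as \<Longrightarrow> 1 \<le> a"
  shows "N (length as) * prod_list (map N as) \<le> circ_seq N (sum_list as)"
proof (cases "sum_list as = 0")
  case True
  with assms(2) have "as = []" by (cases as) fastforce+
  then show ?thesis by (simp add: circ_seq_def assms)
next
  case False
  let ?k = "sum_list as"
  have "finite {as :: nat list. (\<forall>a\<in>set as. 1 \<le> a) \<and> sum_list as = ?k}"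
  proof (rule finite_subset)
    show "{as :: nat list. (\<forall>a\<in>set as. 1 \<le> a) \<and> sum_list as = ?k} \<subseteq> {xs. set xs \<subseteq> {..?k} \<and> length xs \<le> ?k}"
    proof safe
      fix bs :: "nat list" assume bs: "\<forall>a\<in>set bs. 1 \<le> a" "sum_list bs = ?k"
      have "length bs = sum_list (map (\<lambda>_. 1) bs)" by (simp add: sum_list_triv)
      also have "\<dots> \<le> sum_list (map (\<lambda>a. a) bs)" using bs by (intro sum_list_mono) auto
      finally show "length bs \<le> ?k" using bs by simp
      show "b \<le> ?k" if "b \<in> set bs" for b using member_le_sum_list[OF that] bs by simp
    qed
    show "finite {xs. set xs \<subseteq> {..?k} \<and> length xs \<le> ?k}" by (rule finite_lists_length_le) simp
  qed
  then have "finite {N (length as) * prod_list (map N as) | as. (\<forall>a\<in>set as. 1 \<le> a) \<and> sum_list as = ?k}"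
    by (rule finite_image_set)
  then show ?thesis
    unfolding circ_seq_def using False assms by (auto intro!: Max_ge)
qed

lemma prod_list_mono_nonneg:
  assumes "\<And>x. x \<in> set xs \<Longrightarrow> 0 \<le> f x" "\<And>x. x \<in> set xs \<Longrightarrow> f x \<le> (g x :: real)"
  shows "prod_list (map f xs) \<le> prod_list (map g xs)"
  using assms
proof (induction xs)
  case (Cons x xs)
  then have "0 \<le> g x" by (meson list.set_intros(1) order_trans)
  with Cons show ?case by (auto intro!: mult_mono prod_list_nonneg)
qed simp

lemma prod_list_mult_distrib:
  "prod_list (map (\<lambda>x. f x * g x) xs) = prod_list (map f xs) * (prod_list (map g xs) :: real)"
  by (induction xs) auto

lemma prod_list_power: "prod_list (map (\<lambda>x. c ^ h x) xs) = (c :: real) ^ sum_list (map h xs)"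
  by (induction xs) (auto simp: power_add)

lemma norm_sum_list_le: "norm (\<Sum>i\<leftarrow>xs. f i) \<le> (\<Sum>i\<leftarrow>xs. norm (f i))"
  by (induction xs) (auto intro: norm_triangle_le)

text \<open>In the term of a partition the powers of \<open>s\<close> combine to
  \<open>s ^ k\<close>, because the block lengths add up to \<open>k\<close>; the values of
  \<open>N\<close> form one competitor in \<open>circ_seq N k\<close>; the rest is
  \<open>pweight (A * t) \<pi>\<close>. Summation over all partitions then produces the rate
  \<open>s * (2 + A * t)\<close>.\<close>

lemma dnorm_comp_le:
  fixes g :: "'a::euclidean_space \<Rightarrow> 'b::euclidean_space" and f :: "'b \<Rightarrow> 'c::real_normed_vector"
  assumes f: "smooth f" and g: "smooth g" and N: "\<And>k. 0 < N k" "N 0 = 1"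
    and nn: "0 \<le> A" "0 \<le> s" "0 \<le> B" "0 \<le> t"
    and Dg: "\<And>k. dnorm k g x \<le> A * (fact k * s ^ k * N k)"
    and Df: "\<And>k. dnorm k f (g x) \<le> B * (fact k * t ^ k * N k)"
  shows "dnorm k (f \<circ> g) x \<le> B * (fact k * (s * (2 + A * t)) ^ k * circ_seq N k)"
proof (rule dnorm_leI)
  fix vs :: "'a list" assume len: "length vs = k" and vs: "\<And>v. v \<in> set vs \<Longrightarrow> norm v \<le> 1"
  have tm: "norm (dd f (map (\<lambda>B. dd g B x) \<pi>) (g x)) \<le> B * (s ^ k * circ_seq N k * pweight (A * t) \<pi>)"
    if \<pi>: "\<pi> \<in> set (partns vs)" for \<pi>
  proof -
    have sum: "sum_list (map length \<pi>) = k" using partns_sum_length[OF \<pi>] len by simp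
    have block: "norm (dd g b x) \<le> A * (fact (length b) * s ^ length b * N (length b))" if "b \<in> set \<pi>" for b
    proof -
      have "set b \<subseteq> set vs" using partns_blocks[OF \<pi> that] by simp
      then have "norm (dd g b x) \<le> dnorm (length b) g x"
        using vs by (intro norm_dd_le_dnorm_unit g) blast
      then show ?thesis using Dg[of "length b"] by linarith
    qed
    have "norm (dd f (map (\<lambda>B. dd g B x) \<pi>) (g x)) \<le>
        dnorm (length \<pi>) f (g x) * prod_list (map (\<lambda>b. norm (dd g b x)) \<pi>)"
      using norm_dd_le_dnorm[OF f, of "map (\<lambda>B. dd g B x) \<pi>" "g x"] by (simp add: o_def)
    also have "\<dots> \<le> (B * (fact (length \<pi>) * t ^ length \<pi> * N (length \<pi>))) *
        prod_list (map (\<lambda>b. A * (fact (length b) * s ^ length b * N (length b))) \<pi>)"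
      by (intro mult_mono Df prod_list_mono_nonneg block)
        (auto intro!: mult_nonneg_nonneg prod_list_nonneg zero_le_power nn less_imp_le[OF N(1)])
    also have "prod_list (map (\<lambda>b. A * (fact (length b) * s ^ length b * N (length b))) \<pi>) =
        A ^ length \<pi> * (prod_list (map (\<lambda>b. fact (length b)) \<pi>) * s ^ k * prod_list (map N (map length \<pi>)))"
      using prod_list_power[of A "\<lambda>_. 1" \<pi>] sum
      by (simp add: prod_list_mult_distrib prod_list_power sum_list_triv o_def)
    also have "(B * (fact (length \<pi>) * t ^ length \<pi> * N (length \<pi>))) *
        (A ^ length \<pi> * (prod_list (map (\<lambda>b. fact (length b)) \<pi>) * s ^ k * prod_list (map N (map length \<pi>)))) =
        B * (s ^ k * (N (length \<pi>) * prod_list (map N (map length \<pi>))) * pweight (A * t) \<pi>)"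
      by (simp add: pweight_def power_mult_distrib mult_ac)
    also have "\<dots> \<le> B * (s ^ k * circ_seq N k * pweight (A * t) \<pi>)"
    proof -
      have "N (length \<pi>) * prod_list (map N (map length \<pi>)) \<le> circ_seq N k"
        using circ_seq_ge[of N "map length \<pi>", OF N(2)] partns_blocks[OF \<pi>] sum
        by (auto simp: Suc_le_eq)
      then show ?thesis
        by (intro mult_left_mono mult_right_mono pweight_nonneg mult_nonneg_nonneg zero_le_power nn)
    qed
    finally show ?thesis .
  qed
  \<comment> \<open>The composition of \<open>k\<close> into ones is a nonnegative
    competitor.\<close>
  have circ: "0 \<le> circ_seq N k"
  proof -
    have "0 \<le> N (length (replicate k (1::nat))) * prod_list (map N (replicate k (1::nat)))"
      by (intro mult_nonneg_nonneg prod_list_nonneg) (auto simp: less_imp_le N)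
    also have "\<dots> \<le> circ_seq N (sum_list (replicate k (1::nat)))"
      by (rule circ_seq_ge) (auto simp: N)
    finally show ?thesis by (simp add: sum_list_replicate)
  qed
  have "norm (dd (f \<circ> g) vs x) \<le> (\<Sum>\<pi>\<leftarrow>partns vs. norm (dd f (map (\<lambda>B. dd g B x) \<pi>) (g x)))"
    unfolding faa_di_bruno[OF f g] by (rule norm_sum_list_le)
  also have "\<dots> \<le> (\<Sum>\<pi>\<leftarrow>partns vs. B * (s ^ k * circ_seq N k * pweight (A * t) \<pi>))"
    by (rule sum_list_mono) (rule tm)
  also have "\<dots> = B * (s ^ k * circ_seq N k) * (\<Sum>\<pi>\<leftarrow>partns vs. pweight (A * t) \<pi>)"
    by (simp add: sum_list_const_mult mult.assoc)
  also have "\<dots> \<le> B * (s ^ k * circ_seq N k) * (fact k * (A * t + 2) ^ k)"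
    using sum_pweight_le[of "A * t" vs] nn circ len by (intro mult_left_mono) auto
  also have "\<dots> = B * (fact k * (s * (2 + A * t)) ^ k * circ_seq N k)"
    by (simp add: power_mult_distrib add.commute mult_ac)
  finally show "norm (dd (f \<circ> g) vs x) \<le> B * (fact k * (s * (2 + A * t)) ^ k * circ_seq N k)" .
qed

section \<open>Weighted norms of compositions\<close>

text \<open>\<open>1 \<le> R\<close> lets the exponent remain \<open>length ws\<close> although one
  factor is replaced by \<open>e\<close>.\<close>

lemma prod_list_norm_update_le:
  fixes ws :: "'a::real_normed_vector list"
  assumes "\<And>w. w \<in> set ws \<Longrightarrow> norm w \<le> R" "1 \<le> R" "i < length ws" "norm z \<le> e"
  shows "prod_list (map norm (ws[i := z])) \<le> e * R ^ length ws"
  using assms(1,3)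
proof (induction ws arbitrary: i)
  case (Cons w ws)
  have e: "0 \<le> e" using assms(4) norm_ge_zero[of z] by linarith
  show ?case
  proof (cases i)
    case 0
    have "prod_list (map norm ws) \<le> R ^ length ws"
      using Cons.prems by (intro prod_list_norm_le_power) auto
    also have "\<dots> \<le> R ^ Suc (length ws)" using assms(2) by (intro power_increasing) auto
    finally show ?thesis
      using 0 assms(4) e by (auto intro!: mult_mono prod_list_nonneg simp del: power_Suc)
  next
    case (Suc j)
    have "norm w * prod_list (map norm (ws[j := z])) \<le> R * (e * R ^ length ws)"
      using Cons.prems Suc Cons.IH[of j] assms(2)
      by (intro mult_mono) (auto intro!: prod_list_nonneg)
    then show ?thesis using Suc by (simp add: mult_ac)
  qed
qed simp

text \<open>For each partition the base point and all slots move simultaneously along the segments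
  from \<open>h\<close> to \<open>g\<close>. The derivative in the parameter has at most
  \<open>k + 1\<close> terms, each with exactly one direction built from \<open>g - h\<close>; the
  base point term has one slot more, hence orders up to \<open>Suc k\<close> for \<open>f\<close>.
  The factor \<open>fact k * 3 ^ k\<close> counts partitions. The dependence on \<open>k\<close> is
  crude, as the bound will serve finitely many orders.\<close>

lemma dnorm_comp_diff_le:
  fixes g h :: "'a::euclidean_space \<Rightarrow> 'b::euclidean_space" and f :: "'b \<Rightarrow> 'c::real_normed_vector"
  assumes f: "smooth f" and g: "smooth g" and h: "smooth h"
    and L: "convex L" "g x \<in> L" "h x \<in> L"
    and F: "\<And>j y. j \<le> Suc k \<Longrightarrow> y \<in> L \<Longrightarrow> dnorm j f y \<le> F" and R: "1 \<le> R"
    and gR: "\<And>b. b \<le> k \<Longrightarrow> dnorm b g x \<le> R" and hR: "\<And>b. b \<le> k \<Longrightarrow> dnorm b h x \<le> R"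
    and e: "\<And>b. b \<le> k \<Longrightarrow> dnorm b (\<lambda>x. g x - h x) x \<le> e"
  shows "dnorm k (\<lambda>x. (f \<circ> g) x - (f \<circ> h) x) x \<le> fact k * 3 ^ k * ((real k + 1) * F * R ^ k * e)"
proof (rule dnorm_leI)
  fix vs :: "'a list" assume len: "length vs = k" and vs: "\<And>v. v \<in> set vs \<Longrightarrow> norm v \<le> 1"
  define u where "u = (\<lambda>x. g x - h x)"
  have u: "smooth u" unfolding u_def by (intro smooth_diff g h)
  have F0: "0 \<le> F" using F[of 0 "g x"] L norm_ge_zero[of "f (g x)"] by (simp del: norm_ge_zero)
  have ux: "norm (u x) \<le> e" using e[of 0] by (simp add: u_def)
  then have e0: "0 \<le> e" using norm_ge_zero[of "u x"] by linarith
  let ?b = "(real k + 1) * F * R ^ k * e"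
  have tm: "norm (dd f (map (\<lambda>B. dd g B x) \<pi>) (g x) - dd f (map (\<lambda>B. dd h B x) \<pi>) (h x)) \<le> ?b"
    if \<pi>: "\<pi> \<in> set (partns vs)" for \<pi>
  proof -
    define \<theta> where "\<theta> t = dd f (map (\<lambda>B. dd h B x + t *\<^sub>R dd u B x) \<pi>) (h x + t *\<^sub>R u x)" for t :: real
    let ?ws = "\<lambda>t::real. map (\<lambda>B. dd h B x + t *\<^sub>R dd u B x) \<pi>"
    let ?D = "\<lambda>t s. dd f ((s *\<^sub>R u x) # ?ws t) (h x + t *\<^sub>R u x) +
        (\<Sum>j<length \<pi>. dd f ((?ws t)[j := s *\<^sub>R dd u (\<pi> ! j) x]) (h x + t *\<^sub>R u x))"
    have j: "length \<pi> \<le> k" using partns_length_le[OF \<pi>] len by simp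
    have Rk: "R ^ length \<pi> \<le> R ^ k" using R j by (rule power_increasing[rotated])
    have blk: "norm (dd G b x) \<le> c" if "b \<in> set \<pi>" "smooth G" "\<And>b. b \<le> k \<Longrightarrow> dnorm b G x \<le> c"
      for b c and G :: "'a \<Rightarrow> 'b"
    proof -
      have "norm (dd G b x) \<le> dnorm (length b) G x"
        using partns_blocks[OF \<pi> that(1)] vs by (intro norm_dd_le_dnorm_unit that(2)) blast
      also have "\<dots> \<le> c" using partns_block_length_le[OF \<pi> that(1)] len by (intro that(3)) simp
      finally show ?thesis .
    qed
    have D: "(\<theta> has_derivative ?D t) (at t)" for t
    proof -
      have aff: "((\<lambda>t. a + t *\<^sub>R b) has_derivative (\<lambda>s. s *\<^sub>R b)) (at t)" for a b :: 'b
        by (auto intro!: derivative_eq_intros)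
      show ?thesis
        using dd_has_derivative_param[OF f aff, of \<pi> "\<lambda>B t. dd h B x + t *\<^sub>R dd u B x"
            "\<lambda>B s. s *\<^sub>R dd u B x" "[]", OF aff]
        unfolding \<theta>_def by simp
    qed
    have bd: "norm (?D t s) \<le> ?b * norm s" if t: "t \<in> {0..1}" for t s
    proof -
      have conv: "a + t *\<^sub>R (b - a) = (1 - t) *\<^sub>R a + t *\<^sub>R b" for a b :: 'b
        by (simp add: algebra_simps)
      have y: "h x + t *\<^sub>R u x \<in> L"
        using convexD[OF L(1,3,2), of "1 - t" t] t by (simp add: u_def conv)
      \<comment> \<open>The slots are convex combinations of derivatives of \<open>g\<close> and
        \<open>h\<close>, so the bound \<open>R\<close> persists along the segment.\<close>
      have ws: "norm w \<le> R" if "w \<in> set (?ws t)" for w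
      proof -
        from that obtain b where b: "b \<in> set \<pi>" "w = dd h b x + t *\<^sub>R dd u b x" by auto
        then have "w = (1 - t) *\<^sub>R dd h b x + t *\<^sub>R dd g b x"
          by (simp add: u_def dd_diff[OF g h] conv)
        then have "norm w \<le> (1 - t) * norm (dd h b x) + t * norm (dd g b x)"
          using t norm_triangle_ineq[of "(1 - t) *\<^sub>R dd h b x" "t *\<^sub>R dd g b x"] by simp
        also have "\<dots> \<le> (1 - t) * R + t * R"
          using t blk[OF b(1) h hR] blk[OF b(1) g gR] by (intro add_mono mult_left_mono) auto
        finally show ?thesis by (simp add: algebra_simps)
      qed
      \<comment> \<open>Covers both kinds of terms: \<open>zs\<close> has one extra slot or one slot
        replaced, and in either case a single factor of size \<open>norm s * e\<close>.\<close>
      have est: "norm (dd f zs (h x + t *\<^sub>R u x)) \<le> F * (norm s * e * R ^ k)"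
        if "length zs \<le> Suc k" "prod_list (map norm zs) \<le> norm s * e * R ^ length \<pi>" for zs
      proof -
        have "norm (dd f zs (h x + t *\<^sub>R u x)) \<le> dnorm (length zs) f (h x + t *\<^sub>R u x) * prod_list (map norm zs)"
          by (rule norm_dd_le_dnorm[OF f])
        also have "\<dots> \<le> F * (norm s * e * R ^ k)"
        proof (intro mult_mono F that y F0)
          show "prod_list (map norm zs) \<le> norm s * e * R ^ k"
            using that(2) mult_left_mono[OF Rk, of "norm s * e"] e0 by simp
        qed (auto intro!: prod_list_nonneg)
        finally show ?thesis .
      qed
      have "norm (dd f ((s *\<^sub>R u x) # ?ws t) (h x + t *\<^sub>R u x)) \<le> F * (norm s * e * R ^ k)"
      proof (rule est)
        have "prod_list (map norm (?ws t)) \<le> R ^ length \<pi>"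
          using prod_list_norm_le_power[OF ws, of "?ws t"] by simp
        then have "norm (s *\<^sub>R u x) * prod_list (map norm (?ws t)) \<le> (norm s * e) * R ^ length \<pi>"
          using ux e0 R by (intro mult_mono) (auto intro!: mult_left_mono prod_list_nonneg)
        then show "prod_list (map norm ((s *\<^sub>R u x) # ?ws t)) \<le> norm s * e * R ^ length \<pi>"
          by (simp only: list.map prod_list.Cons)
      qed (use j in simp)
      moreover have "norm (dd f ((?ws t)[i := s *\<^sub>R dd u (\<pi> ! i) x]) (h x + t *\<^sub>R u x)) \<le> F * (norm s * e * R ^ k)"
        if i: "i < length \<pi>" for i
      proof (rule est)
        have "norm (s *\<^sub>R dd u (\<pi> ! i) x) \<le> norm s * e"
          using blk[OF nth_mem[OF i] u] e by (simp add: u_def mult_left_mono)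
        then show "prod_list (map norm ((?ws t)[i := s *\<^sub>R dd u (\<pi> ! i) x])) \<le> norm s * e * R ^ length \<pi>"
          using prod_list_norm_update_le[OF ws R, of "?ws t" i] i by simp
      qed (use j in simp)
      ultimately have "norm (?D t s) \<le> F * (norm s * e * R ^ k) + (\<Sum>i<length \<pi>. F * (norm s * e * R ^ k))"
        by (intro norm_triangle_le add_mono sum_norm_le) auto
      also have "\<dots> = (real (length \<pi>) + 1) * (F * (norm s * e * R ^ k))"
        by (simp add: algebra_simps)
      also have "\<dots> \<le> (real k + 1) * (F * (norm s * e * R ^ k))"
        using j F0 e0 R by (intro mult_right_mono) auto
      finally show ?thesis by (simp add: mult_ac)
    qed
    have "norm (\<theta> 1 - \<theta> 0) \<le> ?b * norm (1 - 0 :: real)"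
    proof (rule differentiable_bound[where S = "{0..1}" and f' = ?D])
      show "onorm (?D t) \<le> ?b" if "t \<in> {0..1}" for t
        using F0 e0 R by (intro onorm_bound bd that) auto
    qed (auto intro: has_derivative_at_withinI D)
    moreover have "\<theta> 1 = dd f (map (\<lambda>B. dd g B x) \<pi>) (g x)" "\<theta> 0 = dd f (map (\<lambda>B. dd h B x) \<pi>) (h x)"
      by (simp_all add: \<theta>_def u_def dd_diff[OF g h])
    ultimately show ?thesis by simp
  qed
  have "norm (dd (\<lambda>x. (f \<circ> g) x - (f \<circ> h) x) vs x) =
      norm (\<Sum>\<pi>\<leftarrow>partns vs. dd f (map (\<lambda>B. dd g B x) \<pi>) (g x) - dd f (map (\<lambda>B. dd h B x) \<pi>) (h x))"
    by (simp only: dd_diff[OF smooth_comp[OF f g] smooth_comp[OF f h]] faa_di_bruno[OF f g] faa_di_bruno[OF f h] sum_list_subtractf)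
  also have "\<dots> \<le> (\<Sum>\<pi>\<leftarrow>partns vs. norm (dd f (map (\<lambda>B. dd g B x) \<pi>) (g x) - dd f (map (\<lambda>B. dd h B x) \<pi>) (h x)))"
    by (rule norm_sum_list_le)
  also have "\<dots> \<le> (\<Sum>\<pi>\<leftarrow>partns vs. ?b)"
    by (rule sum_list_mono) (rule tm)
  also have "\<dots> = real (length (partns vs)) * ?b"
    by (simp add: sum_list_triv)
  also have "\<dots> \<le> fact k * 3 ^ k * ?b"
    using length_partns_le[of vs] len F0 e0 R by (intro mult_right_mono) auto
  finally show "norm (dd (\<lambda>x. (f \<circ> g) x - (f \<circ> h) x) vs x) \<le> fact k * 3 ^ k * ?b" .
qed

section \<open>Weighted norms and inclusions between the steps\<close>

lemma wnorm_nonneg: "wfin M K \<rho> f \<Longrightarrow> 0 \<le> wnorm M K \<rho> f"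
  unfolding wnorm_def wfin_def by (intro cSup_upper) auto

lemma dnorm_le_wnorm:
  assumes "wfin M K \<rho> f" "x \<in> K" "0 < \<rho>" "\<And>k. 0 < M k"
  shows "dnorm k f x \<le> wnorm M K \<rho> f * (fact k * \<rho> ^ k * M k)"
proof -
  have "dnorm k f x / (fact k * \<rho> ^ k * M k) \<le> wnorm M K \<rho> f"
    unfolding wnorm_def using assms(1,2)
    by (intro cSup_upper) (auto simp: wfin_def wquot_set_def)
  then show ?thesis using assms(3) assms(4)[of k] by (simp add: pos_divide_le_eq)
qed

lemma wnorm_leI:
  assumes "\<And>k x. x \<in> K \<Longrightarrow> dnorm k f x \<le> c * (fact k * \<rho> ^ k * M k)" "0 \<le> c" "0 < \<rho>" "\<And>k. 0 < M k"
  shows "wfin M K \<rho> f \<and> wnorm M K \<rho> f \<le> c"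
proof -
  have "y \<le> c" if "y \<in> wquot_set M K \<rho> f" for y
    using that assms by (auto simp: wquot_set_def pos_divide_le_eq)
  then show ?thesis
    using assms(2) unfolding wfin_def wnorm_def by (auto intro!: bdd_aboveI[of _ c] cSup_least)
qed

lemma wnorm_mono:
  fixes f :: "'a::euclidean_space \<Rightarrow> 'b::real_normed_vector"
  assumes f: "wfin M K \<rho> f" and K: "K' \<subseteq> K" and \<rho>: "0 < \<rho>" "\<rho> \<le> \<rho>'" and M: "\<And>k. 0 < M k" "\<And>k. M k \<le> M' k"
  shows "wfin M' K' \<rho>' f \<and> wnorm M' K' \<rho>' f \<le> wnorm M K \<rho> f"
proof (rule wnorm_leI)
  show "0 < M' k" for k using M[of k] by linarith
  fix k x assume "x \<in> K'"
  then have "dnorm k f x \<le> wnorm M K \<rho> f * (fact k * \<rho> ^ k * M k)"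
    using K by (intro dnorm_le_wnorm[OF f _ \<rho>(1) M(1)]) auto
  also have "\<dots> \<le> wnorm M K \<rho> f * (fact k * \<rho>' ^ k * M' k)"
    using \<rho> M[of k] by (intro mult_left_mono mult_mono power_mono wnorm_nonneg f) auto
  finally show "dnorm k f x \<le> wnorm M K \<rho> f * (fact k * \<rho>' ^ k * M' k)" .
qed (use \<rho> wnorm_nonneg[OF f] in auto)

lemma wnorm_add:
  fixes f g :: "'a::euclidean_space \<Rightarrow> 'b::real_normed_vector"
  assumes "wfin M K \<rho> f" "wfin M K \<rho> g" "smooth f" "smooth g" "0 < \<rho>" "\<And>k. 0 < M k"
  shows "wfin M K \<rho> (\<lambda>x. f x + g x) \<and> wnorm M K \<rho> (\<lambda>x. f x + g x) \<le> wnorm M K \<rho> f + wnorm M K \<rho> g"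
proof (rule wnorm_leI)
  fix k x assume "x \<in> K"
  then show "dnorm k (\<lambda>x. f x + g x) x \<le> (wnorm M K \<rho> f + wnorm M K \<rho> g) * (fact k * \<rho> ^ k * M k)"
    using dnorm_add_le[OF assms(3,4), of k x] dnorm_le_wnorm[OF assms(1) _ assms(5,6), of x k]
      dnorm_le_wnorm[OF assms(2) _ assms(5,6), of x k] by (simp add: distrib_right)
qed (use assms in \<open>auto intro!: add_nonneg_nonneg wnorm_nonneg\<close>)

lemma wnorm_scaleR_le:
  fixes f :: "'a::euclidean_space \<Rightarrow> 'b::real_normed_vector"
  assumes "wfin M K \<rho> f" "smooth f" "0 < \<rho>" "\<And>k. 0 < M k"
  shows "wfin M K \<rho> (\<lambda>x. c *\<^sub>R f x) \<and> wnorm M K \<rho> (\<lambda>x. c *\<^sub>R f x) \<le> \<bar>c\<bar> * wnorm M K \<rho> f"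
proof (rule wnorm_leI)
  fix k x assume "x \<in> K"
  then show "dnorm k (\<lambda>x. c *\<^sub>R f x) x \<le> \<bar>c\<bar> * wnorm M K \<rho> f * (fact k * \<rho> ^ k * M k)"
    using dnorm_scaleR_le[OF assms(2), of k c x] mult_left_mono[OF dnorm_le_wnorm[OF assms(1) _ assms(3,4), of x k], of "\<bar>c\<bar>"]
    by (simp add: mult.assoc)
qed (use assms in \<open>auto intro!: mult_nonneg_nonneg wnorm_nonneg\<close>)

lemma wnorm_zero:
  assumes "0 < \<rho>" "\<And>k. 0 < M k"
  shows "wfin M K \<rho> (\<lambda>x::'a::euclidean_space. 0::'b::real_normed_vector)"
    and "wnorm M K \<rho> (\<lambda>x::'a. 0::'b) = 0"
proof -
  have "wfin M K \<rho> (\<lambda>x::'a. 0::'b) \<and> wnorm M K \<rho> (\<lambda>x::'a. 0::'b) \<le> 0"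
    by (rule wnorm_leI) (use assms in auto)
  then show "wfin M K \<rho> (\<lambda>x::'a. 0::'b)" "wnorm M K \<rho> (\<lambda>x::'a. 0::'b) = 0"
    using wnorm_nonneg[of M K \<rho> "\<lambda>x::'a. 0::'b"] by auto
qed

lemma wnorm_scaleR:
  fixes f :: "'a::euclidean_space \<Rightarrow> 'b::real_normed_vector"
  assumes "wfin M K \<rho> f" "smooth f" "0 < \<rho>" "\<And>k. 0 < M k"
  shows "wnorm M K \<rho> (\<lambda>x. c *\<^sub>R f x) = \<bar>c\<bar> * wnorm M K \<rho> f"
proof (cases "c = 0")
  case True
  then show ?thesis using wnorm_zero[of \<rho> M] assms(3,4) by simp
next
  case False
  have c: "wfin M K \<rho> (\<lambda>x. c *\<^sub>R f x)" "wnorm M K \<rho> (\<lambda>x. c *\<^sub>R f x) \<le> \<bar>c\<bar> * wnorm M K \<rho> f"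
    using wnorm_scaleR_le[OF assms] by auto
  have "wnorm M K \<rho> f \<le> \<bar>inverse c\<bar> * wnorm M K \<rho> (\<lambda>x. c *\<^sub>R f x)"
    using wnorm_scaleR_le[OF c(1) smooth_scaleR[OF assms(2)] assms(3,4), of "inverse c"] False by simp
  then have "\<bar>c\<bar> * wnorm M K \<rho> f \<le> wnorm M K \<rho> (\<lambda>x. c *\<^sub>R f x)"
    using False by (simp add: abs_inverse field_simps)
  with c(2) show ?thesis by simp
qed

lemma wnorm_diff:
  fixes f g :: "'a::euclidean_space \<Rightarrow> 'b::real_normed_vector"
  assumes "wfin M K \<rho> f" "wfin M K \<rho> g" "smooth f" "smooth g" "0 < \<rho>" "\<And>k. 0 < M k"
  shows "wfin M K \<rho> (\<lambda>x. f x - g x) \<and> wnorm M K \<rho> (\<lambda>x. f x - g x) \<le> wnorm M K \<rho> f + wnorm M K \<rho> g"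
proof -
  have "wfin M K \<rho> (\<lambda>x. (-1) *\<^sub>R g x)" "wnorm M K \<rho> (\<lambda>x. (-1) *\<^sub>R g x) \<le> wnorm M K \<rho> g"
    using wnorm_scaleR_le[OF assms(2,4,5,6), of "-1"] by auto
  with wnorm_add[OF assms(1) this(1) assms(3) smooth_scaleR[OF assms(4)] assms(5,6)]
  show ?thesis by auto
qed

text \<open>Pointwise form with the exact rate \<open>s * r * (2 + A * t)\<close>. Keeping it exact
  leaves room for a larger target radius, whose surplus makes high orders small.\<close>

lemma dnorm_comp_le_wnorm:
  fixes g :: "'a::euclidean_space \<Rightarrow> 'b::euclidean_space" and f :: "'b \<Rightarrow> 'c::real_normed_vector"
  assumes f: "smooth f" "wfin N L t f" and g: "smooth g" "wfin N K s g" "wnorm N K s g \<le> A" "g ` K \<subseteq> L"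
    and N: "\<And>k. 0 < N k" "N 0 = 1" and st: "0 < s" "0 < t"
    and circ: "\<And>k. circ_seq N k \<le> C * r ^ k * N' k" and x: "x \<in> K"
  shows "dnorm k (f \<circ> g) x \<le> C * wnorm N L t f * (fact k * (s * r * (2 + A * t)) ^ k * N' k)"
proof -
  have A: "0 \<le> A" using wnorm_nonneg[OF g(2)] g(3) by simp
  have "dnorm k (f \<circ> g) x \<le> wnorm N L t f * (fact k * (s * (2 + A * t)) ^ k * circ_seq N k)"
  proof (rule dnorm_comp_le[where A = A and N = N, OF f(1) g(1) N A])
    fix k
    have "dnorm k g x \<le> wnorm N K s g * (fact k * s ^ k * N k)"
      by (rule dnorm_le_wnorm) (use g x st N in auto)
    also have "\<dots> \<le> A * (fact k * s ^ k * N k)"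
      using g(3) st less_imp_le[OF N(1)] by (intro mult_right_mono) auto
    finally show "dnorm k g x \<le> A * (fact k * s ^ k * N k)" .
    show "dnorm k f (g x) \<le> wnorm N L t f * (fact k * t ^ k * N k)"
      by (rule dnorm_le_wnorm) (use f g x st N in auto)
  qed (use st wnorm_nonneg[OF f(2)] in auto)
  also have "\<dots> \<le> wnorm N L t f * (fact k * (s * (2 + A * t)) ^ k * (C * r ^ k * N' k))"
    using st A wnorm_nonneg[OF f(2)] by (intro mult_left_mono circ) auto
  also have "\<dots> = C * wnorm N L t f * (fact k * (s * r * (2 + A * t)) ^ k * N' k)"
    by (simp add: power_mult_distrib mult_ac)
  finally show ?thesis .
qed

text \<open>The bound is linear in the norm of \<open>f\<close> once \<open>A\<close> is fixed,
  which makes it useful for a difference of two outer functions.\<close>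

lemma wnorm_comp_le:
  fixes g :: "'a::euclidean_space \<Rightarrow> 'b::euclidean_space" and f :: "'b \<Rightarrow> 'c::real_normed_vector"
  assumes f: "smooth f" "wfin N L t f" and g: "smooth g" "wfin N K s g" "wnorm N K s g \<le> A" "g ` K \<subseteq> L"
    and N: "\<And>k. 0 < N k" "N 0 = 1" and N': "\<And>k. 0 < N' k" and st: "0 < s" "0 < t"
    and circ: "\<And>k. circ_seq N k \<le> C * r ^ k * N' k" "0 < C" "0 < r"
    and \<rho>: "s * r * (2 + A * t) \<le> \<rho>"
  shows "wfin N' K \<rho> (f \<circ> g) \<and> wnorm N' K \<rho> (f \<circ> g) \<le> C * wnorm N L t f"
proof (rule wnorm_leI)
  have A: "0 \<le> A" using wnorm_nonneg[OF g(2)] g(3) by simp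
  then have Q: "0 < s * r * (2 + A * t)" using st circ by (intro mult_pos_pos add_pos_nonneg) auto
  then show "0 < \<rho>" using \<rho> by linarith
  show nn: "0 \<le> C * wnorm N L t f" using circ wnorm_nonneg[OF f(2)] by simp
  fix k x assume "x \<in> K"
  then have "dnorm k (f \<circ> g) x \<le> C * wnorm N L t f * (fact k * (s * r * (2 + A * t)) ^ k * N' k)"
    by (rule dnorm_comp_le_wnorm[OF f g N st circ(1)])
  also have "\<dots> \<le> C * wnorm N L t f * (fact k * \<rho> ^ k * N' k)"
    using Q \<rho> less_imp_le[OF N'] by (intro mult_left_mono mult_right_mono power_mono nn) auto
  finally show "dnorm k (f \<circ> g) x \<le> C * wnorm N L t f * (fact k * \<rho> ^ k * N' k)" .
qed (rule N')

text \<open>The mean value bound is not uniform in the order, and the composition bound does not see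
  that \<open>g\<close> and \<open>h\<close> are close. Orders up to \<open>J\<close> use the
  former, the others the latter, where a target radius of at least twice the rate supplies the
  factor \<open>1 / 2 ^ k\<close>. The same \<open>\<delta>\<close> serves all pairs in the ball of
  radius \<open>A\<close>.\<close>

lemma wnorm_comp_uniformly_continuous:
  fixes f :: "'b::euclidean_space \<Rightarrow> 'c::real_normed_vector" and K :: "'a::euclidean_space set"
  assumes f: "smooth f" "wfin N L t f" and L: "convex L"
    and N: "\<And>k. 0 < N k" "N 0 = 1" and N': "\<And>k. 0 < N' k" and st: "0 < s" "0 < t"
    and circ: "\<And>k. circ_seq N k \<le> C * r ^ k * N' k" "0 < C" "0 < r"
    and A: "0 \<le> A" and \<rho>: "2 * (s * r * (2 + A * t)) \<le> \<rho>" and \<epsilon>: "0 < \<epsilon>"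
  obtains \<delta> where "0 < \<delta>" "\<And>g h :: 'a \<Rightarrow> 'b. \<lbrakk>smooth g; smooth h; g ` K \<subseteq> L; h ` K \<subseteq> L;
      wfin N K s g; wfin N K s h; wnorm N K s g \<le> A; wnorm N K s h \<le> A; wnorm N K s (\<lambda>x. g x - h x) \<le> \<delta>\<rbrakk>
      \<Longrightarrow> wfin N' K \<rho> (\<lambda>x. (f \<circ> g) x - (f \<circ> h) x) \<and> wnorm N' K \<rho> (\<lambda>x. (f \<circ> g) x - (f \<circ> h) x) \<le> \<epsilon>"
proof -
  let ?Q = "s * r * (2 + A * t)"
  have Q: "0 < ?Q" using A st circ by (intro mult_pos_pos add_pos_nonneg) auto
  have \<rho>0: "0 < \<rho>" using Q \<rho> by linarith
  have nf: "0 \<le> wnorm N L t f" by (rule wnorm_nonneg[OF f(2)])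
  define Bf where "Bf = C * wnorm N L t f"
  have Bf: "0 \<le> Bf" using nf circ by (simp add: Bf_def)
  \<comment> \<open>\<open>Bf\<close> bounds each composition at the exact rate, so the difference
    is at most \<open>2 * Bf\<close>; beyond order \<open>J\<close> this is below
    \<open>\<epsilon> * 2 ^ k\<close>.\<close>
  obtain J where J: "2 * Bf / \<epsilon> < 2 ^ J" using real_arch_pow[of 2 "2 * Bf / \<epsilon>"] by auto
  define W where "W = (\<Sum>b\<le>J. fact b * s ^ b * N b)"
  define F where "F = wnorm N L t f * (\<Sum>j\<le>Suc J. fact j * t ^ j * N j)"
  define R where "R = 1 + A * W"
  \<comment> \<open>\<open>G k\<close> is the mean value bound at order \<open>k\<close> per unit of
    \<open>\<delta>\<close>; \<open>w k\<close> is the weight it will be compared with.\<close>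
  define G where "G k = fact k * 3 ^ k * ((real k + 1) * F * R ^ k * W)" for k :: nat
  define w where "w k = fact k * \<rho> ^ k * N' k" for k
  define S where "S = (\<Sum>k\<le>J. G k / w k)"
  have W0: "0 \<le> W" unfolding W_def using st less_imp_le[OF N(1)] by (intro sum_nonneg) auto
  have F0: "0 \<le> F" unfolding F_def using st less_imp_le[OF N(1)] nf by (intro mult_nonneg_nonneg sum_nonneg) auto
  have R1: "1 \<le> R" using A W0 by (simp add: R_def)
  have w0: "0 < w k" for k using \<rho>0 N' by (simp add: w_def)
  have G0: "0 \<le> G k" for k using F0 W0 R1 by (simp add: G_def)
  have S0: "0 \<le> S" unfolding S_def using G0 w0 by (intro sum_nonneg divide_nonneg_pos) auto
  define \<delta> where "\<delta> = \<epsilon> / (1 + S)"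
  have \<delta>: "0 < \<delta>" using \<epsilon> S0 by (simp add: \<delta>_def)
  show ?thesis
  proof (rule that[OF \<delta>])
    fix g h :: "'a \<Rightarrow> 'b"
    assume g: "smooth g" and h: "smooth h" and gL: "g ` K \<subseteq> L" and hL: "h ` K \<subseteq> L"
      and wg: "wfin N K s g" and wh: "wfin N K s h" and Ag: "wnorm N K s g \<le> A" and Ah: "wnorm N K s h \<le> A"
      and gh: "wnorm N K s (\<lambda>x. g x - h x) \<le> \<delta>"
    have wgh: "wfin N K s (\<lambda>x. g x - h x)"
      using wnorm_diff[OF wg wh g h st(1) N(1)] by simp
    show "wfin N' K \<rho> (\<lambda>x. (f \<circ> g) x - (f \<circ> h) x) \<and> wnorm N' K \<rho> (\<lambda>x. (f \<circ> g) x - (f \<circ> h) x) \<le> \<epsilon>"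
    proof (rule wnorm_leI)
      fix k x assume x: "x \<in> K"
      show "dnorm k (\<lambda>x. (f \<circ> g) x - (f \<circ> h) x) x \<le> \<epsilon> * (fact k * \<rho> ^ k * N' k)"
      proof (cases "k \<le> J")
        case True
        have low: "dnorm b u x \<le> c * W" if "wfin N K s u" "wnorm N K s u \<le> c" "b \<le> k" for u :: "'a \<Rightarrow> 'b" and b c
        proof -
          have "dnorm b u x \<le> wnorm N K s u * (fact b * s ^ b * N b)"
            by (rule dnorm_le_wnorm[OF that(1) x st(1) N(1)])
          also have "\<dots> \<le> c * W"
          proof (rule mult_mono[OF that(2)])
            show "fact b * s ^ b * N b \<le> W" unfolding W_def
              using st less_imp_le[OF N(1)] that(3) True by (intro member_le_sum) auto
            show "0 \<le> c" using that(2) wnorm_nonneg[OF that(1)] by linarith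
          qed (use st less_imp_le[OF N(1)] in auto)
          finally show ?thesis .
        qed
        have "dnorm k (\<lambda>x. (f \<circ> g) x - (f \<circ> h) x) x \<le> fact k * 3 ^ k * ((real k + 1) * F * R ^ k * (\<delta> * W))"
        proof (rule dnorm_comp_diff_le[OF f(1) g h L _ _ _ R1])
          show "g x \<in> L" "h x \<in> L" using x gL hL by auto
          show "dnorm j f y \<le> F" if "j \<le> Suc k" "y \<in> L" for j y
          proof -
            have "dnorm j f y \<le> wnorm N L t f * (fact j * t ^ j * N j)"
              by (rule dnorm_le_wnorm[OF f(2) that(2) st(2) N(1)])
            also have "\<dots> \<le> F" unfolding F_def
              using st less_imp_le[OF N(1)] that(1) True by (intro mult_left_mono member_le_sum nf) auto
            finally show ?thesis .
          qed
          show "dnorm b g x \<le> R" "dnorm b h x \<le> R" "dnorm b (\<lambda>x. g x - h x) x \<le> \<delta> * W" if "b \<le> k" for b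
            using low[OF wg Ag that] low[OF wh Ah that] low[OF wgh gh that] by (simp_all add: R_def)
        qed
        also have "\<dots> = \<delta> * (G k / w k) * w k" using w0[of k] by (simp add: G_def)
        also have "\<dots> \<le> \<epsilon> * w k"
        proof (rule mult_right_mono)
          have "G k / w k \<le> S" unfolding S_def
            using True G0 w0 by (intro member_le_sum divide_nonneg_pos) auto
          then have "\<delta> * (G k / w k) \<le> \<delta> * (1 + S)" using \<delta> by (intro mult_left_mono) auto
          then show "\<delta> * (G k / w k) \<le> \<epsilon>" using S0 by (simp add: \<delta>_def)
        qed (use w0 in \<open>simp add: less_imp_le\<close>)
        finally show ?thesis by (simp add: w_def)
      next
        case False
        have c: "dnorm k (f \<circ> u) x \<le> Bf * (fact k * ?Q ^ k * N' k)"
          if "smooth u" "wfin N K s u" "wnorm N K s u \<le> A" "u ` K \<subseteq> L" for u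
          unfolding Bf_def by (rule dnorm_comp_le_wnorm[OF f that N st circ(1) x])
        have "dnorm k (\<lambda>x. (f \<circ> g) x - (f \<circ> h) x) x \<le> 2 * Bf * (fact k * ?Q ^ k * N' k)"
          using dnorm_diff_le[OF smooth_comp[OF f(1) g] smooth_comp[OF f(1) h], of k x]
            c[OF g wg Ag gL] c[OF h wh Ah hL] by linarith
        also have "\<dots> \<le> \<epsilon> * 2 ^ k * (fact k * ?Q ^ k * N' k)"
        proof (rule mult_right_mono)
          have "2 * Bf \<le> \<epsilon> * 2 ^ J" using J \<epsilon> by (simp add: field_simps)
          also have "\<dots> \<le> \<epsilon> * 2 ^ k" using False \<epsilon> by (intro mult_left_mono power_increasing) auto
          finally show "2 * Bf \<le> \<epsilon> * 2 ^ k" .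
        qed (use Q less_imp_le[OF N'] in auto)
        also have "\<dots> = \<epsilon> * (fact k * (2 * ?Q) ^ k * N' k)"
          unfolding power_mult_distrib[of 2] by (simp only: mult_ac)
        also have "\<dots> \<le> \<epsilon> * (fact k * \<rho> ^ k * N' k)"
          using Q \<rho> \<epsilon> less_imp_le[OF N'] by (intro mult_left_mono mult_right_mono power_mono) auto
        finally show ?thesis .
      qed
    qed (use \<epsilon> \<rho>0 N' in auto)
  qed
qed

section \<open>The Beurling case\<close>

lemma weight_matrixD:
  assumes "weight_matrix \<Lambda> M"
  shows "\<Lambda> \<noteq> {}" "l \<in> \<Lambda> \<Longrightarrow> 0 < M l k" "l \<in> \<Lambda> \<Longrightarrow> M l 0 = 1"
    "l \<in> \<Lambda> \<Longrightarrow> m \<in> \<Lambda> \<Longrightarrow> l \<le> m \<Longrightarrow> M l k \<le> M m k"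
  using assms unfolding weight_matrix_def by blast+

text \<open>Order \<open>0\<close> of the norm bounds the values of \<open>g\<close>, as
  \<open>N 0 = 1\<close>. This supplies the compact convex set on which the outer function has to be
  controlled.\<close>

lemma wnorm_image_subset_cball:
  assumes "wfin N K s g" "wnorm N K s g \<le> A" "0 < s" "\<And>k. 0 < N k" "N 0 = 1"
  shows "g ` K \<subseteq> cball 0 A"
proof clarify
  fix x assume "x \<in> K"
  then have "dnorm 0 g x \<le> wnorm N K s g * (fact 0 * s ^ 0 * N 0)"
    by (intro dnorm_le_wnorm assms)
  then show "g x \<in> cball 0 A" using assms by simp
qed

lemma topspace_EB_top [simp]: "topspace (EB_top \<Lambda> M) = EB \<Lambda> M"
  unfolding EB_top_def topology_generated_by_topspace by auto

lemma EB_diff: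
  assumes "weight_matrix \<Lambda> M" "f \<in> EB \<Lambda> M" "g \<in> EB \<Lambda> M"
  shows "(\<lambda>x. f x - g x) \<in> EB \<Lambda> M"
  using assms(2,3) weight_matrixD[OF assms(1)] unfolding EB_def
  by (auto intro!: smooth_diff conjunct1[OF wnorm_diff])

lemma EB_comp:
  fixes g :: "'p::euclidean_space \<Rightarrow> 'q::euclidean_space" and f :: "'q \<Rightarrow> 'r::euclidean_space"
  assumes wm: "weight_matrix \<Lambda> M" and FdB: "FdB_Beurling \<Lambda> M" and f: "f \<in> EB \<Lambda> M" and g: "g \<in> EB \<Lambda> M"
  shows "f \<circ> g \<in> EB \<Lambda> M"
proof -
  have fg: "smooth f" "smooth g" using f g by (auto simp: EB_def)
  have "wfin (M l) K \<rho> (f \<circ> g)" if l: "l \<in> \<Lambda>" and K: "compact K" and \<rho>: "0 < \<rho>" for l K \<rho>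
  proof -
    obtain m C r where m: "m \<in> \<Lambda>" and C: "0 < C" "0 < r" "\<And>k. circ_seq (M m) k \<le> C * r ^ k * M l k"
      using FdB l unfolding FdB_Beurling_def seq_preceq_def by metis
    \<comment> \<open>With \<open>t = 1 / A\<close> the rate \<open>s * r * (2 + A * t)\<close> is
      \<open>3 * s * r\<close>, so \<open>s\<close> can be fixed before \<open>A\<close> is known.
      The \<open>1\<close> in \<open>A\<close> keeps \<open>1 / A\<close> meaningful.\<close>
    define s where "s = \<rho> / (3 * r)"
    define A where "A = 1 + wnorm (M m) K s g"
    have s: "0 < s" using \<rho> C by (simp add: s_def)
    have gs: "wfin (M m) K s g" using g m K s by (simp add: EB_def)
    have A: "1 \<le> A" using wnorm_nonneg[OF gs] by (simp add: A_def)
    have "wfin (M m) (cball 0 A) (1 / A) f" using f m A by (simp add: EB_def)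
    moreover have "s * r * (2 + A * (1 / A)) \<le> \<rho>" using A C by (simp add: s_def)
    ultimately have "wfin (M l) K \<rho> (f \<circ> g) \<and> wnorm (M l) K \<rho> (f \<circ> g) \<le> C * wnorm (M m) (cball 0 A) (1 / A) f"
      using wnorm_image_subset_cball[OF gs _ s, of A] weight_matrixD[OF wm] s A C m l gs fg
      by (intro wnorm_comp_le[where A = A and s = s and r = r]) (auto simp: A_def)
    then show ?thesis ..
  qed
  then show ?thesis using smooth_comp[OF fg] by (simp add: EB_def)
qed

lemma EB_comp_continuous_at:
  fixes g\<^sub>0 :: "'p::euclidean_space \<Rightarrow> 'q::euclidean_space" and f\<^sub>0 :: "'q \<Rightarrow> 'r::euclidean_space"
  assumes wm: "weight_matrix \<Lambda> M" and FdB: "FdB_Beurling \<Lambda> M"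
    and f\<^sub>0: "f\<^sub>0 \<in> EB \<Lambda> M" and g\<^sub>0: "g\<^sub>0 \<in> EB \<Lambda> M"
    and l: "l \<in> \<Lambda>" and K: "compact K" and \<rho>: "0 < \<rho>" and \<epsilon>: "0 < \<epsilon>"
  obtains m L s t \<delta> where "m \<in> \<Lambda>" "compact L" "0 < s" "0 < t" "0 < \<delta>"
    "\<And>g f. g \<in> EB \<Lambda> M \<Longrightarrow> f \<in> EB \<Lambda> M \<Longrightarrow> wnorm (M m) K s (\<lambda>x. g x - g\<^sub>0 x) < \<delta> \<Longrightarrow>
       wnorm (M m) L t (\<lambda>x. f x - f\<^sub>0 x) < \<delta> \<Longrightarrow> wnorm (M l) K \<rho> (\<lambda>x. (f \<circ> g) x - (f\<^sub>0 \<circ> g\<^sub>0) x) < \<epsilon>"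
proof -
  obtain m C r where m: "m \<in> \<Lambda>" and C: "0 < C" "0 < r" "\<And>k. circ_seq (M m) k \<le> C * r ^ k * M l k"
    using FdB l unfolding FdB_Beurling_def seq_preceq_def by metis
  \<comment> \<open>Half of the value used in \<open>EB_comp\<close>, because uniform continuity
    asks for a target radius of twice the rate.\<close>
  define s where "s = \<rho> / (6 * r)"
  define A where "A = 1 + wnorm (M m) K s g\<^sub>0"
  define t where "t = 1 / A"
  define L where "L = cball (0 :: 'q) A"
  have s: "0 < s" using \<rho> C by (simp add: s_def)
  have fin: "wfin (M m) K' s' u" if "u \<in> EB \<Lambda> M" "compact K'" "0 < s'"
    for K' s' and u :: "'x::euclidean_space \<Rightarrow> 'y::euclidean_space"
    using that m by (simp add: EB_def)
  have sm: "smooth u" if "u \<in> EB \<Lambda> M" for u :: "'x::euclidean_space \<Rightarrow> 'y::euclidean_space"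
    using that by (simp add: EB_def)
  have A: "1 \<le> A" using wnorm_nonneg[OF fin[OF g\<^sub>0 K s]] by (simp add: A_def)
  have t: "0 < t" using A by (simp add: t_def)
  have L: "compact L" "convex L" by (auto simp: L_def)
  have \<rho>': "2 * (s * r * (2 + A * t)) \<le> \<rho>" using A C by (simp add: s_def t_def)
  have N: "\<And>k. 0 < M m k" "M m 0 = 1" and N': "\<And>k. 0 < M l k"
    using weight_matrixD[OF wm] m l by auto
  obtain \<delta>\<^sub>1 where \<delta>\<^sub>1: "0 < \<delta>\<^sub>1" "\<And>g h :: 'p \<Rightarrow> 'q. \<lbrakk>smooth g; smooth h; g ` K \<subseteq> L; h ` K \<subseteq> L;
      wfin (M m) K s g; wfin (M m) K s h; wnorm (M m) K s g \<le> A; wnorm (M m) K s h \<le> A;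
      wnorm (M m) K s (\<lambda>x. g x - h x) \<le> \<delta>\<^sub>1\<rbrakk>
      \<Longrightarrow> wfin (M l) K \<rho> (\<lambda>x. (f\<^sub>0 \<circ> g) x - (f\<^sub>0 \<circ> h) x) \<and> wnorm (M l) K \<rho> (\<lambda>x. (f\<^sub>0 \<circ> g) x - (f\<^sub>0 \<circ> h) x) \<le> \<epsilon> / 3"
    by (rule wnorm_comp_uniformly_continuous[where f = f\<^sub>0 and N = "M m" and L = L and N' = "M l" and K = K
          and s = s and t = t and A = A and \<rho> = \<rho> and \<epsilon> = "\<epsilon> / 3",
          OF sm[OF f\<^sub>0] fin[OF f\<^sub>0 L(1) t] L(2) N N' s t C(3,1,2) _ \<rho>'])
      (use A \<epsilon> in auto)
  \<comment> \<open>\<open>1\<close> keeps \<open>g\<close> in the ball of radius \<open>A\<close>,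
    \<open>\<delta>\<^sub>1\<close> serves the change of the inner function, and
    \<open>\<epsilon> / (3 * C)\<close> makes the part linear in \<open>f - f\<^sub>0\<close> at
    most \<open>\<epsilon> / 3\<close>.\<close>
  define \<delta> where "\<delta> = min 1 (min \<delta>\<^sub>1 (\<epsilon> / (3 * C)))"
  show ?thesis
  proof (rule that[OF m L(1) s t])
    show "0 < \<delta>" using \<delta>\<^sub>1 \<epsilon> C by (simp add: \<delta>_def)
    fix g :: "'p \<Rightarrow> 'q" and f :: "'q \<Rightarrow> 'r"
    assume g: "g \<in> EB \<Lambda> M" and f: "f \<in> EB \<Lambda> M"
      and dg: "wnorm (M m) K s (\<lambda>x. g x - g\<^sub>0 x) < \<delta>" and df: "wnorm (M m) L t (\<lambda>x. f x - f\<^sub>0 x) < \<delta>"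
    note gg = EB_diff[OF wm g g\<^sub>0] and ff = EB_diff[OF wm f f\<^sub>0]
    have gA: "wnorm (M m) K s g \<le> A"
      using wnorm_add[OF fin[OF gg K s] fin[OF g\<^sub>0 K s] sm[OF gg] sm[OF g\<^sub>0] s N(1)] dg
      by (simp add: A_def \<delta>_def)
    have gL: "g ` K \<subseteq> L" "g\<^sub>0 ` K \<subseteq> L"
      unfolding L_def using wnorm_image_subset_cball[OF fin[OF g K s] gA s N]
        wnorm_image_subset_cball[OF fin[OF g\<^sub>0 K s] _ s N, of A] by (auto simp: A_def)
    have 1: "wfin (M l) K \<rho> (\<lambda>x. (f\<^sub>0 \<circ> g) x - (f\<^sub>0 \<circ> g\<^sub>0) x)"
        "wnorm (M l) K \<rho> (\<lambda>x. (f\<^sub>0 \<circ> g) x - (f\<^sub>0 \<circ> g\<^sub>0) x) \<le> \<epsilon> / 3"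
      using \<delta>\<^sub>1(2)[OF sm[OF g] sm[OF g\<^sub>0] gL fin[OF g K s] fin[OF g\<^sub>0 K s] gA] dg by (auto simp: A_def \<delta>_def)
    have "s * r * (2 + A * t) \<le> \<rho>" using \<rho>' \<rho> by simp
    then have 2: "wfin (M l) K \<rho> ((\<lambda>x. f x - f\<^sub>0 x) \<circ> g)"
        "wnorm (M l) K \<rho> ((\<lambda>x. f x - f\<^sub>0 x) \<circ> g) \<le> C * wnorm (M m) L t (\<lambda>x. f x - f\<^sub>0 x)"
      using wnorm_comp_le[OF sm[OF ff] fin[OF ff L(1) t] sm[OF g] fin[OF g K s] gA gL(1) N N' s t C(3,1,2)] by auto
    have "C * wnorm (M m) L t (\<lambda>x. f x - f\<^sub>0 x) \<le> C * (\<epsilon> / (3 * C))"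
      using df C by (intro mult_left_mono) (auto simp: \<delta>_def)
    also have "\<dots> = \<epsilon> / 3" using C by simp
    finally have 3: "wnorm (M l) K \<rho> ((\<lambda>x. f x - f\<^sub>0 x) \<circ> g) \<le> \<epsilon> / 3" using 2 by simp
    have eq: "(\<lambda>x. ((\<lambda>x. f x - f\<^sub>0 x) \<circ> g) x + ((f\<^sub>0 \<circ> g) x - (f\<^sub>0 \<circ> g\<^sub>0) x)) = (\<lambda>x. (f \<circ> g) x - (f\<^sub>0 \<circ> g\<^sub>0) x)"
      by (simp add: fun_eq_iff)
    show "wnorm (M l) K \<rho> (\<lambda>x. (f \<circ> g) x - (f\<^sub>0 \<circ> g\<^sub>0) x) < \<epsilon>"
      using wnorm_add[OF 2(1) 1(1) smooth_comp[OF sm[OF ff] sm[OF g]]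
          smooth_diff[OF smooth_comp[OF sm[OF f\<^sub>0] sm[OF g]] smooth_comp[OF sm[OF f\<^sub>0] sm[OF g\<^sub>0]]] \<rho> N']
        1(2) 3 \<epsilon> unfolding eq by linarith
  qed
qed

theorem continuous_map_comp_Beurling:
  assumes wm: "weight_matrix \<Lambda> M" and FdB: "FdB_Beurling \<Lambda> M"
  shows "continuous_map (prod_topology (EB_top \<Lambda> M :: ('p::euclidean_space \<Rightarrow> 'q::euclidean_space) topology)
      (EB_top \<Lambda> M :: ('q \<Rightarrow> 'r::euclidean_space) topology)) (EB_top \<Lambda> M :: ('p \<Rightarrow> 'r) topology) (\<lambda>(g, f). f \<circ> g)"
    (is "continuous_map ?X _ ?c")
proof -
  have ball: "openin (EB_top \<Lambda> M) {g \<in> EB \<Lambda> M. wnorm (M l) K \<rho> (\<lambda>x. g x - f x) < \<epsilon>}"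
    if "f \<in> EB \<Lambda> M" "l \<in> \<Lambda>" "compact K" "0 < \<rho>" "0 < \<epsilon>"
    for f :: "'x::euclidean_space \<Rightarrow> 'y::euclidean_space" and l K \<rho> \<epsilon>
    unfolding EB_top_def by (rule topology_generated_by_Basis) (use that in blast)
  have top: "topspace ?X = EB \<Lambda> M \<times> EB \<Lambda> M" by simp
  have img: "?c ` topspace ?X \<subseteq> EB \<Lambda> M"
    unfolding top using EB_comp[OF wm FdB] by auto
  have opn: "openin ?X (?c -` {h \<in> EB \<Lambda> M. wnorm (M l) K \<rho> (\<lambda>x. h x - k x) < \<epsilon>} \<inter> topspace ?X)" (is "openin _ ?V")
    if k: "k \<in> EB \<Lambda> M" and l: "l \<in> \<Lambda>" and K: "compact K" and \<rho>: "0 < \<rho>" for k :: "'p \<Rightarrow> 'r" and l K \<rho> \<epsilon>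
  proof (subst openin_subopen, clarify)
    fix g\<^sub>0 :: "'p \<Rightarrow> 'q" and f\<^sub>0 :: "'q \<Rightarrow> 'r"
    assume "(g\<^sub>0, f\<^sub>0) \<in> topspace ?X" and "f\<^sub>0 \<circ> g\<^sub>0 \<in> EB \<Lambda> M"
      and lt: "wnorm (M l) K \<rho> (\<lambda>x. (f\<^sub>0 \<circ> g\<^sub>0) x - k x) < \<epsilon>"
    then have g\<^sub>0: "g\<^sub>0 \<in> EB \<Lambda> M" and f\<^sub>0: "f\<^sub>0 \<in> EB \<Lambda> M" by auto
    \<comment> \<open>A generating ball may have any centre \<open>k\<close>; \<open>\<eta>\<close>
      is the slack that the triangle inequality leaves at the given point.\<close>
    define \<eta> where "\<eta> = \<epsilon> - wnorm (M l) K \<rho> (\<lambda>x. (f\<^sub>0 \<circ> g\<^sub>0) x - k x)"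
    have \<eta>: "0 < \<eta>" using lt by (simp add: \<eta>_def)
    obtain m L s t \<delta> where m: "m \<in> \<Lambda>" "compact L" "0 < s" "0 < t" "0 < \<delta>"
      and *: "\<And>g f. g \<in> EB \<Lambda> M \<Longrightarrow> f \<in> EB \<Lambda> M \<Longrightarrow> wnorm (M m) K s (\<lambda>x. g x - g\<^sub>0 x) < \<delta> \<Longrightarrow>
       wnorm (M m) L t (\<lambda>x. f x - f\<^sub>0 x) < \<delta> \<Longrightarrow> wnorm (M l) K \<rho> (\<lambda>x. (f \<circ> g) x - (f\<^sub>0 \<circ> g\<^sub>0) x) < \<eta>"
      by (rule EB_comp_continuous_at[OF wm FdB f\<^sub>0 g\<^sub>0 l K \<rho> \<eta>]) (rule that, assumption+)
    define T where "T = {g \<in> EB \<Lambda> M. wnorm (M m) K s (\<lambda>x. g x - g\<^sub>0 x) < \<delta>} \<times> {f \<in> EB \<Lambda> M. wnorm (M m) L t (\<lambda>x. f x - f\<^sub>0 x) < \<delta>}"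
    have N: "\<And>k. 0 < M m k" "\<And>k. 0 < M l k" using weight_matrixD[OF wm] m l by auto
    have "openin ?X T"
      unfolding T_def openin_prod_Times_iff by (intro disjI2 conjI ball g\<^sub>0 f\<^sub>0 m K)
    moreover have "(g\<^sub>0, f\<^sub>0) \<in> T"
      using g\<^sub>0 f\<^sub>0 m by (simp add: T_def wnorm_zero(2) N)
    moreover have "T \<subseteq> ?V"
    proof clarify
      fix g f assume "(g, f) \<in> T"
      then have g: "g \<in> EB \<Lambda> M" and f: "f \<in> EB \<Lambda> M"
        and lt: "wnorm (M l) K \<rho> (\<lambda>x. (f \<circ> g) x - (f\<^sub>0 \<circ> g\<^sub>0) x) < \<eta>"
        using * by (auto simp: T_def)
      note c = EB_comp[OF wm FdB f g] and c0 = EB_comp[OF wm FdB f\<^sub>0 g\<^sub>0]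
      have fin: "wfin (M l) K \<rho> (\<lambda>x. u x - v x)" "smooth (\<lambda>x. u x - v x)" if "u \<in> EB \<Lambda> M" "v \<in> EB \<Lambda> M" for u v :: "'p \<Rightarrow> 'r"
        using EB_diff[OF wm that] l K \<rho> by (auto simp: EB_def)
      have "wnorm (M l) K \<rho> (\<lambda>x. ((f \<circ> g) x - (f\<^sub>0 \<circ> g\<^sub>0) x) + ((f\<^sub>0 \<circ> g\<^sub>0) x - k x)) < \<epsilon>"
        using wnorm_add[OF fin(1)[OF c c0] fin(1)[OF c0 k] fin(2)[OF c c0] fin(2)[OF c0 k] \<rho> N(2)] lt
        unfolding \<eta>_def by linarith
      then show "(g, f) \<in> ?V" using g f c by simp
    qed
    ultimately show "\<exists>T. openin ?X T \<and> (g\<^sub>0, f\<^sub>0) \<in> T \<and> T \<subseteq> ?V" by blast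
  qed
  have all: "openin ?X (?c -` EB \<Lambda> M \<inter> topspace ?X)"
  proof -
    have "?c -` EB \<Lambda> M \<inter> topspace ?X = topspace ?X" using img by blast
    then show ?thesis using openin_topspace[of ?X] by simp
  qed
  show ?thesis
    unfolding EB_top_def[where ?'a = 'p and ?'b = 'r]
  proof (rule continuous_on_generated_topo)
    fix U :: "('p \<Rightarrow> 'r) set"
    assume "U \<in> insert (EB \<Lambda> M) {{g \<in> EB \<Lambda> M. wnorm (M l) K \<rho> (\<lambda>x. g x - f x) < \<epsilon>} | f l K \<rho> \<epsilon>.
        f \<in> EB \<Lambda> M \<and> l \<in> \<Lambda> \<and> compact K \<and> \<rho> > 0 \<and> \<epsilon> > 0}"
    then show "openin ?X (?c -` U \<inter> topspace ?X)"
    proof (elim insertE CollectE exE conjE)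
    qed (simp_all only: all opn)
  qed (use img in auto)
qed

section \<open>Seminorms of the inductive limit\<close>

lemma topspace_ER_top [simp]: "topspace (ER_top \<Lambda> M) = ER \<Lambda> M"
  unfolding ER_top_def topology_generated_by_topspace by auto

lemma ER_subset_EK: "compact K \<Longrightarrow> ER \<Lambda> M \<subseteq> EK \<Lambda> M K"
  by (auto simp: ER_def EK_def)

lemma EK_smooth: "f \<in> EK \<Lambda> M K \<Longrightarrow> smooth f"
  by (simp add: EK_def)

lemma ER_iff_EK: "f \<in> ER \<Lambda> M \<longleftrightarrow> smooth f \<and> (\<forall>K. compact K \<longrightarrow> f \<in> EK \<Lambda> M K)"
  by (auto simp: ER_def EK_def)

lemma adm_seminorm_nonneg: "adm_seminorm \<Lambda> M K p \<Longrightarrow> f \<in> EK \<Lambda> M K \<Longrightarrow> 0 \<le> p f"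
  by (simp add: adm_seminorm_def seminorm_on_def)

lemma adm_seminorm_scaleR: "adm_seminorm \<Lambda> M K p \<Longrightarrow> f \<in> EK \<Lambda> M K \<Longrightarrow> p (\<lambda>x. c *\<^sub>R f x) = \<bar>c\<bar> * p f"
  by (simp add: adm_seminorm_def seminorm_on_def)

lemma adm_seminorm_add:
  "adm_seminorm \<Lambda> M K p \<Longrightarrow> f \<in> EK \<Lambda> M K \<Longrightarrow> g \<in> EK \<Lambda> M K \<Longrightarrow> p (\<lambda>x. f x + g x) \<le> p f + p g"
  by (simp add: adm_seminorm_def seminorm_on_def)

lemma adm_seminorm_triangle:
  assumes "adm_seminorm \<Lambda> M K p" "(\<lambda>x. f x - g x) \<in> EK \<Lambda> M K" "(\<lambda>x. g x - h x) \<in> EK \<Lambda> M K"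
  shows "p (\<lambda>x. f x - h x) \<le> p (\<lambda>x. f x - g x) + p (\<lambda>x. g x - h x)"
  using adm_seminorm_add[OF assms] by simp

text \<open>A positive constant is extracted so that tolerances can be divided by it.\<close>

lemma adm_seminorm_step:
  fixes p :: "('a::euclidean_space \<Rightarrow> 'b::euclidean_space) \<Rightarrow> real"
  assumes "adm_seminorm \<Lambda> M K p" "l \<in> \<Lambda>" "0 < m"
  obtains C where "0 < C" "\<And>f. smooth f \<Longrightarrow> wfin (M l) K (real m) f \<Longrightarrow> p f \<le> C * wnorm (M l) K (real m) f"
proof -
  obtain C where C: "\<And>f. smooth f \<Longrightarrow> wfin (M l) K (real m) f \<Longrightarrow> p f \<le> C * wnorm (M l) K (real m) f"
  proof -
    have "\<exists>C. \<forall>f. smooth f \<and> wfin (M l) K (real m) f \<longrightarrow> p f \<le> C * wnorm (M l) K (real m) f"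
      using assms by (simp add: adm_seminorm_def)
    then show ?thesis using that by auto
  qed
  show ?thesis
  proof (rule that[of "\<bar>C\<bar> + 1"])
    fix f :: "'a \<Rightarrow> 'b" assume f: "smooth f" "wfin (M l) K (real m) f"
    have "C * wnorm (M l) K (real m) f \<le> (\<bar>C\<bar> + 1) * wnorm (M l) K (real m) f"
      by (intro mult_right_mono wnorm_nonneg f) auto
    then show "p f \<le> (\<bar>C\<bar> + 1) * wnorm (M l) K (real m) f" using C[OF f] by linarith
  qed simp
qed

text \<open>A cofinal sequence of the Banach steps that define the inductive limit.\<close>
definition exhausting :: "real set \<Rightarrow> (nat \<Rightarrow> real) \<Rightarrow> (nat \<Rightarrow> nat) \<Rightarrow> bool" where
  "exhausting \<Lambda> lam rad \<longleftrightarrow> (\<forall>n. lam n \<in> \<Lambda> \<and> 0 < rad n) \<and> mono lam \<and> mono rad \<and>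
     (\<forall>l\<in>\<Lambda>. \<forall>m. \<exists>n. l \<le> lam n \<and> m \<le> rad n)"

lemma exhaustingD:
  assumes "exhausting \<Lambda> lam rad"
  shows "lam n \<in> \<Lambda>" "0 < rad n" "mono lam" "mono rad" "l \<in> \<Lambda> \<Longrightarrow> \<exists>n. l \<le> lam n \<and> m \<le> rad n"
  using assms by (auto simp: exhausting_def)

text \<open>Even an uncountable \<open>\<Lambda>\<close> has a countable cofinal part: its maximum
  if there is one, and otherwise one element above each rational that lies below some element of
  \<open>\<Lambda>\<close>. Running maxima make the enumeration monotone.\<close>

lemma cofinal_sequence_real:
  fixes \<Lambda> :: "real set"
  assumes "\<Lambda> \<noteq> {}"
  obtains lam :: "nat \<Rightarrow> real" where "\<And>n. lam n \<in> \<Lambda>" "mono lam" "\<And>l. l \<in> \<Lambda> \<Longrightarrow> \<exists>n. l \<le> lam n"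
proof -
  have "\<exists>D\<subseteq>\<Lambda>. countable D \<and> D \<noteq> {} \<and> (\<forall>l\<in>\<Lambda>. \<exists>d\<in>D. l \<le> d)"
  proof (cases "\<exists>t\<in>\<Lambda>. \<forall>l\<in>\<Lambda>. l \<le> t")
    case True
    then obtain t where "t \<in> \<Lambda>" "\<forall>l\<in>\<Lambda>. l \<le> t" by blast
    then show ?thesis by (intro exI[of _ "{t}"]) auto
  next
    case False
    define Q where "Q = {q \<in> \<rat>. \<exists>l\<in>\<Lambda>. q \<le> l}"
    define c where "c q = (SOME l. l \<in> \<Lambda> \<and> q \<le> l)" for q
    have c: "c q \<in> \<Lambda> \<and> q \<le> c q" if "q \<in> Q" for q
      unfolding c_def by (rule someI_ex) (use that in \<open>auto simp: Q_def\<close>)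
    have cof: "\<exists>d\<in>c ` Q. l \<le> d" if l: "l \<in> \<Lambda>" for l
    proof -
      obtain l' where l': "l' \<in> \<Lambda>" "l < l'" using False l by force
      then obtain q where q: "q \<in> \<rat>" "l < q" "q < l'" using Rats_dense_in_real by blast
      then have "q \<in> Q" using l' by (auto simp: Q_def intro!: bexI[of _ l'])
      with c[of q] q show ?thesis by (intro bexI[of _ "c q"]) auto
    qed
    show ?thesis
    proof (intro exI[of _ "c ` Q"] conjI ballI cof)
      have "Q \<subseteq> \<rat>" by (auto simp: Q_def)
      then show "countable (c ` Q)" using countable_rat countable_subset by blast
      show "c ` Q \<noteq> {}" using cof assms by blast
    qed (use c in auto)
  qed
  then obtain D where D: "D \<subseteq> \<Lambda>" "countable D" "D \<noteq> {}" "\<forall>l\<in>\<Lambda>. \<exists>d\<in>D. l \<le> d" by blast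
  define lam where "lam n = Max (from_nat_into D ` {..n})" for n
  show ?thesis
  proof
    show "lam n \<in> \<Lambda>" for n
    proof -
      have "lam n \<in> from_nat_into D ` {..n}" unfolding lam_def by (rule Max_in) auto
      then show ?thesis using from_nat_into[OF D(3)] D(1) by auto
    qed
    show "mono lam" unfolding lam_def by (intro monoI Max_mono image_mono) auto
    show "\<exists>n. l \<le> lam n" if "l \<in> \<Lambda>" for l
    proof -
      obtain d where "d \<in> D" "l \<le> d" using D(4) \<open>l \<in> \<Lambda>\<close> by auto
      then obtain n where "d = from_nat_into D n" using from_nat_into_surj[OF D(2), of d] by auto
      then have "d \<le> lam n" unfolding lam_def by (intro Max_ge) auto
      with \<open>l \<le> d\<close> show ?thesis by (intro exI[of _ n]) simp
    qed
  qed
qed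

lemma ex_exhausting:
  assumes "\<Lambda> \<noteq> {}"
  obtains lam rad where "exhausting \<Lambda> lam rad"
proof -
  obtain lam :: "nat \<Rightarrow> real" where lam: "\<And>n. lam n \<in> \<Lambda>" "mono lam" "\<And>l. l \<in> \<Lambda> \<Longrightarrow> \<exists>n. l \<le> lam n"
    using cofinal_sequence_real[OF assms] by blast
  have "\<exists>n. l \<le> lam n \<and> m \<le> Suc n" if "l \<in> \<Lambda>" for l m
  proof -
    obtain n where "l \<le> lam n" using lam(3)[OF \<open>l \<in> \<Lambda>\<close>] ..
    then have "l \<le> lam (max n m)" using monoD[OF lam(2), of n "max n m"] by simp
    then show ?thesis by (intro exI[of _ "max n m"]) simp
  qed
  then have "exhausting \<Lambda> lam Suc"
    using lam by (auto simp: exhausting_def mono_def)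
  then show ?thesis by (rule that)
qed

text \<open>Serves to start the sequence at a step that already contains given functions.\<close>

lemma exhausting_shift:
  assumes "exhausting \<Lambda> lam rad"
  shows "exhausting \<Lambda> (\<lambda>n. lam (n + i)) (\<lambda>n. rad (n + i))"
proof -
  note m = exhaustingD(3,4)[OF assms]
  have "\<exists>n. l \<le> lam (n + i) \<and> m \<le> rad (n + i)" if "l \<in> \<Lambda>" for l m
  proof -
    obtain n where "l \<le> lam n" "m \<le> rad n" using exhaustingD(5)[OF assms \<open>l \<in> \<Lambda>\<close>] by auto
    then show ?thesis
      using monoD[OF m(1), of n "n + i"] monoD[OF m(2), of n "n + i"] by (intro exI[of _ n]) auto
  qed
  then show ?thesis using assms m by (auto simp: exhausting_def mono_def)
qed

section \<open>Linear structure of the limits and gauges of hulls of balls\<close>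

context
  fixes \<Lambda> :: "real set" and M :: "real \<Rightarrow> nat \<Rightarrow> real"
  assumes wm: "weight_matrix \<Lambda> M"
begin

lemma wnorm_step_mono:
  fixes f :: "'a::euclidean_space \<Rightarrow> 'b::euclidean_space"
  assumes "wfin (M l) K \<rho> f" "l \<in> \<Lambda>" "l' \<in> \<Lambda>" "l \<le> l'" "0 < \<rho>" "\<rho> \<le> \<rho>'"
  shows "wfin (M l') K \<rho>' f \<and> wnorm (M l') K \<rho>' f \<le> wnorm (M l) K \<rho> f"
  by (rule wnorm_mono) (use assms weight_matrixD[OF wm] in auto)

lemma exhausting_mono:
  fixes f :: "'a::euclidean_space \<Rightarrow> 'b::euclidean_space"
  assumes "exhausting \<Lambda> lam rad" "i \<le> j" "wfin (M (lam i)) K (rad i) f"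
  shows "wfin (M (lam j)) K (rad j) f \<and> wnorm (M (lam j)) K (rad j) f \<le> wnorm (M (lam i)) K (rad i) f"
  using assms by (intro wnorm_step_mono) (auto simp: exhausting_def mono_def)

lemma EK_iff_exhausting:
  fixes f :: "'a::euclidean_space \<Rightarrow> 'b::euclidean_space"
  assumes ex: "exhausting \<Lambda> lam rad"
  shows "f \<in> EK \<Lambda> M K \<longleftrightarrow> smooth f \<and> (\<exists>n. wfin (M (lam n)) K (rad n) f)"
proof
  assume "f \<in> EK \<Lambda> M K"
  then obtain l m where lm: "smooth f" "l \<in> \<Lambda>" "0 < m" "wfin (M l) K (real m) f" by (auto simp: EK_def)
  obtain n where "l \<le> lam n" "m \<le> rad n" using exhaustingD(5)[OF ex lm(2)] by auto
  moreover have "lam n \<in> \<Lambda>" using ex by (simp add: exhausting_def)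
  ultimately show "smooth f \<and> (\<exists>n. wfin (M (lam n)) K (rad n) f)"
    using wnorm_step_mono[OF lm(4,2), of "lam n" "rad n"] lm by auto
next
  assume "smooth f \<and> (\<exists>n. wfin (M (lam n)) K (rad n) f)"
  then show "f \<in> EK \<Lambda> M K" using ex by (auto simp: EK_def exhausting_def)
qed

lemma EK_zero: "(\<lambda>x. 0) \<in> EK \<Lambda> M K"
proof -
  obtain l where "l \<in> \<Lambda>" using weight_matrixD(1)[OF wm] by blast
  then have "wfin (M l) K (real 1) (\<lambda>x. 0)" by (intro wnorm_zero(1)) (auto intro: weight_matrixD[OF wm])
  then show ?thesis using \<open>l \<in> \<Lambda>\<close> unfolding EK_def by (auto intro!: smooth_zero bexI[of _ l] exI[of _ 1])
qed

lemma EK_scaleR: 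
  assumes "f \<in> EK \<Lambda> M K"
  shows "(\<lambda>x. c *\<^sub>R f x) \<in> EK \<Lambda> M K"
proof -
  obtain l m where lm: "smooth f" "l \<in> \<Lambda>" "0 < m" "wfin (M l) K (real m) f" using assms by (auto simp: EK_def)
  have "wfin (M l) K (real m) (\<lambda>x. c *\<^sub>R f x)"
    using wnorm_scaleR_le[OF lm(4,1)] lm weight_matrixD[OF wm] by simp
  then show ?thesis using lm by (auto simp: EK_def intro!: smooth_scaleR)
qed

text \<open>The two functions may live on different spaces, as do an inner function on
  \<open>K\<close> and an outer function on a ball.\<close>

lemma EK_common_step:
  assumes "f \<in> EK \<Lambda> M K" "g \<in> EK \<Lambda> M K'"
  obtains l m where "l \<in> \<Lambda>" "0 < m" "wfin (M l) K (real m) f" "wfin (M l) K' (real m) g"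
proof -
  obtain l m where lm: "l \<in> \<Lambda>" "0 < m" "wfin (M l) K (real m) f" using assms(1) by (auto simp: EK_def)
  obtain l' m' where lm': "l' \<in> \<Lambda>" "0 < m'" "wfin (M l') K' (real m') g" using assms(2) by (auto simp: EK_def)
  show ?thesis
    by (rule that[of "max l l'" "max m m'"])
      (use lm lm' wnorm_step_mono[OF lm(3,1), of "max l l'" "max m m'"]
         wnorm_step_mono[OF lm'(3,1), of "max l l'" "max m m'"] in \<open>auto simp: max_def\<close>)
qed

lemma EK_add:
  assumes f: "f \<in> EK \<Lambda> M K" and g: "g \<in> EK \<Lambda> M K"
  shows "(\<lambda>x. f x + g x) \<in> EK \<Lambda> M K"
proof -
  obtain l m where lm: "l \<in> \<Lambda>" "0 < m" "wfin (M l) K (real m) f" "wfin (M l) K (real m) g"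
    using EK_common_step[OF f g] .
  have "wfin (M l) K (real m) (\<lambda>x. f x + g x)"
    using wnorm_add[OF lm(3,4) EK_smooth[OF f] EK_smooth[OF g]] lm weight_matrixD[OF wm] by simp
  then show ?thesis using lm smooth_add[OF EK_smooth[OF f] EK_smooth[OF g]] by (auto simp: EK_def)
qed

lemma EK_diff:
  assumes "f \<in> EK \<Lambda> M K" "g \<in> EK \<Lambda> M K"
  shows "(\<lambda>x. f x - g x) \<in> EK \<Lambda> M K"
  using EK_add[OF assms(1) EK_scaleR[OF assms(2), of "-1"]] by simp

lemma ER_diff:
  assumes "f \<in> ER \<Lambda> M" "g \<in> ER \<Lambda> M"
  shows "(\<lambda>x. f x - g x) \<in> ER \<Lambda> M"
  using assms unfolding ER_iff_EK by (auto intro: smooth_diff EK_diff)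

lemma adm_seminorm_zero:
  assumes "adm_seminorm \<Lambda> M K p"
  shows "p (\<lambda>x. 0) = 0"
  using adm_seminorm_scaleR[OF assms EK_zero, of 0] by simp

text \<open>The infimum below is the gauge of the absolutely convex hull of the balls of radius \<open>\<delta> i\<close> in the
  steps.\<close>

lemma ex_adm_seminorm_decomposing:
  fixes K :: "'a::euclidean_space set" and \<delta> :: "nat \<Rightarrow> real"
  assumes ex: "exhausting \<Lambda> lam rad" and \<delta>: "\<And>i. 0 < \<delta> i"
  obtains q :: "('a \<Rightarrow> 'b::euclidean_space) \<Rightarrow> real" where "adm_seminorm \<Lambda> M K q"
    "\<And>h. h \<in> EK \<Lambda> M K \<Longrightarrow> q h < 1 \<Longrightarrow> \<exists>n u. h = (\<lambda>x. \<Sum>i<n. u i x) \<and>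
       (\<forall>i. smooth (u i) \<and> wfin (M (lam i)) K (rad i) (u i) \<and> wnorm (M (lam i)) K (rad i) (u i) < \<delta> i)"
proof -
  let ?fin = "\<lambda>i u::'a \<Rightarrow> 'b. smooth u \<and> wfin (M (lam i)) K (rad i) u"
  let ?nrm = "\<lambda>i u::'a \<Rightarrow> 'b. wnorm (M (lam i)) K (rad i) u"
  \<comment> \<open>Padding with zero functions from \<open>n\<close> on lets two representations be
    brought to a common length without changing their costs.\<close>
  define rep where "rep h n u \<longleftrightarrow> h = (\<lambda>x. \<Sum>i<n. u i x) \<and> (\<forall>i. ?fin i (u i)) \<and> (\<forall>i\<ge>n. u i = (\<lambda>x. 0))" for h n u
  define cost where "cost n u = (\<Sum>i<n. ?nrm i (u i) / \<delta> i)" for n :: nat and u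
  define S where "S h = {c. \<exists>n u. rep h n u \<and> c = cost n u}" for h
  define q where "q h = Inf (S h)" for h
  have pos: "\<And>i k. 0 < M (lam i) k" "\<And>i. 0 < real (rad i)"
    using ex weight_matrixD[OF wm] by (auto simp: exhausting_def)
  have zero: "?fin i (\<lambda>x. 0)" "?nrm i (\<lambda>x. 0) = 0" for i
    by (intro conjI wnorm_zero smooth_zero pos)+
  have S0: "0 \<le> c" if "c \<in> S h" for c h
    using that \<delta> unfolding S_def rep_def cost_def
    by (auto intro!: sum_nonneg divide_nonneg_pos wnorm_nonneg)
  then have bdd: "bdd_below (S h)" for h by (intro bdd_belowI[of _ 0]) auto
  have qle: "q h \<le> cost n u" if "rep h n u" for h n u
    unfolding q_def by (rule cInf_lower[OF _ bdd]) (use that in \<open>auto simp: S_def\<close>)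
  have single: "rep h (Suc n) (\<lambda>i. if i = n then h else (\<lambda>x. 0)) \<and> cost (Suc n) (\<lambda>i. if i = n then h else (\<lambda>x. 0)) = ?nrm n h / \<delta> n"
    if "?fin n h" for n h
  proof -
    have "(\<Sum>i<Suc n. (if i = n then h else (\<lambda>x. 0)) x) = h x" for x by simp
    moreover have "(\<Sum>i<Suc n. ?nrm i (if i = n then h else (\<lambda>x. 0)) / \<delta> i) = ?nrm n h / \<delta> n"
      using zero by simp
    ultimately show ?thesis using that zero by (auto simp: rep_def cost_def fun_eq_iff)
  qed
  have ne: "S h \<noteq> {}" if h: "h \<in> EK \<Lambda> M K" for h
  proof -
    obtain n where "?fin n h" using h EK_iff_exhausting[OF ex] by blast
    from single[OF this] show ?thesis unfolding S_def by blast
  qed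
  have ge: "a \<le> q h" if "h \<in> EK \<Lambda> M K" "\<And>n u. rep h n u \<Longrightarrow> a \<le> cost n u" for h a
    unfolding q_def by (rule cInf_greatest[OF ne[OF that(1)]]) (use that(2) in \<open>auto simp: S_def\<close>)
  have ext: "rep h N u \<and> cost N u = cost n u" if "rep h n u" "n \<le> N" for h n N u
  proof -
    have "(\<Sum>i<n. u i x) = (\<Sum>i<N. u i x)" for x
      using that by (intro sum.mono_neutral_left) (auto simp: rep_def)
    moreover have "(\<Sum>i<n. ?nrm i (u i) / \<delta> i) = (\<Sum>i<N. ?nrm i (u i) / \<delta> i)"
      using that zero by (intro sum.mono_neutral_left) (auto simp: rep_def)
    ultimately show ?thesis using that by (auto simp: rep_def cost_def)
  qed
  have add: "q (\<lambda>x. f x + g x) \<le> q f + q g" if fE: "f \<in> EK \<Lambda> M K" and gE: "g \<in> EK \<Lambda> M K" for f g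
  proof -
    have "q (\<lambda>x. f x + g x) \<le> cost n u + cost m v" if "rep f n u" "rep g m v" for n u m v
    proof -
      let ?N = "max n m"
      have u: "rep f ?N u" "cost ?N u = cost n u" and v: "rep g ?N v" "cost ?N v = cost m v"
        using ext[OF that(1), of ?N] ext[OF that(2), of ?N] by auto
      have sum: "?fin i (\<lambda>x. u i x + v i x) \<and> ?nrm i (\<lambda>x. u i x + v i x) \<le> ?nrm i (u i) + ?nrm i (v i)" for i
        using u(1) v(1) smooth_add[of "u i" "v i"] wnorm_add[of "M (lam i)" K "rad i" "u i" "v i", OF _ _ _ _ pos(2,1)] unfolding rep_def by simp
      then have "rep (\<lambda>x. f x + g x) ?N (\<lambda>i x. u i x + v i x)"
        using u(1) v(1) by (auto simp: rep_def sum.distrib)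
      then have "q (\<lambda>x. f x + g x) \<le> cost ?N (\<lambda>i x. u i x + v i x)" by (rule qle)
      also have "\<dots> \<le> cost ?N u + cost ?N v"
        unfolding cost_def sum.distrib[symmetric] add_divide_distrib[symmetric]
        using sum \<delta> by (intro sum_mono divide_right_mono) (auto intro: less_imp_le)
      finally show ?thesis using u v by simp
    qed
    \<comment> \<open>The infimum over representations of \<open>f\<close> is taken for a fixed
      representation of \<open>g\<close>, and the one over representations of \<open>g\<close>
      afterwards.\<close>
    then have "q (\<lambda>x. f x + g x) - cost m v \<le> q f" if "rep g m v" for m v
      using that by (intro ge[OF fE]) (simp add: algebra_simps)
    then have "q (\<lambda>x. f x + g x) - q f \<le> q g" by (intro ge[OF gE]) (simp add: algebra_simps)
    then show ?thesis by simp
  qed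
  have q0: "0 \<le> q f" if "f \<in> EK \<Lambda> M K" for f
    by (rule ge[OF that]) (use S0 in \<open>auto simp: S_def\<close>)
  have scale_le: "q (\<lambda>x. c *\<^sub>R f x) \<le> \<bar>c\<bar> * q f" if fE: "f \<in> EK \<Lambda> M K" and c: "c \<noteq> 0" for c f
  proof -
    have "q (\<lambda>x. c *\<^sub>R f x) / \<bar>c\<bar> \<le> q f"
    proof (rule ge[OF fE])
      fix n u assume u: "rep f n u"
      have "rep (\<lambda>x. c *\<^sub>R f x) n (\<lambda>i x. c *\<^sub>R u i x)"
        using u unfolding rep_def
        by (auto simp: scaleR_sum_right intro!: smooth_scaleR conjunct1[OF wnorm_scaleR_le] pos)
      then have "q (\<lambda>x. c *\<^sub>R f x) \<le> cost n (\<lambda>i x. c *\<^sub>R u i x)" by (rule qle)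
      also have "\<dots> = \<bar>c\<bar> * cost n u"
        using u pos by (simp add: cost_def rep_def sum_distrib_left wnorm_scaleR)
      finally show "q (\<lambda>x. c *\<^sub>R f x) / \<bar>c\<bar> \<le> cost n u" using c by (simp add: field_simps)
    qed
    then show ?thesis using c by (simp add: field_simps)
  qed
  have scale: "q (\<lambda>x. c *\<^sub>R f x) = \<bar>c\<bar> * q f" if fE: "f \<in> EK \<Lambda> M K" for c f
  proof (cases "c = 0")
    case True
    have "q (\<lambda>x. 0) \<le> 0" using qle[OF conjunct1[OF single[OF zero(1)]], of 0] conjunct2[OF single[OF zero(1)], of 0] zero by simp
    then show ?thesis using True q0[OF EK_zero] by simp
  next
    case False
    have "q f \<le> \<bar>inverse c\<bar> * q (\<lambda>x. c *\<^sub>R f x)"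
      using scale_le[OF EK_scaleR[OF fE], of "inverse c" c] False by simp
    then have "\<bar>c\<bar> * q f \<le> q (\<lambda>x. c *\<^sub>R f x)" using False by (simp add: abs_inverse field_simps)
    then show ?thesis using scale_le[OF fE False] by simp
  qed
  have step: "\<exists>C. \<forall>f. smooth f \<and> wfin (M l) K (real m) f \<longrightarrow> q f \<le> C * wnorm (M l) K (real m) f"
    if l: "l \<in> \<Lambda>" and m: "0 < m" for l m
  proof -
    obtain n where n: "l \<le> lam n" "m \<le> rad n" using exhaustingD(5)[OF ex l] by auto
    have lam: "lam n \<in> \<Lambda>" using ex by (simp add: exhausting_def)
    show ?thesis
    proof (intro exI[of _ "1 / \<delta> n"] allI impI)
      fix f :: "'a \<Rightarrow> 'b" assume f: "smooth f \<and> wfin (M l) K (real m) f"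
      then have f': "wfin (M (lam n)) K (rad n) f" "?nrm n f \<le> wnorm (M l) K (real m) f"
        using wnorm_step_mono[of l K m f "lam n" "rad n"] l lam n m by auto
      then have "q f \<le> ?nrm n f / \<delta> n"
        using qle[OF conjunct1[OF single[of f n]]] conjunct2[OF single[of f n]] f by simp
      also have "\<dots> \<le> wnorm (M l) K (real m) f / \<delta> n"
        using f' \<delta> by (intro divide_right_mono) (auto intro: less_imp_le)
      finally show "q f \<le> 1 / \<delta> n * wnorm (M l) K (real m) f" by simp
    qed
  qed
  show ?thesis
  proof (rule that)
    show "adm_seminorm \<Lambda> M K q"
      unfolding adm_seminorm_def seminorm_on_def by (intro conjI ballI allI impI q0 scale add step)
    fix h assume h: "h \<in> EK \<Lambda> M K" "q h < 1"
    then obtain c where "c \<in> S h" "c < 1" using cInf_lessD[OF ne[OF h(1)]] unfolding q_def by blast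
    then obtain n u where u: "rep h n u" "cost n u < 1" by (auto simp: S_def)
    \<comment> \<open>The cost is a sum of nonnegative terms, so a total below \<open>1\<close>
      forces each of them below \<open>1\<close>; from \<open>n\<close> on the functions
      vanish.\<close>
    have "?nrm i (u i) < \<delta> i" for i
    proof (cases "i < n")
      case True
      have "?nrm i (u i) / \<delta> i \<le> cost n u" unfolding cost_def
        using True u(1) \<delta> by (intro member_le_sum divide_nonneg_pos wnorm_nonneg) (auto simp: rep_def)
      then have "?nrm i (u i) / \<delta> i < 1" using u(2) by simp
      then show ?thesis using \<delta>[of i] by simp
    next
      case False
      then show ?thesis using u(1) zero \<delta> by (simp add: rep_def)
    qed
    then show "\<exists>n u. h = (\<lambda>x. \<Sum>i<n. u i x) \<and> (\<forall>i. smooth (u i) \<and> wfin (M (lam i)) K (rad i) (u i) \<and> ?nrm i (u i) < \<delta> i)"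
      using u(1) by (auto simp: rep_def)
  qed
qed

end

section \<open>Continuity in the Roumieu case\<close>

context
  fixes \<Lambda> :: "real set" and M :: "real \<Rightarrow> nat \<Rightarrow> real"
  assumes wm: "weight_matrix \<Lambda> M" and FdB: "FdB_Roumieu \<Lambda> M"
begin

lemma FdB_RoumieuE:
  assumes "l \<in> \<Lambda>"
  obtains m C r where "m \<in> \<Lambda>" "0 < C" "0 < r" "\<And>k. circ_seq (M l) k \<le> C * r ^ k * M m k"
proof -
  obtain m where m: "m \<in> \<Lambda>" "seq_preceq (circ_seq (M l)) (M m)"
    using FdB assms unfolding FdB_Roumieu_def by auto
  then obtain C r where "0 < C" "0 < r" "\<forall>k. circ_seq (M l) k \<le> C * r ^ k * M m k"
    unfolding seq_preceq_def by auto
  with m show ?thesis by (intro that[of m C r]) auto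
qed

text \<open>A first step for \<open>g\<close> on \<open>K\<close> serves to find a ball
  \<open>L\<close> containing the image of \<open>K\<close>. Then \<open>f\<close> lies in a step on
  \<open>L\<close>, and a step common to both functions carries the estimate.\<close>

lemma ER_comp:
  fixes g :: "'p::euclidean_space \<Rightarrow> 'q::euclidean_space" and f :: "'q \<Rightarrow> 'r::euclidean_space"
  assumes f: "f \<in> ER \<Lambda> M" and g: "g \<in> ER \<Lambda> M"
  shows "f \<circ> g \<in> ER \<Lambda> M"
proof -
  have fg: "smooth f" "smooth g" using f g by (auto simp: ER_def)
  have "f \<circ> g \<in> EK \<Lambda> M K" if K: "compact K" for K
  proof -
    have gK: "g \<in> EK \<Lambda> M K" using ER_subset_EK[OF K] g by blast
    then obtain l\<^sub>0 m\<^sub>0 where lm\<^sub>0: "l\<^sub>0 \<in> \<Lambda>" "0 < m\<^sub>0" "wfin (M l\<^sub>0) K (real m\<^sub>0) g" by (auto simp: EK_def)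
    define L where "L = cball (0::'q) (wnorm (M l\<^sub>0) K (real m\<^sub>0) g)"
    have gL: "g ` K \<subseteq> L" unfolding L_def
      using lm\<^sub>0 weight_matrixD[OF wm] by (intro wnorm_image_subset_cball[OF lm\<^sub>0(3) order_refl]) auto
    have "f \<in> EK \<Lambda> M L" using ER_subset_EK[of L] f by (auto simp: L_def)
    then obtain l m where lm: "l \<in> \<Lambda>" "0 < m" "wfin (M l) K (real m) g" "wfin (M l) L (real m) f"
      using EK_common_step[OF wm gK] by blast
    obtain l' C r where l': "l' \<in> \<Lambda>" and C: "0 < C" "0 < r" "\<And>k. circ_seq (M l) k \<le> C * r ^ k * M l' k"
      using FdB_RoumieuE[OF lm(1)] by blast
    let ?A = "wnorm (M l) K (real m) g"
    \<comment> \<open>Radii in the inductive limit are integers, so the rate is rounded up.\<close>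
    obtain n :: nat where n: "real m * r * (2 + ?A * real m) < real n" using reals_Archimedean2 by blast
    have "0 < real m * r * (2 + ?A * real m)"
      using lm C wnorm_nonneg[OF lm(3)] by (intro mult_pos_pos add_pos_nonneg) auto
    then have n0: "0 < n" using n by (cases n) auto
    have "wfin (M l') K (real n) (f \<circ> g) \<and> wnorm (M l') K (real n) (f \<circ> g) \<le> C * wnorm (M l) L (real m) f"
      using n lm l' C gL fg weight_matrixD[OF wm]
      by (intro wnorm_comp_le[where A = ?A and s = "real m" and r = r]) auto
    then show ?thesis using l' n0 smooth_comp[OF fg] by (auto simp: EK_def)
  qed
  then show ?thesis using smooth_comp[OF fg] by (simp add: ER_iff_EK)
qed

text \<open>The target step is fixed by \<open>l\<close>, \<open>s\<close>, \<open>t\<close> and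
  \<open>A\<close>, and the seminorm is compared with its norm once; hence one constant serves all
  \<open>f\<close> and \<open>g\<close> of these classes.\<close>

lemma adm_seminorm_comp_le:
  fixes K :: "'p::euclidean_space set" and L :: "'q::euclidean_space set" and p :: "('p \<Rightarrow> 'r::euclidean_space) \<Rightarrow> real"
  assumes p: "adm_seminorm \<Lambda> M K p" and l: "l \<in> \<Lambda>" and st: "0 < s" "0 < t" and A: "0 \<le> A"
  obtains C where "0 < C" "\<And>(f :: 'q \<Rightarrow> 'r) (g :: 'p \<Rightarrow> 'q). \<lbrakk>smooth f; smooth g; wfin (M l) L t f; wfin (M l) K s g;
      wnorm (M l) K s g \<le> A; g ` K \<subseteq> L\<rbrakk> \<Longrightarrow> f \<circ> g \<in> EK \<Lambda> M K \<and> p (f \<circ> g) \<le> C * wnorm (M l) L t f"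
proof -
  obtain l' C r where l': "l' \<in> \<Lambda>" and C: "0 < C" "0 < r" "\<And>k. circ_seq (M l) k \<le> C * r ^ k * M l' k"
    using FdB_RoumieuE[OF l] by blast
  obtain n :: nat where n: "s * r * (2 + A * t) < real n" using reals_Archimedean2 by blast
  have "0 < s * r * (2 + A * t)" using st C A by (intro mult_pos_pos add_pos_nonneg) auto
  then have n0: "0 < n" using n by (cases n) auto
  obtain D where D: "0 < D" "\<And>f. smooth f \<Longrightarrow> wfin (M l') K (real n) f \<Longrightarrow> p f \<le> D * wnorm (M l') K (real n) f"
    using adm_seminorm_step[OF p l' n0] by blast
  show ?thesis
  proof (rule that[of "D * C"])
    fix f :: "'q \<Rightarrow> 'r" and g :: "'p \<Rightarrow> 'q"
    assume fg: "smooth f" "smooth g" "wfin (M l) L t f" "wfin (M l) K s g" "wnorm (M l) K s g \<le> A" "g ` K \<subseteq> L"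
    have *: "wfin (M l') K (real n) (f \<circ> g) \<and> wnorm (M l') K (real n) (f \<circ> g) \<le> C * wnorm (M l) L t f"
      using n l l' C fg st weight_matrixD[OF wm]
      by (intro wnorm_comp_le[where A = A and s = s and r = r]) auto
    then have "p (f \<circ> g) \<le> D * wnorm (M l') K (real n) (f \<circ> g)"
      using D(2) smooth_comp[OF fg(1,2)] by blast
    also have "\<dots> \<le> D * (C * wnorm (M l) L t f)" using D(1) * by (intro mult_left_mono) auto
    finally show "f \<circ> g \<in> EK \<Lambda> M K \<and> p (f \<circ> g) \<le> D * C * wnorm (M l) L t f"
      using * l' n0 smooth_comp[OF fg(1,2)] by (auto simp: EK_def)
  qed (use D C in simp)
qed

text \<open>This is \<open>wnorm_comp_uniformly_continuous\<close> with tolerance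
  \<open>\<epsilon> / D\<close>, where \<open>D\<close> compares \<open>p\<close> with the norm of a
  large enough target step.\<close>

lemma adm_seminorm_comp_uniformly_continuous:
  fixes K :: "'p::euclidean_space set" and f :: "'q::euclidean_space \<Rightarrow> 'r::euclidean_space"
  assumes p: "adm_seminorm \<Lambda> M K p" and l: "l \<in> \<Lambda>" and st: "0 < s" "0 < t" and A: "0 \<le> A"
    and f: "smooth f" "wfin (M l) L t f" and L: "convex L" and \<epsilon>: "0 < \<epsilon>"
  obtains \<delta> where "0 < \<delta>" "\<And>g h :: 'p \<Rightarrow> 'q. \<lbrakk>smooth g; smooth h; g ` K \<subseteq> L; h ` K \<subseteq> L;
      wfin (M l) K s g; wfin (M l) K s h; wnorm (M l) K s g \<le> A; wnorm (M l) K s h \<le> A;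
      wnorm (M l) K s (\<lambda>x. g x - h x) \<le> \<delta>\<rbrakk>
      \<Longrightarrow> (\<lambda>x. (f \<circ> g) x - (f \<circ> h) x) \<in> EK \<Lambda> M K \<and> p (\<lambda>x. (f \<circ> g) x - (f \<circ> h) x) \<le> \<epsilon>"
proof -
  obtain l' C r where l': "l' \<in> \<Lambda>" and C: "0 < C" "0 < r" "\<And>k. circ_seq (M l) k \<le> C * r ^ k * M l' k"
    using FdB_RoumieuE[OF l] by blast
  obtain n :: nat where n: "2 * (s * r * (2 + A * t)) < real n" using reals_Archimedean2 by blast
  have "0 < s * r * (2 + A * t)" using st C A by (intro mult_pos_pos add_pos_nonneg) auto
  then have n0: "0 < n" using n by (cases n) auto
  obtain D where D: "0 < D" "\<And>f. smooth f \<Longrightarrow> wfin (M l') K (real n) f \<Longrightarrow> p f \<le> D * wnorm (M l') K (real n) f"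
    using adm_seminorm_step[OF p l' n0] by blast
  have N: "\<And>k. 0 < M l k" "M l 0 = 1" and N': "\<And>k. 0 < M l' k" using weight_matrixD[OF wm] l l' by auto
  obtain \<delta> where \<delta>: "0 < \<delta>" "\<And>g h :: 'p \<Rightarrow> 'q. \<lbrakk>smooth g; smooth h; g ` K \<subseteq> L; h ` K \<subseteq> L;
      wfin (M l) K s g; wfin (M l) K s h; wnorm (M l) K s g \<le> A; wnorm (M l) K s h \<le> A;
      wnorm (M l) K s (\<lambda>x. g x - h x) \<le> \<delta>\<rbrakk>
      \<Longrightarrow> wfin (M l') K (real n) (\<lambda>x. (f \<circ> g) x - (f \<circ> h) x) \<and>
        wnorm (M l') K (real n) (\<lambda>x. (f \<circ> g) x - (f \<circ> h) x) \<le> \<epsilon> / D"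
    by (rule wnorm_comp_uniformly_continuous[where f = f and N = "M l" and L = L and N' = "M l'" and K = K
          and s = s and t = t and A = A and \<rho> = "real n" and \<epsilon> = "\<epsilon> / D",
          OF f L N N' st C(3,1,2) A less_imp_le[OF n]])
      (use \<epsilon> D in auto)
  show ?thesis
  proof (rule that[OF \<delta>(1)])
    fix g h :: "'p \<Rightarrow> 'q"
    assume gh: "smooth g" "smooth h" "g ` K \<subseteq> L" "h ` K \<subseteq> L" "wfin (M l) K s g" "wfin (M l) K s h"
      "wnorm (M l) K s g \<le> A" "wnorm (M l) K s h \<le> A" "wnorm (M l) K s (\<lambda>x. g x - h x) \<le> \<delta>"
    let ?u = "\<lambda>x. (f \<circ> g) x - (f \<circ> h) x"
    have u: "wfin (M l') K (real n) ?u" "wnorm (M l') K (real n) ?u \<le> \<epsilon> / D" "smooth ?u"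
      using \<delta>(2)[OF gh] smooth_diff[OF smooth_comp[OF f(1) gh(1)] smooth_comp[OF f(1) gh(2)]] by auto
    have "p ?u \<le> D * wnorm (M l') K (real n) ?u" by (rule D(2)[OF u(3,1)])
    also have "\<dots> \<le> D * (\<epsilon> / D)" using D(1) u by (intro mult_left_mono) auto
    finally show "?u \<in> EK \<Lambda> M K \<and> p ?u \<le> \<epsilon>" using D(1) u l' n0 by (auto simp: EK_def)
  qed
qed

text \<open>One neighbourhood has to serve perturbations with arbitrarily many pieces, each in a
  different step. When piece \<open>j\<close> is added, the partial sum lies in step
  \<open>j\<close> as well, so uniform continuity is used in that step with tolerance
  \<open>\<epsilon> / 2 * (1/2) ^ Suc j\<close>. Both the tolerances and the sizes of the pieces are
  summable.\<close>

lemma ER_comp_continuous_at: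
  fixes g\<^sub>0 :: "'p::euclidean_space \<Rightarrow> 'q::euclidean_space" and f :: "'q \<Rightarrow> 'r::euclidean_space"
  assumes f: "f \<in> ER \<Lambda> M" and g\<^sub>0: "g\<^sub>0 \<in> ER \<Lambda> M"
    and K: "compact K" and p: "adm_seminorm \<Lambda> M K p" and \<epsilon>: "0 < \<epsilon>"
  obtains q where "adm_seminorm \<Lambda> M K q"
    "\<And>g. g \<in> ER \<Lambda> M \<Longrightarrow> q (\<lambda>x. g x - g\<^sub>0 x) < 1 \<Longrightarrow> p (\<lambda>x. (f \<circ> g) x - (f \<circ> g\<^sub>0) x) < \<epsilon>"
proof -
  obtain lam\<^sub>0 rad\<^sub>0 where ex\<^sub>0: "exhausting \<Lambda> lam\<^sub>0 rad\<^sub>0" using ex_exhausting[OF weight_matrixD(1)[OF wm]] by blast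
  have "g\<^sub>0 \<in> EK \<Lambda> M K" using ER_subset_EK[OF K] g\<^sub>0 by blast
  then obtain n\<^sub>0 where n\<^sub>0: "smooth g\<^sub>0" "wfin (M (lam\<^sub>0 n\<^sub>0)) K (rad\<^sub>0 n\<^sub>0) g\<^sub>0"
    using EK_iff_exhausting[OF wm ex\<^sub>0] by blast
  \<comment> \<open>The extra \<open>1\<close> is the room for all pieces together, whose norms will
    sum to at most \<open>1\<close>.\<close>
  define A where "A = 1 + wnorm (M (lam\<^sub>0 n\<^sub>0)) K (rad\<^sub>0 n\<^sub>0) g\<^sub>0"
  have A: "1 \<le> A" using wnorm_nonneg[OF n\<^sub>0(2)] by (simp add: A_def)
  define L where "L = cball (0::'q) A"
  have L: "compact L" "convex L" by (auto simp: L_def)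
  have "f \<in> EK \<Lambda> M L" using ER_subset_EK[OF L(1)] f by blast
  then obtain n\<^sub>1 where n\<^sub>1: "smooth f" "wfin (M (lam\<^sub>0 n\<^sub>1)) L (rad\<^sub>0 n\<^sub>1) f"
    using EK_iff_exhausting[OF wm ex\<^sub>0] by blast
  \<comment> \<open>Dropping initial steps makes \<open>g\<^sub>0\<close> and \<open>f\<close>
    available in every remaining step, \<open>g\<^sub>0\<close> with the bound \<open>A - 1\<close>
    and \<open>f\<close> with the fixed radius \<open>t\<close>.\<close>
  define lam where "lam n = lam\<^sub>0 (n + max n\<^sub>0 n\<^sub>1)" for n
  define rad where "rad n = rad\<^sub>0 (n + max n\<^sub>0 n\<^sub>1)" for n
  define t where "t = real (rad\<^sub>0 n\<^sub>1)"
  have ex: "exhausting \<Lambda> lam rad" unfolding lam_def rad_def by (rule exhausting_shift[OF ex\<^sub>0])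
  have l: "lam i \<in> \<Lambda>" and r: "0 < real (rad i)" for i using exhaustingD(1,2)[OF ex, of i] by auto
  have t: "0 < t" using exhaustingD(2)[OF ex\<^sub>0, of n\<^sub>1] by (simp add: t_def)
  have N: "\<And>k. 0 < M (lam i) k" "M (lam i) 0 = 1" for i using weight_matrixD[OF wm] l by auto
  have gA: "wfin (M (lam i)) K (rad i) g\<^sub>0 \<and> wnorm (M (lam i)) K (rad i) g\<^sub>0 \<le> A - 1" for i
    using exhausting_mono[OF wm ex\<^sub>0 _ n\<^sub>0(2), of "i + max n\<^sub>0 n\<^sub>1"] by (simp add: lam_def rad_def A_def)
  have fL: "wfin (M (lam i)) L t f" for i
  proof -
    have "lam\<^sub>0 n\<^sub>1 \<le> lam i" unfolding lam_def using exhaustingD(3)[OF ex\<^sub>0] by (rule monoD) simp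
    then show ?thesis
      using wnorm_step_mono[OF wm n\<^sub>1(2) exhaustingD(1)[OF ex\<^sub>0] l _ _ order_refl] t by (simp add: t_def)
  qed
  \<comment> \<open>\<open>L\<close>, \<open>A\<close> and \<open>t\<close> do not change with
    \<open>i\<close>; the admissible distance \<open>d\<close> and the tolerance do.\<close>
  define P where "P i d \<longleftrightarrow> 0 < d \<and> (\<forall>g h :: 'p \<Rightarrow> 'q. smooth g \<longrightarrow> smooth h \<longrightarrow> g ` K \<subseteq> L \<longrightarrow> h ` K \<subseteq> L \<longrightarrow>
      wfin (M (lam i)) K (rad i) g \<longrightarrow> wfin (M (lam i)) K (rad i) h \<longrightarrow>
      wnorm (M (lam i)) K (rad i) g \<le> A \<longrightarrow> wnorm (M (lam i)) K (rad i) h \<le> A \<longrightarrow>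
      wnorm (M (lam i)) K (rad i) (\<lambda>x. g x - h x) \<le> d \<longrightarrow>
      (\<lambda>x. (f \<circ> g) x - (f \<circ> h) x) \<in> EK \<Lambda> M K \<and> p (\<lambda>x. (f \<circ> g) x - (f \<circ> h) x) \<le> \<epsilon> / 2 * (1/2) ^ Suc i)" for i d
  have "\<exists>d. P i d" for i
  proof -
    have \<epsilon>': "0 < \<epsilon> / 2 * (1/2) ^ Suc i" and A0: "0 \<le> A" using \<epsilon> A by auto
    show ?thesis
      by (rule adm_seminorm_comp_uniformly_continuous[OF p l r t A0 n\<^sub>1(1) fL L(2) \<epsilon>', of i])
        (rule exI, unfold P_def, intro conjI allI impI, assumption, blast+)
  qed
  then obtain d where d: "\<And>i. P i (d i)" by metis
  define \<delta> where "\<delta> i = min (d i) ((1/2) ^ Suc i)" for i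
  have "0 < \<delta> i" for i using d[of i] by (simp add: \<delta>_def P_def)
  then obtain q :: "('p \<Rightarrow> 'q) \<Rightarrow> real" where q: "adm_seminorm \<Lambda> M K q"
    "\<And>h. h \<in> EK \<Lambda> M K \<Longrightarrow> q h < 1 \<Longrightarrow> \<exists>n u. h = (\<lambda>x. \<Sum>i<n. u i x) \<and>
       (\<forall>i. smooth (u i) \<and> wfin (M (lam i)) K (rad i) (u i) \<and> wnorm (M (lam i)) K (rad i) (u i) < \<delta> i)"
    using ex_adm_seminorm_decomposing[OF wm ex] by blast
  show ?thesis
  proof (rule that[OF q(1)])
    fix g :: "'p \<Rightarrow> 'q" assume g: "g \<in> ER \<Lambda> M" and lt: "q (\<lambda>x. g x - g\<^sub>0 x) < 1"
    have "(\<lambda>x. g x - g\<^sub>0 x) \<in> EK \<Lambda> M K" using ER_diff[OF wm g g\<^sub>0] ER_subset_EK[OF K] by blast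
    from q(2)[OF this lt] obtain n u where gu: "(\<lambda>x. g x - g\<^sub>0 x) = (\<lambda>x. \<Sum>i<n. u i x)"
      and u: "\<And>i. smooth (u i)" "\<And>i. wfin (M (lam i)) K (rad i) (u i)" "\<And>i. wnorm (M (lam i)) K (rad i) (u i) < \<delta> i"
      by auto
    define G where "G j x = g\<^sub>0 x + (\<Sum>i<j. u i x)" for j x
    have GS: "G (Suc j) = (\<lambda>x. G j x + u j x)" for j by (simp add: G_def fun_eq_iff add.assoc)
    have G0: "G 0 = g\<^sub>0" by (simp add: G_def fun_eq_iff)
    have Gn: "G n = g" using fun_cong[OF gu] by (simp add: G_def fun_eq_iff diff_eq_eq add.commute)
    have sG: "smooth (G j)" for j
      by (induction j) (auto simp: G0 GS intro!: smooth_add u n\<^sub>0)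
    \<comment> \<open>Starting from \<open>A - 1\<close>, piece \<open>u j\<close> adds at most
      \<open>(1/2) ^ Suc j\<close>, which gives \<open>A - (1/2) ^ j\<close> throughout. The range
      is \<open>j \<le> Suc i\<close> because \<open>G (Suc i)\<close> involves \<open>u 0\<close>
      to \<open>u i\<close>, all of which lie in step \<open>i\<close>.\<close>
    have bound: "wfin (M (lam i)) K (rad i) (G j) \<and> wnorm (M (lam i)) K (rad i) (G j) \<le> A - (1/2) ^ j" if "j \<le> Suc i" for i j
      using that
    proof (induction j)
      case 0
      then show ?case using gA[of i] by (simp add: G0)
    next
      case (Suc j)
      then have IH: "wfin (M (lam i)) K (rad i) (G j)" "wnorm (M (lam i)) K (rad i) (G j) \<le> A - (1/2) ^ j" by auto
      have uj: "wfin (M (lam i)) K (rad i) (u j)" "wnorm (M (lam i)) K (rad i) (u j) \<le> wnorm (M (lam j)) K (rad j) (u j)"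
        using exhausting_mono[OF wm ex _ u(2), of j i] Suc.prems by auto
      have "wnorm (M (lam j)) K (rad j) (u j) \<le> (1/2) ^ Suc j" using u(3)[of j] by (simp add: \<delta>_def)
      then show ?case
        using wnorm_add[OF IH(1) uj(1) sG u(1) r N(1)] IH(2) uj(2) unfolding GS by auto
    qed
    have GA: "wfin (M (lam i)) K (rad i) (G j)" "wnorm (M (lam i)) K (rad i) (G j) \<le> A" "G j ` K \<subseteq> L" if "j \<le> Suc i" for i j
    proof -
      show fin: "wfin (M (lam i)) K (rad i) (G j)" and le: "wnorm (M (lam i)) K (rad i) (G j) \<le> A"
        using bound[OF that] zero_le_power[of "1/2 :: real" j] by linarith+
      show "G j ` K \<subseteq> L" unfolding L_def by (rule wnorm_image_subset_cball[OF fin le r N])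
    qed
    have step: "(\<lambda>x. (f \<circ> G (Suc j)) x - (f \<circ> G j) x) \<in> EK \<Lambda> M K \<and>
        p (\<lambda>x. (f \<circ> G (Suc j)) x - (f \<circ> G j) x) \<le> \<epsilon> / 2 * (1/2) ^ Suc j" for j
    proof -
      have "wnorm (M (lam j)) K (rad j) (\<lambda>x. G (Suc j) x - G j x) \<le> d j"
        using u(3)[of j] by (simp add: GS \<delta>_def)
      then show ?thesis using d[of j] sG GA[of "Suc j" j] GA[of j j] unfolding P_def by simp
    qed
    have "(\<lambda>x. (f \<circ> G j) x - (f \<circ> g\<^sub>0) x) \<in> EK \<Lambda> M K \<and> p (\<lambda>x. (f \<circ> G j) x - (f \<circ> g\<^sub>0) x) \<le> \<epsilon> / 2 * (1 - (1/2) ^ j)" for j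
    proof (induction j)
      case 0
      then show ?case using EK_zero[OF wm] adm_seminorm_zero[OF wm p] by (simp add: G0)
    next
      case (Suc j)
      have "p (\<lambda>x. (f \<circ> G (Suc j)) x - (f \<circ> g\<^sub>0) x) \<le> \<epsilon> / 2 * (1/2) ^ Suc j + \<epsilon> / 2 * (1 - (1/2) ^ j)"
        using adm_seminorm_triangle[OF p, of "f \<circ> G (Suc j)" "f \<circ> G j" "f \<circ> g\<^sub>0"] Suc step[of j] by linarith
      moreover have "(\<lambda>x. ((f \<circ> G (Suc j)) x - (f \<circ> G j) x) + ((f \<circ> G j) x - (f \<circ> g\<^sub>0) x)) \<in> EK \<Lambda> M K"
        using Suc step[of j] by (intro EK_add[OF wm]) auto
      ultimately show ?case by (simp add: algebra_simps)
    qed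
    from this[of n] have "p (\<lambda>x. (f \<circ> g) x - (f \<circ> g\<^sub>0) x) \<le> \<epsilon> / 2 * (1 - (1/2) ^ n)" by (simp add: Gn)
    also have "\<dots> \<le> \<epsilon> / 2 * 1" using \<epsilon> by (intro mult_left_mono) auto
    finally show "p (\<lambda>x. (f \<circ> g) x - (f \<circ> g\<^sub>0) x) < \<epsilon>" using \<epsilon> by simp
  qed
qed

theorem continuous_map_comp_Roumieu:
  fixes f :: "'q::euclidean_space \<Rightarrow> 'r::euclidean_space"
  assumes f: "f \<in> ER \<Lambda> M"
  shows "continuous_map (ER_top \<Lambda> M :: ('p::euclidean_space \<Rightarrow> 'q) topology) (ER_top \<Lambda> M :: ('p \<Rightarrow> 'r) topology) (\<lambda>g. f \<circ> g)"
    (is "continuous_map ?X _ ?c")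
proof -
  have img: "?c ` topspace ?X \<subseteq> ER \<Lambda> M" using ER_comp[OF f] by auto
  have opn: "openin ?X (?c -` {h \<in> ER \<Lambda> M. p (\<lambda>x. h x - k x) < \<epsilon>} \<inter> topspace ?X)" (is "openin _ ?V")
    if k: "k \<in> ER \<Lambda> M" and K: "compact K" and p: "adm_seminorm \<Lambda> M K p" for k :: "'p \<Rightarrow> 'r" and K p \<epsilon>
  proof (subst openin_subopen, rule ballI)
    fix g\<^sub>0 :: "'p \<Rightarrow> 'q" assume "g\<^sub>0 \<in> ?V"
    then have g\<^sub>0: "g\<^sub>0 \<in> ER \<Lambda> M" and lt: "p (\<lambda>x. (f \<circ> g\<^sub>0) x - k x) < \<epsilon>" by auto
    then have \<eta>: "0 < \<epsilon> - p (\<lambda>x. (f \<circ> g\<^sub>0) x - k x)" by simp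
    obtain q where q: "adm_seminorm \<Lambda> M K q"
      "\<And>g. g \<in> ER \<Lambda> M \<Longrightarrow> q (\<lambda>x. g x - g\<^sub>0 x) < 1 \<Longrightarrow> p (\<lambda>x. (f \<circ> g) x - (f \<circ> g\<^sub>0) x) < \<epsilon> - p (\<lambda>x. (f \<circ> g\<^sub>0) x - k x)"
      by (rule ER_comp_continuous_at[OF f g\<^sub>0 K p \<eta>]) (rule that, assumption+)
    define T where "T = {g \<in> ER \<Lambda> M. q (\<lambda>x. g x - g\<^sub>0 x) < 1}"
    have "openin ?X T"
      unfolding T_def ER_top_def
      by (rule topology_generated_by_Basis, rule insertI2, rule CollectI) (use g\<^sub>0 K q(1) zero_less_one in blast)
    moreover have "g\<^sub>0 \<in> T" using g\<^sub>0 adm_seminorm_zero[OF wm q(1)] by (simp add: T_def)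
    moreover have "T \<subseteq> ?V"
    proof
      fix g assume "g \<in> T"
      then have g: "g \<in> ER \<Lambda> M" and lt: "p (\<lambda>x. (f \<circ> g) x - (f \<circ> g\<^sub>0) x) < \<epsilon> - p (\<lambda>x. (f \<circ> g\<^sub>0) x - k x)"
        using q(2) by (auto simp: T_def)
      note c = ER_comp[OF f g] and c0 = ER_comp[OF f g\<^sub>0]
      have "p (\<lambda>x. (f \<circ> g) x - k x) < \<epsilon>"
        using adm_seminorm_triangle[OF p subsetD[OF ER_subset_EK[OF K] ER_diff[OF wm c c0]]
            subsetD[OF ER_subset_EK[OF K] ER_diff[OF wm c0 k]]] lt by linarith
      then show "g \<in> ?V" using g c by simp
    qed
    ultimately show "\<exists>T. openin ?X T \<and> g\<^sub>0 \<in> T \<and> T \<subseteq> ?V" by blast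
  qed
  have all: "openin ?X (?c -` ER \<Lambda> M \<inter> topspace ?X)"
  proof -
    have "?c -` ER \<Lambda> M \<inter> topspace ?X = topspace ?X" using img by blast
    then show ?thesis using openin_topspace[of ?X] by simp
  qed
  show ?thesis
    unfolding ER_top_def[where ?'a = 'p and ?'b = 'r]
  proof (rule continuous_on_generated_topo)
    fix U :: "('p \<Rightarrow> 'r) set"
    assume "U \<in> insert (ER \<Lambda> M) {{g \<in> ER \<Lambda> M. p (\<lambda>x. g x - f x) < \<epsilon>} | f K p \<epsilon>.
        f \<in> ER \<Lambda> M \<and> compact K \<and> adm_seminorm \<Lambda> M K p \<and> \<epsilon> > 0}"
    then show "openin ?X (?c -` U \<inter> topspace ?X)"
    proof (elim insertE CollectE exE conjE)
    qed (simp_all only: all opn)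
  qed (use img in auto)
qed

end

section \<open>Sequential continuity in the Roumieu case\<close>

text \<open>If \<open>H\<close> is not dominated by a single \<open>w n\<close>, then it is large at points \<open>\<kappa> 0 < \<kappa> 1 < \<dots>\<close> relative to
  \<open>w 0, w 1, \<dots>\<close>, and gluing the \<open>w n\<close> along these points gives a weight that dominates all \<open>w n\<close> but
  not \<open>H\<close>.\<close>

lemma dominated_by_one_weight:
  fixes w :: "nat \<Rightarrow> nat \<Rightarrow> real" and H :: "nat \<Rightarrow> real"
  assumes pos: "\<And>n k. 0 < w n k" and mono: "\<And>i j k. i \<le> j \<Longrightarrow> w i k \<le> w j k"
    and dom: "\<And>a. (\<And>k. 0 < a k) \<Longrightarrow> (\<And>n. \<exists>c. \<forall>k. w n k \<le> c * a k) \<Longrightarrow> \<exists>B. \<forall>k. H k \<le> B * a k"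
  shows "\<exists>n B. \<forall>k. H k \<le> B * w n k"
proof (rule ccontr)
  assume neg: "\<not> (\<exists>n B. \<forall>k. H k \<le> B * w n k)"
  \<comment> \<open>Finitely many indices can be absorbed into a constant, so domination fails
    beyond every \<open>J\<close>: the sum in \<open>B\<close> rules out \<open>k \<le> J\<close>,
    and the summand \<open>real i\<close> gives the required factor.\<close>
  have big: "\<exists>k>J. real i * w i k < H k" for i J
  proof -
    define B where "B = real i + (\<Sum>k\<le>J. \<bar>H k\<bar> / w i k)"
    obtain k where k: "B * w i k < H k" using neg by (meson not_le)
    have nn: "0 \<le> \<bar>H k\<bar> / w i k" for k using pos[of i k] by (simp add: less_imp_le)
    have "k > J"
    proof (rule ccontr)
      assume "\<not> k > J"
      then have "\<bar>H k\<bar> / w i k \<le> (\<Sum>k\<le>J. \<bar>H k\<bar> / w i k)" by (intro member_le_sum nn) auto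
      then have "\<bar>H k\<bar> / w i k * w i k \<le> B * w i k"
        using pos[of i k] by (intro mult_right_mono) (auto simp: B_def)
      then show False using k pos[of i k] by simp
    qed
    moreover have "real i * w i k \<le> B * w i k"
      using pos[of i k] nn by (intro mult_right_mono) (auto simp: B_def intro!: sum_nonneg)
    ultimately show ?thesis using k by (intro exI[of _ k]) auto
  qed
  have "\<exists>\<kappa>. \<forall>i. real i * w i (\<kappa> i) < H (\<kappa> i) \<and> \<kappa> i < \<kappa> (Suc i)"
    by (rule dependent_nat_choice[where P = "\<lambda>i k. real i * w i k < H k" and Q = "\<lambda>i k k'. k < k'"])
      (use big in blast)+
  then obtain \<kappa> :: "nat \<Rightarrow> nat" where \<kappa>: "\<And>i. real i * w i (\<kappa> i) < H (\<kappa> i)" "strict_mono \<kappa>"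
    by (auto simp: strict_mono_Suc_iff)
  \<comment> \<open>\<open>\<nu> k\<close> is the index of the weight in force at \<open>k\<close>:
    weight \<open>0\<close> up to \<open>\<kappa> 0\<close>, and weight \<open>Suc i\<close> after
    \<open>\<kappa> i\<close> up to and including \<open>\<kappa> (Suc i)\<close>.\<close>
  define \<nu> where "\<nu> k = (LEAST i. k \<le> \<kappa> i)" for k
  have \<nu>: "k \<le> \<kappa> (\<nu> k)" for k
    unfolding \<nu>_def by (rule LeastI[of _ k]) (rule strict_mono_imp_increasing[OF \<kappa>(2)])
  have \<nu>\<kappa>: "\<nu> (\<kappa> i) = i" for i
    unfolding \<nu>_def by (rule Least_equality) (simp_all add: strict_mono_less_eq[OF \<kappa>(2)])
  define a where "a k = w (\<nu> k) k" for k
  have a: "0 < a k" for k by (simp add: a_def pos)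
  have "\<exists>c. \<forall>k. w n k \<le> c * a k" for n
  proof (intro exI allI)
    fix k
    \<comment> \<open>Beyond \<open>\<kappa> n\<close> the glued weight is at least
      \<open>w n\<close>; the sum takes care of the finitely many earlier indices.\<close>
    let ?c = "1 + (\<Sum>k\<le>\<kappa> n. w n k / a k)"
    have nn: "0 \<le> w n k / a k" for k using pos[of n k] a[of k] by (simp add: less_imp_le)
    show "w n k \<le> ?c * a k"
    proof (cases "k \<le> \<kappa> n")
      case True
      then have "w n k / a k \<le> (\<Sum>k\<le>\<kappa> n. w n k / a k)" by (intro member_le_sum nn) auto
      then have "w n k / a k * a k \<le> ?c * a k" using a[of k] by (intro mult_right_mono) auto
      then show ?thesis using a[of k] by simp
    next
      case False
      have "n \<le> \<nu> k"
      proof (rule ccontr)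
        assume "\<not> n \<le> \<nu> k"
        then have "\<kappa> (\<nu> k) \<le> \<kappa> n" by (simp add: strict_mono_less_eq[OF \<kappa>(2)])
        then show False using \<nu>[of k] False by simp
      qed
      then have "w n k \<le> a k" unfolding a_def by (rule mono)
      also have "\<dots> \<le> ?c * a k" using a[of k] sum_nonneg[of "{..\<kappa> n}" "\<lambda>k. w n k / a k"] nn
        by (simp add: distrib_right)
      finally show ?thesis .
    qed
  qed
  with a obtain B where B: "\<And>k. H k \<le> B * a k" using dom[of a] by auto
  obtain i where "B < real i" using reals_Archimedean2 by blast
  then have "B * w i (\<kappa> i) \<le> real i * w i (\<kappa> i)" using pos[of i "\<kappa> i"] by (intro mult_right_mono) auto
  moreover have "a (\<kappa> i) = w i (\<kappa> i)" by (simp add: a_def \<nu>\<kappa>)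
  ultimately show False using \<kappa>(1)[of i] B[of "\<kappa> i"] by simp
qed

text \<open>The powers of \<open>\<rho>\<close> are absorbed into the weight, so that steps of
  different radii can be compared with one sequence at radius \<open>1\<close>.\<close>

lemma wnorm_le_step:
  fixes f :: "'a::euclidean_space \<Rightarrow> 'b::euclidean_space"
  assumes f: "wfin N K \<rho> f" and N: "\<And>k. 0 < N k" "0 < \<rho>" and a: "\<And>k. 0 < a k"
    and c: "\<And>k. \<rho> ^ k * N k \<le> c * a k"
  shows "wfin a K 1 f \<and> wnorm a K 1 f \<le> c * wnorm N K \<rho> f"
proof (rule wnorm_leI)
  have "0 < c * a 0" using c[of 0] N(1)[of 0] by simp
  then have c0: "0 < c" using a[of 0] by (simp add: zero_less_mult_iff)
  then show "0 \<le> c * wnorm N K \<rho> f" using wnorm_nonneg[OF f] by simp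
  fix k x assume "x \<in> K"
  then have "dnorm k f x \<le> wnorm N K \<rho> f * (fact k * (\<rho> ^ k * N k))"
    using dnorm_le_wnorm[OF f _ N(2,1), of x k] by (simp add: mult.assoc)
  also have "\<dots> \<le> wnorm N K \<rho> f * (fact k * (c * a k))"
    by (intro mult_left_mono c wnorm_nonneg[OF f]) auto
  finally show "dnorm k f x \<le> c * wnorm N K \<rho> f * (fact k * 1 ^ k * a k)" by (simp add: mult_ac)
qed (use a in auto)

context
  fixes \<Lambda> :: "real set" and M :: "real \<Rightarrow> nat \<Rightarrow> real"
  assumes wm: "weight_matrix \<Lambda> M"
begin

text \<open>A weight that dominates every step gives a seminorm that is finite on the limit and
  continuous on each step. These are the test seminorms for sequences.\<close>

lemma adm_seminorm_wnorm:
  fixes K :: "'a::euclidean_space set"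
  assumes ex: "exhausting \<Lambda> lam rad" and a: "\<And>k. 0 < a k"
    and dom: "\<And>n. \<exists>c. \<forall>k. real (rad n) ^ k * M (lam n) k \<le> c * a k"
  shows "adm_seminorm \<Lambda> M K (wnorm a K 1 :: ('a \<Rightarrow> 'b::euclidean_space) \<Rightarrow> real)"
    and "(f :: 'a \<Rightarrow> 'b) \<in> EK \<Lambda> M K \<Longrightarrow> wfin a K 1 f"
proof -
  have pos: "0 < M (lam n) k" "0 < real (rad n)" for n k
    using exhaustingD(1,2)[OF ex, of n] weight_matrixD(2)[OF wm] by auto
  have step: "\<exists>c>0. \<forall>f :: 'a \<Rightarrow> 'b. wfin (M (lam n)) K (rad n) f \<longrightarrow> wfin a K 1 f \<and> wnorm a K 1 f \<le> c * wnorm (M (lam n)) K (rad n) f" for n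
  proof -
    obtain c where c: "\<And>k. real (rad n) ^ k * M (lam n) k \<le> c * a k" using dom[of n] by auto
    have "0 < c * a 0" using c[of 0] pos(1)[of n 0] by simp
    then have "0 < c" using a[of 0] by (simp add: zero_less_mult_iff)
    moreover have "wfin a K 1 f \<and> wnorm a K 1 f \<le> c * wnorm (M (lam n)) K (rad n) f"
      if "wfin (M (lam n)) K (rad n) f" for f :: "'a \<Rightarrow> 'b"
      by (rule wnorm_le_step[OF that pos a c])
    ultimately show ?thesis by auto
  qed
  show fin: "wfin a K 1 f" if "f \<in> EK \<Lambda> M K" for f :: "'a \<Rightarrow> 'b"
  proof -
    obtain n where "wfin (M (lam n)) K (rad n) f"
      using \<open>f \<in> EK \<Lambda> M K\<close> EK_iff_exhausting[OF wm ex] by auto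
    then show ?thesis using step[of n] by auto
  qed
  show "adm_seminorm \<Lambda> M K (wnorm a K 1 :: ('a \<Rightarrow> 'b) \<Rightarrow> real)"
    unfolding adm_seminorm_def seminorm_on_def
  proof (intro conjI ballI allI impI)
    fix f g :: "'a \<Rightarrow> 'b" assume f: "f \<in> EK \<Lambda> M K"
    show "0 \<le> wnorm a K 1 f" by (rule wnorm_nonneg[OF fin[OF f]])
    show "wnorm a K 1 (\<lambda>x. c *\<^sub>R f x) = \<bar>c\<bar> * wnorm a K 1 f" for c
      by (rule wnorm_scaleR[OF fin[OF f] EK_smooth[OF f] zero_less_one a])
    assume g: "g \<in> EK \<Lambda> M K"
    show "wnorm a K 1 (\<lambda>x. f x + g x) \<le> wnorm a K 1 f + wnorm a K 1 g"
      using wnorm_add[OF fin[OF f] fin[OF g] EK_smooth[OF f] EK_smooth[OF g] zero_less_one a] by simp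
  next
    fix l and m :: nat assume l: "l \<in> \<Lambda>" and m: "0 < m"
    obtain n where n: "l \<le> lam n" "m \<le> rad n" using exhaustingD(5)[OF ex l] by auto
    obtain c where c: "0 < c" "\<And>f :: 'a \<Rightarrow> 'b. wfin (M (lam n)) K (rad n) f \<Longrightarrow> wnorm a K 1 f \<le> c * wnorm (M (lam n)) K (rad n) f"
      using step[of n] by auto
    show "\<exists>C. \<forall>f :: 'a \<Rightarrow> 'b. smooth f \<and> wfin (M l) K (real m) f \<longrightarrow> wnorm a K 1 f \<le> C * wnorm (M l) K (real m) f"
    proof (intro exI[of _ c] allI impI)
      fix f :: "'a \<Rightarrow> 'b" assume f: "smooth f \<and> wfin (M l) K (real m) f"
      then have f': "wfin (M (lam n)) K (rad n) f" "wnorm (M (lam n)) K (rad n) f \<le> wnorm (M l) K (real m) f"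
        using wnorm_step_mono[OF wm _ l exhaustingD(1)[OF ex] n(1), of K m f "rad n"] n m by auto
      show "wnorm a K 1 f \<le> c * wnorm (M l) K (real m) f"
        using c(2)[OF f'(1)] mult_left_mono[OF f'(2), of c] c(1) by linarith
    qed
  qed
qed

text \<open>The test seminorms show that the supremum \<open>H\<close> of the derivatives over the
  sequence is dominated by every weight that dominates all steps, and
  \<open>dominated_by_one_weight\<close> turns this into a bound in one step. Doubling the radius
  upgrades boundedness to convergence: high orders gain \<open>1 / 2 ^ k\<close> uniformly along the
  sequence, low orders are controlled by one test seminorm.\<close>

lemma null_sequence_in_step:
  fixes h :: "nat \<Rightarrow> 'a::euclidean_space \<Rightarrow> 'b::euclidean_space"
  assumes hE: "\<And>i. h i \<in> EK \<Lambda> M K"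
    and null: "\<And>p. adm_seminorm \<Lambda> M K p \<Longrightarrow> (\<lambda>i. p (h i)) \<longlonglongrightarrow> 0"
  obtains l m where "l \<in> \<Lambda>" "0 < m" "\<And>i. wfin (M l) K (real m) (h i)"
    "(\<lambda>i. wnorm (M l) K (real m) (h i)) \<longlonglongrightarrow> 0"
proof -
  obtain lam rad where ex: "exhausting \<Lambda> lam rad" using ex_exhausting[OF weight_matrixD(1)[OF wm]] by blast
  have Mpos: "0 < M (lam n) k" and rpos: "0 < real (rad n)" for n k
    using exhaustingD(1,2)[OF ex, of n] weight_matrixD(2)[OF wm] by auto
  define w where "w n k = real (rad n) ^ k * M (lam n) k" for n k
  have w: "0 < w n k" for n k using Mpos rpos by (simp add: w_def)
  have wmono: "w i k \<le> w j k" if "i \<le> j" for i j k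
    unfolding w_def using monoD[OF exhaustingD(3)[OF ex] that] monoD[OF exhaustingD(4)[OF ex] that] exhaustingD(1)[OF ex]
    by (intro mult_mono power_mono weight_matrixD(4)[OF wm]) (auto intro: less_imp_le[OF Mpos])
  have bound: "\<exists>B. \<forall>i k. \<forall>x\<in>K. dnorm k (h i) x / fact k \<le> B * a k"
    if a: "\<And>k. 0 < a k" and dom: "\<And>n. \<exists>c. \<forall>k. w n k \<le> c * a k" for a
  proof -
    have *: "adm_seminorm \<Lambda> M K (wnorm a K 1 :: ('a \<Rightarrow> 'b) \<Rightarrow> real)" "wfin a K 1 (h i)" for i
      using adm_seminorm_wnorm[OF ex a dom[unfolded w_def]] hE by auto
    have "Bseq (\<lambda>i. wnorm a K 1 (h i))"
      using null[OF *(1)] convergentI convergent_imp_Bseq by blast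
    then obtain B where B: "\<And>i. \<bar>wnorm a K 1 (h i)\<bar> \<le> B" by (auto simp: Bseq_def)
    have "dnorm k (h i) x / fact k \<le> B * a k" if "x \<in> K" for i k x
    proof -
      have "dnorm k (h i) x \<le> wnorm a K 1 (h i) * (fact k * 1 ^ k * a k)"
        by (rule dnorm_le_wnorm[OF *(2) that zero_less_one a])
      also have "\<dots> \<le> B * (fact k * 1 ^ k * a k)"
        using B[of i] a[of k] by (intro mult_right_mono) auto
      finally show ?thesis by (simp add: field_simps)
    qed
    then show ?thesis by blast
  qed
  \<comment> \<open>The diagonal weight is at least \<open>w n\<close> from \<open>k = n\<close> on,
    so it dominates every step. It shows that \<open>H\<close> is finite and later tests the low
    orders.\<close>
  define b where "b k = w k k" for k
  have b: "0 < b k" for k by (simp add: b_def w)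
  have bdom: "\<exists>c. \<forall>k. w n k \<le> c * b k" for n
  proof (intro exI allI)
    fix k
    let ?c = "1 + (\<Sum>k\<le>n. w n k / b k)"
    have nn: "0 \<le> w n k / b k" for k using w[of n k] b[of k] by (simp add: less_imp_le)
    show "w n k \<le> ?c * b k"
    proof (cases "k \<le> n")
      case True
      then have "w n k / b k \<le> (\<Sum>k\<le>n. w n k / b k)" by (intro member_le_sum nn) auto
      then have "w n k / b k * b k \<le> ?c * b k" using b[of k] by (intro mult_right_mono) auto
      then show ?thesis using b[of k] by simp
    next
      case False
      then have "w n k \<le> b k" unfolding b_def by (intro wmono) simp
      also have "\<dots> \<le> ?c * b k" using b[of k] sum_nonneg[of "{..n}" "\<lambda>k. w n k / b k"] nn
        by (simp add: distrib_right)
      finally show ?thesis .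
    qed
  qed
  \<comment> \<open>The inserted \<open>0\<close> keeps the supremum meaningful for empty
    \<open>K\<close>.\<close>
  define H where "H k = Sup (insert 0 {dnorm k (h i) x / fact k | i x. x \<in> K})" for k
  have bdd: "bdd_above (insert 0 {dnorm k (h i) x / fact k | i x. x \<in> K})" for k
  proof -
    obtain B where "\<And>i k x. x \<in> K \<Longrightarrow> dnorm k (h i) x / fact k \<le> B * b k" using bound[OF b bdom] by auto
    then have "bdd_above {dnorm k (h i) x / fact k | i x. x \<in> K}" by (intro bdd_aboveI[of _ "B * b k"]) auto
    then show ?thesis by simp
  qed
  have Hge: "dnorm k (h i) x / fact k \<le> H k" if "x \<in> K" for i k x
    unfolding H_def by (rule cSup_upper[OF _ bdd]) (use that in auto)
  have H0: "0 \<le> H k" for k unfolding H_def by (rule cSup_upper[OF _ bdd]) simp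
  have "\<exists>n B. \<forall>k. H k \<le> B * w n k"
  proof (rule dominated_by_one_weight[OF w wmono])
    fix a :: "nat \<Rightarrow> real" assume a: "\<And>k. 0 < a k" and dom: "\<And>n. \<exists>c. \<forall>k. w n k \<le> c * a k"
    obtain B where B: "\<And>i k x. x \<in> K \<Longrightarrow> dnorm k (h i) x / fact k \<le> B * a k" using bound[OF a dom] by auto
    have "H k \<le> \<bar>B\<bar> * a k" for k unfolding H_def
    proof (rule cSup_least)
      have "B * a k \<le> \<bar>B\<bar> * a k" using a[of k] by (intro mult_right_mono) auto
      moreover have "0 \<le> \<bar>B\<bar> * a k" using a[of k] by simp
      moreover fix y assume "y \<in> insert 0 {dnorm k (h i) x / fact k | i x. x \<in> K}"
      then have "y = 0 \<or> y \<le> B * a k" using B by auto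
      ultimately show "y \<le> \<bar>B\<bar> * a k" by linarith
    qed simp
    then show "\<exists>B. \<forall>k. H k \<le> B * a k" by blast
  qed
  then obtain n B where HB: "\<And>k. H k \<le> B * w n k" by auto
  have B0: "0 \<le> B" using HB[of 0] H0[of 0] w[of n 0] by (metis mult_less_0_iff not_le order_trans)
  have dB: "dnorm k (h i) x \<le> B * (fact k * real (rad n) ^ k * M (lam n) k)" if "x \<in> K" for i k x
  proof -
    have "dnorm k (h i) x / fact k \<le> B * w n k" using Hge[OF that, of k i] HB[of k] by linarith
    then show ?thesis by (simp add: w_def field_simps)
  qed
  let ?l = "lam n" and ?m = "2 * rad n"
  have m: "0 < ?m" using exhaustingD(2)[OF ex, of n] by simp
  have fin: "wfin (M ?l) K (real ?m) (h i)" for i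
  proof -
    have "wfin (M ?l) K (real (rad n)) (h i)" using wnorm_leI[OF dB B0 rpos Mpos] by simp
    from wnorm_step_mono[OF wm this exhaustingD(1)[OF ex] exhaustingD(1)[OF ex] order_refl rpos, of "real ?m"]
    show ?thesis by simp
  qed
  have small: "\<exists>I. \<forall>i\<ge>I. wnorm (M ?l) K (real ?m) (h i) \<le> \<epsilon>" if \<epsilon>: "0 < \<epsilon>" for \<epsilon>
  proof -
    obtain J where J: "B / \<epsilon> < 2 ^ J" using real_arch_pow[of 2 "B / \<epsilon>"] by auto
    define v where "v k = real ?m ^ k * M ?l k" for k
    have v: "0 < v k" for k using m Mpos by (simp add: v_def)
    \<comment> \<open>\<open>S\<close> compares \<open>b\<close> with the weight of the final step
      for orders up to \<open>J\<close>; hence the tolerance \<open>\<epsilon> / S\<close> for the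
      test seminorm.\<close>
    define S where "S = 1 + (\<Sum>k\<le>J. b k / v k)"
    have nn: "0 \<le> b k / v k" for k using v[of k] b[of k] by (simp add: less_imp_le)
    have S: "1 \<le> S" unfolding S_def using nn by (simp add: sum_nonneg)
    have adm: "adm_seminorm \<Lambda> M K (wnorm b K 1 :: ('a \<Rightarrow> 'b) \<Rightarrow> real)" "wfin b K 1 (h i)" for i
      using adm_seminorm_wnorm[OF ex b bdom[unfolded w_def]] hE by auto
    have "0 < \<epsilon> / S" using \<epsilon> S by simp
    then have "\<forall>\<^sub>F i in sequentially. wnorm b K 1 (h i) < \<epsilon> / S"
      by (rule order_tendstoD(2)[OF null[OF adm(1)]])
    then obtain I where I: "\<And>i. i \<ge> I \<Longrightarrow> wnorm b K 1 (h i) < \<epsilon> / S" by (auto simp: eventually_sequentially)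
    have "wnorm (M ?l) K (real ?m) (h i) \<le> \<epsilon>" if i: "i \<ge> I" for i
    proof (rule conjunct2[OF wnorm_leI])
      fix k x assume x: "x \<in> K"
      show "dnorm k (h i) x \<le> \<epsilon> * (fact k * real ?m ^ k * M ?l k)"
      proof (cases "k \<le> J")
        case True
        then have "b k / v k \<le> (\<Sum>k\<le>J. b k / v k)" by (intro member_le_sum nn) auto
        then have "b k / v k \<le> S" by (simp add: S_def)
        then have bS: "b k \<le> S * v k" using v[of k] by (simp add: pos_divide_le_eq)
        have "dnorm k (h i) x \<le> wnorm b K 1 (h i) * (fact k * 1 ^ k * b k)"
          by (rule dnorm_le_wnorm[OF adm(2) x zero_less_one b])
        also have "\<dots> \<le> \<epsilon> / S * (fact k * (S * v k))"
          using I[OF i] bS \<epsilon> S b[of k] by (intro mult_mono) (auto intro: less_imp_le)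
        also have "\<dots> = \<epsilon> * (fact k * real ?m ^ k * M ?l k)" using S by (simp add: v_def)
        finally show ?thesis .
      next
        case False
        have "B \<le> \<epsilon> * 2 ^ J" using J \<epsilon> by (simp add: field_simps)
        also have "\<dots> \<le> \<epsilon> * 2 ^ k" using False \<epsilon> by (intro mult_left_mono power_increasing) auto
        finally have "B * (fact k * real (rad n) ^ k * M ?l k) \<le> \<epsilon> * 2 ^ k * (fact k * real (rad n) ^ k * M ?l k)"
          using Mpos[of n k] by (intro mult_right_mono) auto
        also have "\<dots> = \<epsilon> * (fact k * real ?m ^ k * M ?l k)" by (simp add: power_mult_distrib)
        finally show ?thesis using dB[OF x, of k i] by linarith
      qed
    qed (use \<epsilon> m Mpos in auto)
    then show ?thesis by blast
  qed
  have "(\<lambda>i. wnorm (M ?l) K (real ?m) (h i)) \<longlonglongrightarrow> 0"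
  proof (rule LIMSEQ_I)
    fix e :: real assume "0 < e"
    then obtain I where I: "\<And>i. i \<ge> I \<Longrightarrow> wnorm (M ?l) K (real ?m) (h i) \<le> e / 2" using small[of "e / 2"] by auto
    have "norm (wnorm (M ?l) K (real ?m) (h i) - 0) < e" if "i \<ge> I" for i
      using I[OF that] wnorm_nonneg[OF fin, of i] \<open>0 < e\<close> by simp
    then show "\<exists>I. \<forall>i\<ge>I. norm (wnorm (M ?l) K (real ?m) (h i) - 0) < e" by blast
  qed
  with fin show ?thesis using exhaustingD(1)[OF ex, of n] m by (intro that[of ?l ?m]) auto
qed

lemma limitin_ER_topD:
  fixes s :: "nat \<Rightarrow> 'a::euclidean_space \<Rightarrow> 'b::euclidean_space"
  assumes lim: "limitin (ER_top \<Lambda> M) s f sequentially" and K: "compact K" and p: "adm_seminorm \<Lambda> M K p"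
    and s: "\<And>i. s i \<in> ER \<Lambda> M"
  shows "(\<lambda>i. p (\<lambda>x. s i x - f x)) \<longlonglongrightarrow> 0"
proof (rule LIMSEQ_I)
  fix e :: real assume e: "0 < e"
  have f: "f \<in> ER \<Lambda> M" using lim by (simp add: limitin_def)
  have "openin (ER_top \<Lambda> M) {g \<in> ER \<Lambda> M. p (\<lambda>x. g x - f x) < e}"
    unfolding ER_top_def
    by (rule topology_generated_by_Basis, rule insertI2, rule CollectI) (use f K p e in blast)
  moreover have "f \<in> {g \<in> ER \<Lambda> M. p (\<lambda>x. g x - f x) < e}"
    using f e adm_seminorm_zero[OF wm p] by simp
  ultimately have "\<forall>\<^sub>F i in sequentially. s i \<in> {g \<in> ER \<Lambda> M. p (\<lambda>x. g x - f x) < e}"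
    using lim unfolding limitin_def by blast
  then obtain I where "\<And>i. i \<ge> I \<Longrightarrow> p (\<lambda>x. s i x - f x) < e" by (auto simp: eventually_sequentially)
  moreover have "0 \<le> p (\<lambda>x. s i x - f x)" for i
    using adm_seminorm_nonneg[OF p] ER_diff[OF wm s f] ER_subset_EK[OF K] by blast
  ultimately show "\<exists>I. \<forall>i\<ge>I. norm (p (\<lambda>x. s i x - f x) - 0) < e" by auto
qed

text \<open>Membership in open sets is reduced to the generating sets by induction. A generating
  ball may be centred away from \<open>f\<close>; the triangle inequality converts its slack at
  \<open>f\<close> into smallness of the difference to \<open>f\<close>.\<close>

lemma limitin_ER_topI:
  fixes s :: "nat \<Rightarrow> 'a::euclidean_space \<Rightarrow> 'b::euclidean_space"
  assumes s: "\<And>i. s i \<in> ER \<Lambda> M" and f: "f \<in> ER \<Lambda> M"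
    and null: "\<And>K p. compact K \<Longrightarrow> adm_seminorm \<Lambda> M K p \<Longrightarrow> (\<lambda>i. p (\<lambda>x. s i x - f x)) \<longlonglongrightarrow> 0"
  shows "limitin (ER_top \<Lambda> M) s f sequentially"
  unfolding limitin_def
proof (intro conjI allI impI)
  fix U assume U: "openin (ER_top \<Lambda> M) U \<and> f \<in> U"
  let ?B = "insert (ER \<Lambda> M) {{g \<in> ER \<Lambda> M. p (\<lambda>x. g x - f x) < \<epsilon>} | f K p \<epsilon>.
        f \<in> ER \<Lambda> M \<and> compact K \<and> adm_seminorm \<Lambda> M K p \<and> \<epsilon> > 0} :: ('a \<Rightarrow> 'b) set set"
  have "generate_topology_on ?B U"
    using U unfolding ER_top_def openin_topology_generated_by_iff by simp
  then have "f \<in> U \<longrightarrow> (\<forall>\<^sub>F i in sequentially. s i \<in> U)"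
  proof (induction rule: generate_topology_on.induct)
    case (Int a b)
    then show ?case by (auto intro: eventually_conj)
  next
    case (UN \<K>)
    show ?case
    proof
      assume "f \<in> \<Union>\<K>"
      then obtain k where k: "k \<in> \<K>" "f \<in> k" by blast
      then have "\<forall>\<^sub>F i in sequentially. s i \<in> k" using UN.IH by blast
      then show "\<forall>\<^sub>F i in sequentially. s i \<in> \<Union>\<K>" by (rule eventually_mono) (use k in blast)
    qed
  next
    case (Basis V)
    then consider "V = ER \<Lambda> M" | k K p \<epsilon> where "V = {g \<in> ER \<Lambda> M. p (\<lambda>x. g x - k x) < \<epsilon>}"
      "k \<in> ER \<Lambda> M" "compact K" "adm_seminorm \<Lambda> M K p" by blast
    then show ?case
    proof cases
      case 1
      then show ?thesis using s by simp
    next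
      case 2
      show ?thesis
      proof
        assume "f \<in> V"
        then have "0 < \<epsilon> - p (\<lambda>x. f x - k x)" using 2 by simp
        then have "\<forall>\<^sub>F i in sequentially. p (\<lambda>x. s i x - f x) < \<epsilon> - p (\<lambda>x. f x - k x)"
          by (rule order_tendstoD(2)[OF null[OF 2(3,4)]])
        then show "\<forall>\<^sub>F i in sequentially. s i \<in> V"
        proof (rule eventually_mono)
          fix i assume "p (\<lambda>x. s i x - f x) < \<epsilon> - p (\<lambda>x. f x - k x)"
          then have "p (\<lambda>x. s i x - k x) < \<epsilon>"
            using adm_seminorm_triangle[OF 2(4) subsetD[OF ER_subset_EK[OF 2(3)] ER_diff[OF wm s[of i] f]]
                subsetD[OF ER_subset_EK[OF 2(3)] ER_diff[OF wm f 2(2)]]] by linarith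
          then show "s i \<in> V" using s by (simp add: 2(1))
        qed
      qed
    qed
  qed simp
  then show "\<forall>\<^sub>F i in sequentially. s i \<in> U" using U by blast
qed (simp add: f)

text \<open>Convergence of the inner functions in one step gives a common bound \<open>A\<close> and
  a ball \<open>L\<close> for all values; after that the outer differences can be placed in one step
  on \<open>L\<close>.\<close>

lemma ER_comp_null_sequence:
  fixes g :: "nat \<Rightarrow> 'p::euclidean_space \<Rightarrow> 'q::euclidean_space" and f :: "nat \<Rightarrow> 'q \<Rightarrow> 'r::euclidean_space"
  assumes FdB: "FdB_Roumieu \<Lambda> M"
    and g: "\<And>i. g i \<in> ER \<Lambda> M" "limitin (ER_top \<Lambda> M) g g\<^sub>0 sequentially"
    and f: "\<And>i. f i \<in> ER \<Lambda> M" "limitin (ER_top \<Lambda> M) f f\<^sub>0 sequentially"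
    and K: "compact K" and p: "adm_seminorm \<Lambda> M K p"
  shows "(\<lambda>i. p (\<lambda>x. (f i \<circ> g i) x - (f\<^sub>0 \<circ> g\<^sub>0) x)) \<longlonglongrightarrow> 0"
proof -
  have g\<^sub>0: "g\<^sub>0 \<in> ER \<Lambda> M" and f\<^sub>0: "f\<^sub>0 \<in> ER \<Lambda> M" using g(2) f(2) by (simp_all add: limitin_def)
  have gK: "(\<lambda>x. g i x - g\<^sub>0 x) \<in> EK \<Lambda> M K" for i using ER_diff[OF wm g(1) g\<^sub>0] ER_subset_EK[OF K] by blast
  have sg: "smooth (g i)" "smooth (f i)" "smooth g\<^sub>0" "smooth f\<^sub>0" for i
    using g(1) f(1) g\<^sub>0 f\<^sub>0 by (auto simp: ER_def)
  have sd: "smooth (\<lambda>x. g i x - g\<^sub>0 x)" "smooth (\<lambda>x. f i x - f\<^sub>0 x)" for i by (intro smooth_diff sg)+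
  obtain l\<^sub>1 m\<^sub>1 where 1: "l\<^sub>1 \<in> \<Lambda>" "0 < m\<^sub>1" "\<And>i. wfin (M l\<^sub>1) K (real m\<^sub>1) (\<lambda>x. g i x - g\<^sub>0 x)"
    "(\<lambda>i. wnorm (M l\<^sub>1) K (real m\<^sub>1) (\<lambda>x. g i x - g\<^sub>0 x)) \<longlonglongrightarrow> 0"
    by (rule null_sequence_in_step[where h = "\<lambda>i x. g i x - g\<^sub>0 x", OF gK limitin_ER_topD[OF g(2) K _ g(1)]]) (assumption, rule that, assumption+)
  obtain l\<^sub>2 m\<^sub>2 where 2: "l\<^sub>2 \<in> \<Lambda>" "0 < m\<^sub>2" "wfin (M l\<^sub>2) K (real m\<^sub>2) g\<^sub>0"
    using g\<^sub>0 K by (auto simp: ER_def)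
  obtain E where E: "\<And>i. wnorm (M l\<^sub>1) K (real m\<^sub>1) (\<lambda>x. g i x - g\<^sub>0 x) \<le> E"
  proof -
    have "Bseq (\<lambda>i. wnorm (M l\<^sub>1) K (real m\<^sub>1) (\<lambda>x. g i x - g\<^sub>0 x))"
      using 1(4) convergentI convergent_imp_Bseq by blast
    then show ?thesis using that by (auto simp: Bseq_def abs_le_iff)
  qed
  \<comment> \<open>\<open>E\<close> bounds all differences and the other summand bounds the limit,
    so the ball of radius \<open>A\<close> serves \<open>g\<^sub>0\<close> and every
    \<open>g i\<close>.\<close>
  define A where "A = E + wnorm (M l\<^sub>2) K (real m\<^sub>2) g\<^sub>0"
  define L where "L = cball (0::'q) A"
  have L: "compact L" "convex L" by (auto simp: L_def)
  have A: "0 \<le> A" using wnorm_nonneg[OF 1(3)] wnorm_nonneg[OF 2(3)] E unfolding A_def by (meson add_nonneg_nonneg order_trans)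
  have fL: "(\<lambda>x. f i x - f\<^sub>0 x) \<in> EK \<Lambda> M L" for i using ER_diff[OF wm f(1) f\<^sub>0] ER_subset_EK[OF L(1)] by blast
  obtain l\<^sub>3 m\<^sub>3 where 3: "l\<^sub>3 \<in> \<Lambda>" "0 < m\<^sub>3" "\<And>i. wfin (M l\<^sub>3) L (real m\<^sub>3) (\<lambda>x. f i x - f\<^sub>0 x)"
    "(\<lambda>i. wnorm (M l\<^sub>3) L (real m\<^sub>3) (\<lambda>x. f i x - f\<^sub>0 x)) \<longlonglongrightarrow> 0"
    by (rule null_sequence_in_step[where h = "\<lambda>i x. f i x - f\<^sub>0 x", OF fL limitin_ER_topD[OF f(2) L(1) _ f(1)]]) (assumption, rule that, assumption+)
  obtain l\<^sub>4 m\<^sub>4 where 4: "l\<^sub>4 \<in> \<Lambda>" "0 < m\<^sub>4" "wfin (M l\<^sub>4) L (real m\<^sub>4) f\<^sub>0"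
    using f\<^sub>0 L by (auto simp: ER_def)
  \<comment> \<open>A common step for both differences and both limits; the maximum of the four
    indices is one of them and thus lies in \<open>\<Lambda>\<close>.\<close>
  define l where "l = Max {l\<^sub>1, l\<^sub>2, l\<^sub>3, l\<^sub>4}"
  define m where "m = Max {m\<^sub>1, m\<^sub>2, m\<^sub>3, m\<^sub>4}"
  have "l \<in> {l\<^sub>1, l\<^sub>2, l\<^sub>3, l\<^sub>4}" unfolding l_def by (rule Max_in) auto
  then have l: "l \<in> \<Lambda>" "l\<^sub>1 \<le> l" "l\<^sub>2 \<le> l" "l\<^sub>3 \<le> l" "l\<^sub>4 \<le> l" using 1 2 3 4 by (auto simp: l_def)
  have m: "real m\<^sub>1 \<le> real m" "real m\<^sub>2 \<le> real m" "real m\<^sub>3 \<le> real m" "real m\<^sub>4 \<le> real m" by (simp_all add: m_def)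
  have m0: "0 < real m" using 1(2) m by linarith
  have N: "\<And>k. 0 < M l k" "M l 0 = 1" using weight_matrixD[OF wm] l by auto
  have dg: "wfin (M l) K (real m) (\<lambda>x. g i x - g\<^sub>0 x)"
      "wnorm (M l) K (real m) (\<lambda>x. g i x - g\<^sub>0 x) \<le> wnorm (M l\<^sub>1) K (real m\<^sub>1) (\<lambda>x. g i x - g\<^sub>0 x)" for i
    using wnorm_step_mono[OF wm 1(3) 1(1) l(1,2) _ m(1), of i] 1(2) by auto
  have g0: "wfin (M l) K (real m) g\<^sub>0" "wnorm (M l) K (real m) g\<^sub>0 \<le> wnorm (M l\<^sub>2) K (real m\<^sub>2) g\<^sub>0"
    using wnorm_step_mono[OF wm 2(3) 2(1) l(1,3) _ m(2)] 2(2) by auto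
  have df: "wfin (M l) L (real m) (\<lambda>x. f i x - f\<^sub>0 x)"
      "wnorm (M l) L (real m) (\<lambda>x. f i x - f\<^sub>0 x) \<le> wnorm (M l\<^sub>3) L (real m\<^sub>3) (\<lambda>x. f i x - f\<^sub>0 x)" for i
    using wnorm_step_mono[OF wm 3(3) 3(1) l(1,4) _ m(3), of i] 3(2) by auto
  have f0: "wfin (M l) L (real m) f\<^sub>0"
    using wnorm_step_mono[OF wm 4(3) 4(1) l(1,5) _ m(4)] 4(2) by auto
  have gi: "wfin (M l) K (real m) (g i)" "wnorm (M l) K (real m) (g i) \<le> A" for i
    using wnorm_add[OF dg(1) g0(1) sd(1) sg(3) m0 N(1), of i] dg(2)[of i] g0(2) E[of i] by (auto simp: A_def)
  have "0 \<le> E" using wnorm_nonneg[OF 1(3), of 0] E[of 0] by linarith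
  then have g0A: "wnorm (M l) K (real m) g\<^sub>0 \<le> A" using g0(2) by (simp add: A_def)
  have gL: "g i ` K \<subseteq> L" "g\<^sub>0 ` K \<subseteq> L" for i
    unfolding L_def by (intro wnorm_image_subset_cball[OF gi m0 N] wnorm_image_subset_cball[OF g0(1) g0A m0 N])+
  obtain C where C: "0 < C" "\<And>(f :: 'q \<Rightarrow> 'r) (g :: 'p \<Rightarrow> 'q). \<lbrakk>smooth f; smooth g; wfin (M l) L (real m) f; wfin (M l) K (real m) g;
      wnorm (M l) K (real m) g \<le> A; g ` K \<subseteq> L\<rbrakk> \<Longrightarrow> f \<circ> g \<in> EK \<Lambda> M K \<and> p (f \<circ> g) \<le> C * wnorm (M l) L (real m) f"
    by (rule adm_seminorm_comp_le[OF wm FdB p l(1) m0 m0 A]) (rule that, assumption+)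
  show ?thesis
  proof (rule LIMSEQ_I)
    fix e :: real assume e: "0 < e"
    then have e2: "0 < e / 2" by simp
    obtain \<delta> where \<delta>: "0 < \<delta>" "\<And>g h :: 'p \<Rightarrow> 'q. \<lbrakk>smooth g; smooth h; g ` K \<subseteq> L; h ` K \<subseteq> L;
      wfin (M l) K (real m) g; wfin (M l) K (real m) h; wnorm (M l) K (real m) g \<le> A; wnorm (M l) K (real m) h \<le> A;
      wnorm (M l) K (real m) (\<lambda>x. g x - h x) \<le> \<delta>\<rbrakk>
      \<Longrightarrow> (\<lambda>x. (f\<^sub>0 \<circ> g) x - (f\<^sub>0 \<circ> h) x) \<in> EK \<Lambda> M K \<and> p (\<lambda>x. (f\<^sub>0 \<circ> g) x - (f\<^sub>0 \<circ> h) x) \<le> e / 2"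
      by (rule adm_seminorm_comp_uniformly_continuous[OF wm FdB p l(1) m0 m0 A sg(4) f0 L(2) e2])
        (rule that, assumption+)
    have "\<forall>\<^sub>F i in sequentially. wnorm (M l\<^sub>1) K (real m\<^sub>1) (\<lambda>x. g i x - g\<^sub>0 x) < \<delta>"
      by (rule order_tendstoD(2)[OF 1(4) \<delta>(1)])
    moreover have "\<forall>\<^sub>F i in sequentially. wnorm (M l\<^sub>3) L (real m\<^sub>3) (\<lambda>x. f i x - f\<^sub>0 x) < e / (2 * C)"
      by (rule order_tendstoD(2)[OF 3(4)]) (use e C in simp)
    ultimately have "\<forall>\<^sub>F i in sequentially. norm (p (\<lambda>x. (f i \<circ> g i) x - (f\<^sub>0 \<circ> g\<^sub>0) x) - 0) < e"
    proof eventually_elim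
      case (elim i)
      \<comment> \<open>The error from the outer function and the error from the inner function each
        receive half of \<open>e\<close>.\<close>
      have a: "(\<lambda>x. f i x - f\<^sub>0 x) \<circ> g i \<in> EK \<Lambda> M K"
          "p ((\<lambda>x. f i x - f\<^sub>0 x) \<circ> g i) \<le> C * wnorm (M l) L (real m) (\<lambda>x. f i x - f\<^sub>0 x)"
        using C(2)[OF sd(2) sg(1) df(1) gi gL(1)] by auto
      have "C * wnorm (M l) L (real m) (\<lambda>x. f i x - f\<^sub>0 x) < C * (e / (2 * C))"
        using elim(2) df(2)[of i] C(1) by (intro mult_strict_left_mono) auto
      then have a': "p (\<lambda>x. (f i \<circ> g i) x - (f\<^sub>0 \<circ> g i) x) < e / 2"
        using a(2) C(1) by (simp add: comp_def)
      have aE: "(\<lambda>x. (f i \<circ> g i) x - (f\<^sub>0 \<circ> g i) x) \<in> EK \<Lambda> M K" using a(1) by (simp add: comp_def)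
      have c: "(\<lambda>x. (f\<^sub>0 \<circ> g i) x - (f\<^sub>0 \<circ> g\<^sub>0) x) \<in> EK \<Lambda> M K \<and> p (\<lambda>x. (f\<^sub>0 \<circ> g i) x - (f\<^sub>0 \<circ> g\<^sub>0) x) \<le> e / 2"
        using elim(1) dg(2)[of i] by (intro \<delta>(2) sg gL gi g0(1) g0A) auto
      have "p (\<lambda>x. (f i \<circ> g i) x - (f\<^sub>0 \<circ> g\<^sub>0) x) < e"
        using adm_seminorm_triangle[OF p aE conjunct1[OF c]] a' c by linarith
      moreover have "0 \<le> p (\<lambda>x. (f i \<circ> g i) x - (f\<^sub>0 \<circ> g\<^sub>0) x)"
        using ER_diff[OF wm ER_comp[OF wm FdB f(1) g(1)] ER_comp[OF wm FdB f\<^sub>0 g\<^sub>0]] ER_subset_EK[OF K]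
        by (intro adm_seminorm_nonneg[OF p]) blast
      ultimately show ?case by simp
    qed
    then show "\<exists>I. \<forall>i\<ge>I. norm (p (\<lambda>x. (f i \<circ> g i) x - (f\<^sub>0 \<circ> g\<^sub>0) x) - 0) < e"
      by (simp add: eventually_sequentially)
  qed
qed

theorem seq_continuous_map_comp_Roumieu:
  assumes FdB: "FdB_Roumieu \<Lambda> M"
  shows "seq_continuous_map (prod_topology (ER_top \<Lambda> M :: ('p::euclidean_space \<Rightarrow> 'q::euclidean_space) topology)
      (ER_top \<Lambda> M :: ('q \<Rightarrow> 'r::euclidean_space) topology)) (ER_top \<Lambda> M :: ('p \<Rightarrow> 'r) topology) (\<lambda>(g, f). f \<circ> g)"
    (is "seq_continuous_map ?X _ ?c")
  unfolding seq_continuous_map_def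
proof (intro conjI allI impI)
  show "?c ` topspace ?X \<subseteq> topspace (ER_top \<Lambda> M)" using ER_comp[OF wm FdB] by auto
  fix s :: "nat \<Rightarrow> ('p \<Rightarrow> 'q) \<times> ('q \<Rightarrow> 'r)" and z
  assume "(\<forall>n. s n \<in> topspace ?X) \<and> limitin ?X s z sequentially"
  then have s: "\<And>n. fst (s n) \<in> ER \<Lambda> M" "\<And>n. snd (s n) \<in> ER \<Lambda> M"
    and lim: "limitin (ER_top \<Lambda> M) (fst \<circ> s) (fst z) sequentially" "limitin (ER_top \<Lambda> M) (snd \<circ> s) (snd z) sequentially"
    by (auto simp: limitin_pairwise mem_Times_iff)
  have z: "fst z \<in> ER \<Lambda> M" "snd z \<in> ER \<Lambda> M" using lim by (simp_all add: limitin_def)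
  have "limitin (ER_top \<Lambda> M) (\<lambda>n. snd (s n) \<circ> fst (s n)) (snd z \<circ> fst z) sequentially"
  proof (rule limitin_ER_topI)
    fix K and p :: "('p \<Rightarrow> 'r) \<Rightarrow> real" assume "compact K" "adm_seminorm \<Lambda> M K p"
    then show "(\<lambda>i. p (\<lambda>x. (snd (s i) \<circ> fst (s i)) x - (snd z \<circ> fst z) x)) \<longlonglongrightarrow> 0"
      using ER_comp_null_sequence[OF FdB _ lim(1) _ lim(2)] s by simp
  qed (intro ER_comp[OF wm FdB] s z)+
  then show "limitin (ER_top \<Lambda> M) (?c \<circ> s) (?c z) sequentially"
    by (simp add: comp_def case_prod_beta)
qed

end

theorem theorem4p13:
  fixes \<Lambda> :: "real set" and M :: "real \<Rightarrow> nat \<Rightarrow> real"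
  assumes "weight_matrix \<Lambda> M"
  shows "(FdB_Beurling \<Lambda> M \<longrightarrow>
           continuous_map (prod_topology (EB_top \<Lambda> M :: ('p::euclidean_space \<Rightarrow> 'q::euclidean_space) topology)
                                          (EB_top \<Lambda> M :: ('q \<Rightarrow> 'r::euclidean_space) topology))
             (EB_top \<Lambda> M :: ('p \<Rightarrow> 'r) topology) (\<lambda>(g, f). f \<circ> g))
       \<and> (FdB_Roumieu \<Lambda> M \<longrightarrow>
           (\<forall>f \<in> (ER \<Lambda> M :: ('q \<Rightarrow> 'r) set).
              continuous_map (ER_top \<Lambda> M :: ('p \<Rightarrow> 'q) topology) (ER_top \<Lambda> M :: ('p \<Rightarrow> 'r) topology)
                (\<lambda>g. f \<circ> g))
         \<and> seq_continuous_map (prod_topology (ER_top \<Lambda> M :: ('p \<Rightarrow> 'q) topology)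
                                              (ER_top \<Lambda> M :: ('q \<Rightarrow> 'r) topology))
             (ER_top \<Lambda> M :: ('p \<Rightarrow> 'r) topology) (\<lambda>(g, f). f \<circ> g))"
  by (intro conjI impI ballI continuous_map_comp_Beurling continuous_map_comp_Roumieu
      seq_continuous_map_comp_Roumieu assms)

end
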